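(* For every integer $d\ge 1$ there is a constant $c_d>0$, depending only on $d$, such that the following holds. Let $C\subset\mathbb{R}^2$ be a plane algebraic curve of degree $d$ that does not contain a line or a circle. Then any set of $n$ points on $C$ determines at least $c_d\, n^{4/3}$ distinct distances.
   Context: A plane algebraic curve is an infinite set of the form $Z_{\mathbb{R}}(f)=\{(a,b)\in\mathbb{R}^2 : f(a,b)=0\}$ for some nonzero polynomial $f\in\mathbb{R}[x,y]$; its degree is the minimum degree of a polynomial $f$ with $C=Z_{\mathbb{R}}(f)$. The distances determined by a point set $S$ are the Euclidean distances $|pq|$ for $p\neq q\in S$.
   Formalization: The bound is stated for sets of n ≥ 2 points: a single point determines no distances, so the inequality with a positive constant fails for n = 1. *)

theory Defs
  imports Complex_Main
begin

text \<open>Bivariate real polynomials are represented by coefficient functions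
  a :: nat => nat => real, where a i j is the coefficient of x^i y^j.\<close>

definition poly2_deg_le :: "(nat \<Rightarrow> nat \<Rightarrow> real) \<Rightarrow> nat \<Rightarrow> bool" where
  "poly2_deg_le a N \<longleftrightarrow> (\<forall>i j. a i j \<noteq> 0 \<longrightarrow> i + j \<le> N)"

definition poly2_nonzero :: "(nat \<Rightarrow> nat \<Rightarrow> real) \<Rightarrow> bool" where
  "poly2_nonzero a \<longleftrightarrow> (\<exists>i j. a i j \<noteq> 0)"

definition poly2_eval :: "(nat \<Rightarrow> nat \<Rightarrow> real) \<Rightarrow> nat \<Rightarrow> real \<Rightarrow> real \<Rightarrow> real" where
  "poly2_eval a N x y = (\<Sum>i\<le>N. \<Sum>j\<le>N. a i j * x ^ i * y ^ j)"

definition zero_set2 :: "(nat \<Rightarrow> nat \<Rightarrow> real) \<Rightarrow> nat \<Rightarrow> (real \<times> real) set" where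
  "zero_set2 a N = {(x, y). poly2_eval a N x y = 0}"

definition curve_deg_le :: "(real \<times> real) set \<Rightarrow> nat \<Rightarrow> bool" where
  "curve_deg_le C N \<longleftrightarrow>
     (\<exists>a. poly2_deg_le a N \<and> poly2_nonzero a \<and> C = zero_set2 a N)"

definition algebraic_curve_of_degree :: "(real \<times> real) set \<Rightarrow> nat \<Rightarrow> bool" where
  "algebraic_curve_of_degree C d \<longleftrightarrow>
     infinite C \<and> curve_deg_le C d \<and> (\<forall>d'<d. \<not> curve_deg_le C d')"

definition contains_line :: "(real \<times> real) set \<Rightarrow> bool" where
  "contains_line C \<longleftrightarrow>
     (\<exists>a b c. (a \<noteq> 0 \<or> b \<noteq> 0) \<and> {(x, y). a * x + b * y = c} \<subseteq> C)"

definition contains_circle :: "(real \<times> real) set \<Rightarrow> bool" where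
  "contains_circle C \<longleftrightarrow>
     (\<exists>p q r. r > 0 \<and> {(x, y). (x - p)^2 + (y - q)^2 = r^2} \<subseteq> C)"

definition eucl_dist2 :: "real \<times> real \<Rightarrow> real \<times> real \<Rightarrow> real" where
  "eucl_dist2 u v = sqrt ((fst u - fst v)^2 + (snd u - snd v)^2)"

definition distances :: "(real \<times> real) set \<Rightarrow> real set" where
  "distances P = {eucl_dist2 u v | u v. u \<in> P \<and> v \<in> P \<and> u \<noteq> v}"

end

theory Submission
  imports Defs "HOL-Analysis.Analysis" "Subresultants.Subresultant_Gcd"
    "HOL-Computational_Algebra.Field_as_Ring"
begin

text \<open>Pigeonholing over the factors of the defining polynomial, we may assume that the curve is
  \<open>f = 0\<close> with \<open>f\<close> irreducible. By Cauchy-Schwarz it suffices to show that the number of quadruples with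
  \<open>|p q| = |p' q'|\<close> is \<open>O(n\<^sup>8\<^sup>/\<^sup>3)\<close>. For each pair \<open>(p, p')\<close> count the points \<open>(q, q')\<close> of the grid
  \<open>P \<times> P\<close> on the curve \<open>|p q| = |p' q'|\<close>. Since the grid is a Cartesian product, no general incidence
  theorem is needed: cut the curve into arcs containing at most \<open>s\<close> points of \<open>P\<close> each, so that the grid
  splits into cells. On an arc the distance to \<open>p\<close> sweeps an interval, and by the intermediate value
  theorem each value lies in boundedly many of these intervals, because a circle meets the curve in
  boundedly many points; hence each \<open>(p, p')\<close> meets only \<open>O(n/s)\<close> cells. Inside the cells one counts
  pairs of grid points, any two of which lie on boundedly many of the curves unless they are
  exceptionally related. With \<open>s = n\<^sup>1\<^sup>/\<^sup>3\<close> this gives the bound.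

  If some \<open>(q0, q0')\<close> were related to too many other pairs, many of the curves would share a
  component, along which \<open>p'\<close> is an affine function \<open>U\<close> of \<open>p\<close>, determined by three distances. The
  conditions \<open>|p q| = |U(p) q'|\<close> extend from the points to the whole curve by Bezout, in \<open>p\<close> and then also in \<open>q\<close>;
  putting \<open>q = p\<close> shows that \<open>U\<close> is an isometry of the curve taking \<open>q0\<close> to \<open>q0'\<close>. A curve without lines
  and circles has boundedly many isometries, so only \<open>O(n)\<close> pairs are exceptional.\<close>

section \<open>Evaluation of bivariate polynomials and resultants\<close>

text \<open>Two error terms compete: about n^2 * (n/s) for the cells that are hit and n^2 * s^2 for
  pairs of grid points in a common cell. They balance at s = n^(1/3), which is where the exponent
  comes from. The obstacle is that p' is not a polynomial function of p. Prescribing its distances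
  to two points leaves a square root to be chosen, and that root need not be real. Partners are
  therefore sought among the complex zeros of \<open>f\<close>, and the norm from a double cover
  removes the choice of root, so that a Bezout count applies. Everything else stays real: centres,
  radii and affine maps have real coefficients, so divisibility by the real irreducible
  \<open>f\<close> always decides, and a real affine map brings the partner of a real point back to
  a real point. Squared distance replaces distance throughout because it is a polynomial. Of the
  isometries of the curve only the orbits of points are bounded, never the group itself. All
  constants are explicit functions of \<open>d\<close>, so that they can be fixed before the curve
  is chosen.\<close>

definition evx :: "real poly \<Rightarrow> 'a::real_field \<Rightarrow> 'a" where
  "evx c x = poly (map_poly of_real c) x"

text \<open>The outer variable is y, and the coefficients are polynomials in x. The target field is
  left open so that one real polynomial has both real points and complex zeros.\<close>

definition ev :: "real poly poly \<Rightarrow> 'a::real_field \<Rightarrow> 'a \<Rightarrow> 'a" where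
  "ev f x y = poly (map_poly (\<lambda>c. evx c x) f) y"

lemma comm_ring_hom_evx: "comm_ring_hom (\<lambda>c. evx c (x::'a::real_field))"
proof -
  interpret of_real: comm_ring_hom "of_real :: real \<Rightarrow> 'a"
    by unfold_locales auto
  interpret m: map_poly_comm_ring_hom "of_real :: real \<Rightarrow> 'a" ..
  show ?thesis
    by unfold_locales (auto simp: evx_def m.hom_add m.hom_mult)
qed

lemma comm_ring_hom_ev: "comm_ring_hom (\<lambda>f. ev f (x::'a::real_field) y)"
proof -
  interpret e: comm_ring_hom "\<lambda>c. evx c x" by (rule comm_ring_hom_evx)
  interpret m: map_poly_comm_ring_hom "\<lambda>c. evx c x" ..
  show ?thesis
    by unfold_locales (auto simp: ev_def m.hom_add m.hom_mult)
qed

lemma evx_simps [simp]: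
  "evx 0 x = 0" "evx 1 x = 1" "evx (p + q) x = evx p x + evx q x"
  "evx (p * q) x = evx p x * evx q x" "evx (- p) x = - evx p x"
  "evx (p - q) x = evx p x - evx q x"
proof -
  interpret e: comm_ring_hom "\<lambda>c. evx c x" by (rule comm_ring_hom_evx)
  show "evx 0 x = 0" "evx 1 x = 1" "evx (p + q) x = evx p x + evx q x"
  "evx (p * q) x = evx p x * evx q x" "evx (- p) x = - evx p x"
  "evx (p - q) x = evx p x - evx q x"
    by (simp_all add: e.hom_add e.hom_mult e.hom_uminus e.hom_minus)
qed

lemma ev_simps [simp]:
  "ev 0 x y = 0" "ev 1 x y = 1" "ev (p + q) x y = ev p x y + ev q x y"
  "ev (p * q) x y = ev p x y * ev q x y" "ev (- p) x y = - ev p x y"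
  "ev (p - q) x y = ev p x y - ev q x y"
proof -
  interpret e: comm_ring_hom "\<lambda>c. ev c x y" by (rule comm_ring_hom_ev)
  show "ev 0 x y = 0" "ev 1 x y = 1" "ev (p + q) x y = ev p x y + ev q x y"
  "ev (p * q) x y = ev p x y * ev q x y" "ev (- p) x y = - ev p x y"
  "ev (p - q) x y = ev p x y - ev q x y"
    by (simp_all add: e.hom_add e.hom_mult e.hom_uminus e.hom_minus)
qed

lemma evx_pCons [simp]: "evx (pCons a p) x = of_real a + x * evx p x"
  by (simp add: evx_def Polynomial.map_poly_pCons)

lemma ev_pCons [simp]: "ev (pCons c f) x y = evx c x + y * ev f x y"
  by (simp add: ev_def Polynomial.map_poly_pCons)

lemma ev_altdef: "ev f x y = (\<Sum>i\<le>degree f. evx (coeff f i) x * y ^ i)"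
proof (induction f)
  case (pCons c f)
  then show ?case
    by (cases "f = 0")
      (auto simp: sum.atMost_Suc_shift sum_distrib_left mult_ac simp del: sum.atMost_Suc)
qed simp

lemma evx_altdef: "evx c x = (\<Sum>i\<le>degree c. of_real (coeff c i) * x ^ i)"
proof (induction c)
  case (pCons c f)
  then show ?case
    by (cases "f = 0")
      (auto simp: sum.atMost_Suc_shift sum_distrib_left mult_ac simp del: sum.atMost_Suc)
qed simp

lemma evx_real [simp]: "evx c (x::real) = poly c x"
  by (simp add: evx_altdef poly_altdef)

lemma evx_of_real [simp]: "evx c (of_real x) = of_real (poly c x)"
  by (simp add: evx_altdef poly_altdef)

lemma ev_of_real: "ev f (of_real x) (of_real y) = of_real (ev f x y)"
  by (simp add: ev_altdef)

lemma evx_roots: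
  assumes "h \<noteq> 0"
  shows "finite {x::'a::real_field. evx h x = 0}" "card {x::'a. evx h x = 0} \<le> degree h"
proof -
  have *: "map_poly (of_real :: real \<Rightarrow> 'a) h \<noteq> 0"
    using assms by (simp add: map_poly_eq_0_iff)
  show "finite {x::'a. evx h x = 0}"
    unfolding evx_def using poly_roots_finite[OF *] .
  have "card {x::'a. evx h x = 0} \<le> degree (map_poly (of_real :: real \<Rightarrow> 'a) h)"
    unfolding evx_def using card_poly_roots_bound[OF *] .
  then show "card {x::'a. evx h x = 0} \<le> degree h"
    by (metis degree_map_poly_le le_trans)
qed

section \<open>Bidegree bounds and the resultant with respect to y\<close>

definition bideg_le :: "real poly poly \<Rightarrow> nat \<Rightarrow> bool" where
  "bideg_le f N \<longleftrightarrow> degree f \<le> N \<and> (\<forall>i. degree (coeff f i) \<le> N)"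

lemma bideg_le_mono: "bideg_le f M \<Longrightarrow> M \<le> N \<Longrightarrow> bideg_le f N"
  by (meson bideg_le_def le_trans)

lemma bideg_le_add: "bideg_le f M \<Longrightarrow> bideg_le g M \<Longrightarrow> bideg_le (f + g) M"
  by (auto simp: bideg_le_def intro: degree_add_le)

lemma bideg_le_mult:
  assumes "bideg_le f M" "bideg_le g N"
  shows "bideg_le (f * g) (M + N)"
  unfolding bideg_le_def
proof (intro conjI allI)
  show "degree (f * g) \<le> M + N"
    using assms degree_mult_le[of f g] by (auto simp: bideg_le_def)
  fix i
  show "degree (coeff (f * g) i) \<le> M + N"
    unfolding coeff_mult
  proof (rule degree_sum_le)
    fix j assume "j \<in> {..i}"
    have "degree (coeff f j * coeff g (i - j)) \<le> degree (coeff f j) + degree (coeff g (i - j))"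
      by (rule degree_mult_le)
    also have "\<dots> \<le> M + N" using assms by (auto simp: bideg_le_def intro: add_mono)
    finally show "degree (coeff f j * coeff g (i - j)) \<le> M + N" .
  qed simp
qed

text \<open>Evaluated at x, the Sylvester matrix kills the vector of powers of y, since its rows are
  the coefficient lists of multiples of two polynomials that vanish at y. The matrix keeps the
  formal degrees \<open>m\<close> and \<open>n\<close>, so the argument also covers those x at which
  a leading coefficient vanishes.\<close>

lemma resultant_common_zero:
  fixes x y :: "'a::real_field"
  assumes "ev f x y = 0" "ev g x y = 0" "degree f > 0"
  shows "evx (resultant f g) x = 0"
proof -
  define h where "h = (\<lambda>c. evx c x)"
  define m where "m = degree f"
  define n where "n = degree g"
  define F where "F = map_poly h f"
  define G where "G = map_poly h g"
  interpret e: comm_ring_hom h unfolding h_def by (rule comm_ring_hom_evx)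
  have h0: "h 0 = 0" by simp
  define S where "S = sylvester_mat_sub m n F G"
  have S: "S \<in> carrier_mat (m + n) (m + n)" by (simp add: S_def sylvester_mat_sub_carrier)
  have "map_mat h (sylvester_mat f g) = S"
    unfolding S_def sylvester_mat_def m_def n_def F_def G_def
    by (rule sylvester_mat_sub_map) (rule h0)
  then have det: "evx (resultant f g) x = det S"
    by (metis resultant_def e.hom_det h_def)
  have dF: "degree F \<le> m" and dG: "degree G \<le> n"
    by (auto simp: F_def G_def m_def n_def degree_map_poly_le)
  have F0: "poly F y = 0" and G0: "poly G y = 0"
    using assms by (auto simp: F_def G_def ev_def h_def)
  define v where "v = vec (m + n) (\<lambda>j. y ^ (m + n - 1 - j))"
  have v: "v \<in> carrier_vec (m + n)" by (simp add: v_def)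
  have mn: "m + n > 0" using assms by (simp add: m_def)
  have "v $ (m + n - 1) = 1" using mn by (simp add: v_def)
  then have v0: "v \<noteq> 0\<^sub>v (m + n)" using mn by auto
  have row: "(\<Sum>j<m+n. coeff q (m + n - 1 - j) * y ^ (m + n - 1 - j)) = poly q y"
    if "degree q < m + n" for q :: "'a poly"
  proof -
    have "(\<Sum>j<m+n. coeff q (m + n - 1 - j) * y ^ (m + n - 1 - j)) = (\<Sum>k<m+n. coeff q k * y ^ k)"
      by (rule sum.reindex_bij_witness[where i="\<lambda>k. m+n-1-k" and j="\<lambda>k. m+n-1-k"]) auto
    also have "\<dots> = (\<Sum>k\<le>degree q. coeff q k * y ^ k)"
      by (rule sum.mono_neutral_right) (use that in \<open>auto simp: coeff_eq_0 not_le\<close>)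
    finally show ?thesis by (simp add: poly_altdef)
  qed
  have "S *\<^sub>v v = 0\<^sub>v (m + n)"
  proof (rule eq_vecI)
    fix i assume "i < dim_vec (0\<^sub>v (m + n))"
    then have i: "i < m + n" by simp
    \<comment> \<open>The polynomial whose coefficients form row i: shifts of \<open>F\<close> in
      the upper n rows, shifts of \<open>G\<close> in the lower m rows.\<close>
    define q where "q = (if i < n then monom 1 (n - 1 - i) * F else monom 1 (m + n - 1 - i) * G)"
    have ent: "S $$ (i, j) = coeff q (m + n - 1 - j)" if j: "j < m + n" for j
    proof (cases "i < n")
      case True
      have *: "\<not> m + i < j \<Longrightarrow> m + n - Suc j - (n - Suc i) = m + i - j" "m + i < j \<Longrightarrow> m + n - Suc j < n - Suc i"
        using True j by auto
      show ?thesis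
        using True i j dF *
        by (auto simp: S_def sylvester_mat_sub_index q_def coeff_monom_mult coeff_eq_0)
    next
      case False
      have *: "j \<le> i \<Longrightarrow> m + n - Suc j - (m + n - Suc i) = i - j" 
        "\<not> i - n \<le> j \<Longrightarrow> n < i - j"
        using False i j by auto
      show ?thesis
        using False i j dG *
        by (auto simp: S_def sylvester_mat_sub_index q_def coeff_monom_mult coeff_eq_0)
    qed
    have dq: "degree q < m + n"
    proof (cases "i < n")
      case True
      have "degree q \<le> (n - 1 - i) + m"
        unfolding q_def using True order_trans[OF degree_mult_le add_mono[OF degree_monom_le[of "1::'a" "n - 1 - i"] dF]]
        by simp
      then show ?thesis using True by linarith
    next
      case False
      have "degree q \<le> (m + n - 1 - i) + n"
        unfolding q_def using False order_trans[OF degree_mult_le add_mono[OF degree_monom_le dG]]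
        by auto
      then show ?thesis using False i by linarith
    qed
    have "(S *\<^sub>v v) $ i = (\<Sum>j<m+n. S $$ (i, j) * y ^ (m + n - 1 - j))"
      using i S by (auto simp: scalar_prod_def v_def atLeast0LessThan intro!: sum.cong)
    also have "\<dots> = (\<Sum>j<m+n. coeff q (m + n - 1 - j) * y ^ (m + n - 1 - j))"
      using ent by simp
    also have "\<dots> = poly q y" using row[OF dq] .
    also have "\<dots> = 0" using F0 G0 by (simp add: q_def)
    finally show "(S *\<^sub>v v) $ i = 0\<^sub>v (m + n) $ i" using i by simp
  qed (use S in auto)
  then have "det S = 0" using det_0_iff_vec_prod_zero_field[OF S] v v0 by blast
  then show ?thesis using det by simp
qed

lemma degree_resultant_le:
  assumes "bideg_le f d" "bideg_le g e"
  shows "degree (resultant f g) \<le> (d + e) * (d + e)"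
proof -
  have "degree (det (sylvester_mat f g)) \<le> (d + e) * (degree f + degree g)"
  proof (rule degree_det_le)
    fix i j assume "i < degree f + degree g" "j < degree f + degree g"
    then show "degree (sylvester_mat f g $$ (i, j)) \<le> d + e"
      using assms by (auto simp: sylvester_index_mat bideg_le_def intro: trans_le_add1 trans_le_add2)
  qed (rule sylvester_carrier_mat)
  also have "\<dots> \<le> (d + e) * (d + e)"
    using assms by (intro mult_left_mono add_mono) (auto simp: bideg_le_def)
  finally show ?thesis by (simp add: resultant_def)
qed

text \<open>A vanishing resultant gives a common factor of positive degree in y. It is a nonunit
  dividing the irreducible \<open>f\<close>, hence an associate of \<open>f\<close>.\<close>

lemma resultant_irreducible_nonzero:
  fixes f g :: "real poly poly"
  assumes "irreducible f" "\<not> f dvd g"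
  shows "resultant f g \<noteq> 0"
proof
  assume "resultant f g = 0"
  then have "degree (gcd f g) \<noteq> 0" by (simp add: resultant_0_gcd)
  then have "\<not> is_unit (gcd f g)" by (simp add: poly_dvd_1)
  moreover obtain k where k: "f = gcd f g * k" by (meson dvdE gcd_dvd1)
  ultimately have "is_unit k" using assms(1) by (metis irreducibleD)
  then have "f dvd gcd f g" by (metis k dvd_mult_unit_iff' dvd_refl mult.commute)
  then show False using assms(2) by (meson dvd_trans gcd_dvd2)
qed

section \<open>Irreducible plane curves\<close>

definition xdeg :: "real poly poly \<Rightarrow> nat" where
  "xdeg f = Max ((\<lambda>i. degree (coeff f i)) ` {..degree f})"

lemma degree_coeff_le_xdeg: "degree (coeff f i) \<le> xdeg f"
proof (cases "i \<le> degree f")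
  case True
  then show ?thesis unfolding xdeg_def by (intro Max_ge) auto
qed (simp add: coeff_eq_0)

lemma xdeg_le_iff: "xdeg f \<le> N \<longleftrightarrow> (\<forall>i. degree (coeff f i) \<le> N)"
proof
  assume "\<forall>i. degree (coeff f i) \<le> N"
  then show "xdeg f \<le> N" unfolding xdeg_def by (subst Max_le_iff) auto
qed (meson degree_coeff_le_xdeg le_trans)

lemma xdeg_attained: 
  assumes "f \<noteq> 0"
  shows "\<exists>i. coeff (coeff f i) (xdeg f) \<noteq> 0"
proof -
  have "xdeg f \<in> (\<lambda>i. degree (coeff f i)) ` {..degree f}"
    unfolding xdeg_def by (rule Max_in) auto
  then obtain i where i: "xdeg f = degree (coeff f i)" by auto
  show ?thesis
  proof (cases "xdeg f = 0")
    case True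
    then have "degree (lead_coeff f) = 0" using degree_coeff_le_xdeg[of f "degree f"] by simp
    then show ?thesis using True assms by (metis leading_coeff_0_iff)
  next
    case False
    then show ?thesis using i by (metis degree_0 leading_coeff_0_iff)
  qed
qed

lemma coeff_mult_bound:
  fixes p q :: "'a::comm_ring_1 poly"
  assumes "degree p \<le> a" "degree q \<le> b"
  shows "coeff (p * q) (a + b) = coeff p a * coeff q b"
proof -
  have "coeff p i * coeff q (a + b - i) = (if i = a then coeff p a * coeff q b else 0)" if "i \<le> a + b" for i
  proof (cases "i < a")
    case True
    then show ?thesis using assms by (auto simp: coeff_eq_0)
  next
    case False
    then show ?thesis using assms by (cases "i = a") (auto simp: coeff_eq_0)
  qed
  then have "coeff (p * q) (a + b) = (\<Sum>i\<le>a+b. if i = a then coeff p a * coeff q b else 0)"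
    unfolding coeff_mult by (intro sum.cong) auto
  then show ?thesis by simp
qed

text \<open>Among the terms of top degree in x take the largest y-exponents \<open>i0\<close> and
  \<open>j0\<close>; the coefficient at x^(a+b) y^(i0+j0) then receives a single nonzero product.
  The lemma makes \<open>degree f + xdeg f\<close> drop strictly when \<open>f\<close> is split into
  nonunits.\<close>

lemma xdeg_mult_ge:
  assumes "f \<noteq> 0" "g \<noteq> 0"
  shows "xdeg f + xdeg g \<le> xdeg (f * g)"
proof -
  define a where "a = xdeg f"
  define b where "b = xdeg g"
  define I where "I = {i. coeff (coeff f i) a \<noteq> 0}"
  define J where "J = {i. coeff (coeff g i) b \<noteq> 0}"
  have "I \<subseteq> {..degree f}" "J \<subseteq> {..degree g}"
    unfolding I_def J_def by (auto intro: le_degree)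
  then have fin: "finite I" "finite J" by (auto intro: finite_subset)
  have ne: "I \<noteq> {}" "J \<noteq> {}"
    using xdeg_attained[OF assms(1)] xdeg_attained[OF assms(2)] by (auto simp: I_def J_def a_def b_def)
  define i0 where "i0 = Max I"
  define j0 where "j0 = Max J"
  have i0: "i0 \<in> I" "\<And>i. i > i0 \<Longrightarrow> coeff (coeff f i) a = 0"
    using Max_in[OF fin(1) ne(1)] Max_ge[OF fin(1)] by (force simp: i0_def I_def)+
  have j0: "j0 \<in> J" "\<And>i. i > j0 \<Longrightarrow> coeff (coeff g i) b = 0"
    using Max_in[OF fin(2) ne(2)] Max_ge[OF fin(2)] by (force simp: j0_def J_def)+
  have "coeff (coeff (f * g) (i0 + j0)) (a + b)
      = (\<Sum>k\<le>i0+j0. coeff (coeff f k * coeff g (i0 + j0 - k)) (a + b))"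
    by (simp add: coeff_mult coeff_sum)
  also have "\<dots> = (\<Sum>k\<le>i0+j0. coeff (coeff f k) a * coeff (coeff g (i0 + j0 - k)) b)"
    by (intro sum.cong refl coeff_mult_bound) (auto simp: a_def b_def degree_coeff_le_xdeg)
  also have "\<dots> = (\<Sum>k\<le>i0+j0. if k = i0 then coeff (coeff f i0) a * coeff (coeff g j0) b else 0)"
  proof (intro sum.cong refl)
    fix k assume "k \<in> {..i0 + j0}"
    then show "coeff (coeff f k) a * coeff (coeff g (i0 + j0 - k)) b =
      (if k = i0 then coeff (coeff f i0) a * coeff (coeff g j0) b else 0)"
      using i0(2)[of k] j0(2)[of "i0 + j0 - k"] by (cases "k < i0"; cases "k = i0") auto
  qed
  also have "\<dots> = coeff (coeff f i0) a * coeff (coeff g j0) b" by simp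
  also have "\<dots> \<noteq> 0" using i0(1) j0(1) by (simp add: I_def J_def)
  finally have "a + b \<le> degree (coeff (f * g) (i0 + j0))" by (rule le_degree)
  then show ?thesis using degree_coeff_le_xdeg[of "f * g" "i0 + j0"] by (simp add: a_def b_def)
qed

definition curve_of :: "real poly poly \<Rightarrow> (real \<times> real) set" where
  "curve_of f = {p. ev f (fst p) (snd p) = 0}"

lemma const_of_degrees_zero:
  assumes "degree f = 0" "xdeg f = 0"
  shows "\<exists>c. f = [:[:c:]:]"
proof -
  obtain p where p: "f = [:p:]" using assms(1) by (metis degree_eq_zeroE)
  have "degree p = 0" using degree_coeff_le_xdeg[of f 0] assms(2) p by simp
  then show ?thesis using p by (metis degree_eq_zeroE)
qed

text \<open>Passing to the richer of two factors keeps at least half of the points, and every split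
  lowers \<open>degree f + xdeg f\<close>, which is at most 2N at the start. Both degrees enter the
  measure because a factor may be a polynomial in x alone.\<close>

lemma irreducible_factor_rich:
  assumes "f \<noteq> 0" "bideg_le f N" "finite P" "P \<noteq> {}" "P \<subseteq> curve_of f"
  shows "\<exists>g. irreducible g \<and> bideg_le g N \<and> curve_of g \<subseteq> curve_of f
     \<and> card P \<le> 2 ^ (2 * N) * card (P \<inter> curve_of g)"
proof -
  have "\<exists>g. irreducible g \<and> bideg_le g N \<and> curve_of g \<subseteq> curve_of f
     \<and> card P \<le> 2 ^ (degree f + xdeg f) * card (P \<inter> curve_of g)"
    using assms
  proof (induction "degree f + xdeg f" arbitrary: f P rule: less_induct)
    case less
    show ?case
    proof (cases "irreducible f")
      case True
      have "P \<inter> curve_of f = P" using less.prems by auto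
      then show ?thesis using True less.prems by (intro exI[of _ f]) simp
    next
      case False
      have nu: "\<not> is_unit f"
      proof
        assume "is_unit f"
        then obtain k where "1 = f * k" by (auto elim: dvdE)
        then have "ev f x y * ev k x y = 1" for x y :: real
          using ev_simps(2)[of x y] ev_simps(4)[of f k x y] by simp
        moreover obtain p where "p \<in> P" using less.prems(4) by blast
        ultimately have "ev f (fst p) (snd p) * ev k (fst p) (snd p) = 1" by blast
        then have "ev f (fst p) (snd p) \<noteq> 0" by auto
        then show False using less.prems(5) \<open>p \<in> P\<close> by (auto simp: curve_of_def)
      qed
      obtain a b where ab: "f = a * b" "\<not> is_unit a" "\<not> is_unit b"
        using False nu less.prems(1) unfolding irreducible_def by blast
      have a0: "a \<noteq> 0" and b0: "b \<noteq> 0" using ab less.prems by auto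
      have pos: "degree h + xdeg h > 0" if nu: "\<not> is_unit h" and h0: "h \<noteq> 0" for h
      proof (rule ccontr)
        assume "\<not> degree h + xdeg h > 0"
        then obtain c where c: "h = [:[:c:]:]" using const_of_degrees_zero by blast
        with h0 have "c \<noteq> 0" by auto
        then have "h * [:[:1 / c:]:] = 1" using c by (simp add: pCons_one)
        then have "is_unit h" by (metis dvd_triv_left)
        then show False using nu by simp
      qed
      have deg: "degree a + degree b = degree f" using ab a0 b0 by (simp add: degree_mult_eq)
      have xd: "xdeg a + xdeg b \<le> xdeg f" using xdeg_mult_ge[OF a0 b0] ab by simp
      have la: "degree a + xdeg a < degree f + xdeg f" using deg xd pos[OF ab(3) b0] by linarith
      have lb: "degree b + xdeg b < degree f + xdeg f" using deg xd pos[OF ab(2) a0] by linarith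
      have ba: "bideg_le h N" if "degree h \<le> degree f" "xdeg h \<le> xdeg f" for h
        using less.prems(2) that xdeg_le_iff by (meson bideg_le_def le_trans)
      have un: "curve_of f = curve_of a \<union> curve_of b" 
        unfolding ab(1) curve_of_def by auto
      have "P = (P \<inter> curve_of a) \<union> (P \<inter> curve_of b)" using un less.prems by auto
      then have "card P \<le> card (P \<inter> curve_of a) + card (P \<inter> curve_of b)"
        by (metis card_Un_le)
      then have "card P \<le> 2 * card (P \<inter> curve_of a) \<or> card P \<le> 2 * card (P \<inter> curve_of b)"
        by linarith
      then obtain h where h: "h = a \<or> h = b" "card P \<le> 2 * card (P \<inter> curve_of h)"
        by blast
      have Ph: "P \<inter> curve_of h \<noteq> {}" using h(2) less.prems by (auto simp: card_gt_0_iff)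
      have lt: "degree h + xdeg h < degree f + xdeg f" using h la lb by auto
      have hN: "bideg_le h N" using h deg xd by (intro ba) auto
      obtain g where g: "irreducible g" "bideg_le g N" "curve_of g \<subseteq> curve_of h"
         "card (P \<inter> curve_of h) \<le> 2 ^ (degree h + xdeg h) * card ((P \<inter> curve_of h) \<inter> curve_of g)"
        using less.hyps[OF lt _ hN _ Ph] h a0 b0 less.prems by blast
      have "(P \<inter> curve_of h) \<inter> curve_of g = P \<inter> curve_of g" using g(3) by auto
      then have "card P \<le> 2 * (2 ^ (degree h + xdeg h) * card (P \<inter> curve_of g))"
        using order_trans[OF h(2) mult_left_mono[OF g(4)]] by simp
      also have "\<dots> = 2 ^ (Suc (degree h + xdeg h)) * card (P \<inter> curve_of g)" by simp
      also have "\<dots> \<le> 2 ^ (degree f + xdeg f) * card (P \<inter> curve_of g)"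
        using lt by (intro mult_right_mono power_increasing) auto
      finally show ?thesis using g h un by (intro exI[of _ g]) auto
    qed
  qed
  then obtain g where g: "irreducible g" "bideg_le g N" "curve_of g \<subseteq> curve_of f"
     "card P \<le> 2 ^ (degree f + xdeg f) * card (P \<inter> curve_of g)" by blast
  have "(2::nat) ^ (degree f + xdeg f) \<le> 2 ^ (2 * N)"
    using assms(2) xdeg_le_iff[of f N] by (intro power_increasing) (auto simp: bideg_le_def)
  then have "card P \<le> 2 ^ (2 * N) * card (P \<inter> curve_of g)"
    using g(4) by (meson mult_right_mono order_trans zero_le)
  then show ?thesis using g by blast
qed

section \<open>Complex zeros, squared distance and the standing assumptions on the curve\<close>

definition zeros_of :: "real poly poly \<Rightarrow> (complex \<times> complex) set" where
  "zeros_of f = {p. ev f (fst p) (snd p) = 0}"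

definition cpl :: "real \<times> real \<Rightarrow> complex \<times> complex" where
  "cpl p = (of_real (fst p), of_real (snd p))"

text \<open>On complex points this is the bilinear form, not the Hermitian one: it stays polynomial,
  but it may vanish for distinct points.\<close>

definition sqd :: "'a \<times> 'a \<Rightarrow> 'a \<times> 'a \<Rightarrow> 'a::comm_ring_1" where
  "sqd u v = (fst u - fst v)\<^sup>2 + (snd u - snd v)\<^sup>2"

lemma cpl_in_zeros_of [simp]: "cpl p \<in> zeros_of f \<longleftrightarrow> p \<in> curve_of f"
  by (simp add: zeros_of_def curve_of_def cpl_def ev_of_real)

lemma inj_cpl: "inj cpl"
  by (auto simp: inj_on_def cpl_def prod_eq_iff)

lemma sqd_cpl: "sqd (cpl p) (cpl q) = of_real (sqd p q)"
  by (simp add: sqd_def cpl_def)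

lemma sqd_nonneg: "0 \<le> (sqd p q :: real)"
  by (simp add: sqd_def)

lemma sqd_eq_0_iff: "(sqd p q :: real) = 0 \<longleftrightarrow> p = q"
  by (auto simp: sqd_def sum_power2_eq_zero_iff prod_eq_iff)

lemma sqd_commute: "sqd p q = sqd q p"
  by (simp add: sqd_def power2_commute)

lemma bideg_le_pCons:
  assumes "degree c \<le> N" "p = 0 \<or> Suc (degree p) \<le> N" "bideg_le p N"
  shows "bideg_le (pCons c p) N"
  unfolding bideg_le_def
proof (intro conjI allI)
  show "degree (pCons c p) \<le> N" using assms(2) by auto
  show "degree (coeff (pCons c p) i) \<le> N" for i
    using assms(1,3) by (cases i) (auto simp: bideg_le_def)
qed

lemma bideg_le_0 [simp]: "bideg_le 0 N"
  by (simp add: bideg_le_def)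

text \<open>Irreducibility is meant over the reals. \<open>two_points\<close> rules out polynomials
  such as x^2 + y^2, whose real zero set is a single point; that the curve is infinite is derived
  later from a point over a good abscissa.\<close>

locale curve =
  fixes f :: "real poly poly" and d :: nat
  assumes irreducible: "irreducible f" and bideg: "bideg_le f d"
    and no_line: "\<not> contains_line (curve_of f)"
    and no_circle: "\<not> contains_circle (curve_of f)"
    and two_points: "\<exists>u\<in>curve_of f. \<exists>v\<in>curve_of f. u \<noteq> v"
begin

lemma no_vertical_line: "\<exists>y::real. ev f x y \<noteq> 0"
proof (rule ccontr)
  assume "\<not> ?thesis"
  then have "{(u, v). 1 * u + 0 * v = x} \<subseteq> curve_of f" by (auto simp: curve_of_def)
  then have "contains_line (curve_of f)" unfolding contains_line_def
    by (metis zero_neq_one)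
  then show False using no_line by simp
qed

lemma degree_pos: "degree f > 0"
proof (rule ccontr)
  assume "\<not> degree f > 0"
  then obtain c where c: "f = [:c:]" by (metis degree_eq_zeroE gr0I)
  obtain u where "u \<in> curve_of f" using two_points by blast
  then have "ev f (fst u) y = 0" for y by (simp add: c curve_of_def)
  then show False using no_vertical_line by blast
qed

lemma fibre:
  shows "finite {y::real. ev f x y = 0}" "card {y::real. ev f x y = 0} \<le> d"
proof -
  have *: "map_poly (\<lambda>c. evx c x) f \<noteq> 0"
    using no_vertical_line[of x] by (auto simp: ev_def)
  show "finite {y::real. ev f x y = 0}"
    unfolding ev_def using poly_roots_finite[OF *] .
  have "card {y::real. ev f x y = 0} \<le> degree (map_poly (\<lambda>c. evx c x) f)"
    unfolding ev_def using card_poly_roots_bound[OF *] .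
  also have "\<dots> \<le> degree f" by (rule degree_map_poly_le)
  finally show "card {y::real. ev f x y = 0} \<le> d" using bideg by (simp add: bideg_le_def)
qed

text \<open>A weak Bezout bound: the abscissae are roots of the resultant, and the curve has at most
  \<open>d\<close> points over each of them.\<close>

lemma common_zeros_bound:
  assumes "\<not> f dvd g" "bideg_le g e"
  shows "finite (curve_of f \<inter> curve_of g)" 
    "card (curve_of f \<inter> curve_of g) \<le> (d + e)\<^sup>2 * d"
proof -
  define h where "h = resultant f g"
  have h0: "h \<noteq> 0" unfolding h_def by (rule resultant_irreducible_nonzero[OF irreducible assms(1)])
  define X where "X = {x::real. evx h x = 0}"
  have X: "finite X" "card X \<le> (d + e)\<^sup>2"
    using evx_roots[OF h0, where 'a=real] degree_resultant_le[OF bideg assms(2)]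
    by (auto simp: X_def h_def power2_eq_square)
  have sub: "curve_of f \<inter> curve_of g \<subseteq> Sigma X (\<lambda>x. {y. ev f x y = 0})"
    using resultant_common_zero[OF _ _ degree_pos] 
    by (auto simp del: evx_real simp: curve_of_def X_def h_def)
  have fin: "finite (Sigma X (\<lambda>x. {y. ev f x y = 0}))" using X fibre by blast
  show "finite (curve_of f \<inter> curve_of g)" using sub fin by (rule finite_subset)
  have "card (curve_of f \<inter> curve_of g) \<le> card (Sigma X (\<lambda>x. {y. ev f x y = 0}))"
    using sub fin by (intro card_mono)
  also have "\<dots> = (\<Sum>x\<in>X. card {y. ev f x y = 0})" using X fibre by (intro card_SigmaI) auto
  also have "\<dots> \<le> (\<Sum>x\<in>X. d)" by (intro sum_mono fibre)
  also have "\<dots> = card X * d" by simp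
  also have "\<dots> \<le> (d + e)\<^sup>2 * d" using X by simp
  finally show "card (curve_of f \<inter> curve_of g) \<le> (d + e)\<^sup>2 * d" .
qed

text \<open>The cofactor has degree 0 in y, so it is a polynomial in x; as it divides a nonzero
  constant, it has no zeros.\<close>

lemma factor_unit:
  assumes "g = f * k" "degree g \<le> degree f" "lead_coeff g = [:c:]" "c \<noteq> 0" "g \<noteq> 0"
  shows "curve_of f = curve_of g"
proof -
  have k0: "k \<noteq> 0" using assms by auto
  have "degree k = 0" using assms degree_mult_eq[of f k] k0 degree_pos by auto
  then obtain k0 where k: "k = [:k0:]" by (metis degree_eq_zeroE)
  have "lead_coeff f * k0 = [:c:]"
    using lead_coeff_mult[of f k] assms(1,3) by (simp add: k del: mult_pCons_right)
  then have "evx (lead_coeff f) x * evx k0 x = c" for x :: real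
    using evx_simps(4)[of "lead_coeff f" k0 x] by simp
  then have "evx k0 x \<noteq> 0" for x :: real using assms(4) by (metis mult_zero_right)
  moreover have "ev g x y = ev f x y * evx k0 x" for x y :: real
    unfolding assms(1) k ev_simps by simp
  ultimately show ?thesis by (simp add: curve_of_def)
qed

text \<open>A common bound for both kinds of section: it dominates
  \<open>(d + 1)\<^sup>2 * d\<close> for lines and \<open>2 * (d + 2)\<^sup>2\<close> for
  circles.\<close>

definition meet_bound :: nat where "meet_bound = 2 * (d + 2) ^ 3"

lemma line_points:
  assumes "a \<noteq> 0 \<or> b \<noteq> 0"
  shows "finite {p \<in> curve_of f. a * fst p + b * snd p = c}"
    "card {p \<in> curve_of f. a * fst p + b * snd p = c} \<le> meet_bound"
proof -
  define g where "g = [:[:-c, a:], [:b:]:]"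
  have ev: "ev g x y = a * x + b * y - c" for x y by (simp add: g_def)
  then have cg: "curve_of g = {p. a * fst p + b * snd p = c}" by (auto simp: curve_of_def)
  have bd: "bideg_le g 1" unfolding g_def 
    by (intro bideg_le_pCons) auto
  have "\<not> f dvd g"
  proof
    assume "f dvd g"
    then obtain k where k: "g = f * k" by (auto elim: dvdE)
    have g0: "g \<noteq> 0" using assms by (auto simp: g_def)
    then have "degree f \<le> degree g" using k degree_mult_eq[of f k] by auto
    then have "degree g > 0" using degree_pos by simp
    then have b: "b \<noteq> 0" by (auto simp: g_def)
    have "curve_of f = curve_of g"
      by (rule factor_unit[OF k, of b]) (use b degree_pos in \<open>simp_all add: g_def\<close>)
    moreover have "{(x, y). a * x + b * y = c} = curve_of g" unfolding cg by auto
    ultimately show False using no_line assms unfolding contains_line_def by blast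
  qed
  from common_zeros_bound[OF this bd] cg
  have *: "finite {p \<in> curve_of f. a * fst p + b * snd p = c}"
    "card {p \<in> curve_of f. a * fst p + b * snd p = c} \<le> (d + 1)\<^sup>2 * d" 
    by (simp_all add: Int_def)
  show "finite {p \<in> curve_of f. a * fst p + b * snd p = c}" by (rule *(1))
  have "(d + 1)\<^sup>2 * d \<le> (d + 2)\<^sup>2 * (d + 2)" by (intro mult_mono power_mono) auto
  also have "\<dots> \<le> meet_bound" by (simp add: meet_bound_def power2_eq_square power3_eq_cube)
  finally show "card {p \<in> curve_of f. a * fst p + b * snd p = c} \<le> meet_bound" using *(2) by simp
qed

text \<open>If \<open>f\<close> had degree 2 in y, it would have the same real zeros as the circle
  polynomial; two points on it force t > 0, so the curve would be a genuine circle. If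
  \<open>f\<close> had degree 1 in y, its leading coefficient would vanish nowhere, so the curve
  would have a point over every real x, even over those beyond the circle.\<close>

lemma circle_not_dvd:
  assumes ev: "\<And>x y::real. ev g x y = (x - a)\<^sup>2 + (y - b)\<^sup>2 - t"
    and g: "g = [:[:a\<^sup>2 + b\<^sup>2 - t, -2*a, 1:], [:-2*b:], 1:]"
  shows "\<not> f dvd g"
proof
  assume "f dvd g"
  then obtain k where k: "g = f * k" by (auto elim: dvdE)
  have g0: "g \<noteq> 0" unfolding g by simp
  have lg: "lead_coeff g = [:1:]" unfolding g by (simp add: pCons_one)
  have dg: "degree g = 2" unfolding g by simp
  show False
  proof (cases "degree f \<ge> 2")
    case True
    then have eq: "curve_of f = curve_of g"
      by (intro factor_unit[OF k _ lg]) (use g0 dg in auto)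
    obtain u v where uv: "u \<in> curve_of f" "v \<in> curve_of f" "u \<noteq> v" using two_points by blast
    have s: "sqd u (a, b) = t" "sqd v (a, b) = t" using uv unfolding eq 
      by (auto simp: curve_of_def ev sqd_def)
    then have "t \<noteq> 0" using uv(3) by (auto simp: sqd_eq_0_iff)
    then have t: "t > 0" using s sqd_nonneg[of u "(a, b)"] by simp
    have "{(x, y). (x - a)^2 + (y - b)^2 = (sqrt t)^2} \<subseteq> curve_of f"
      unfolding eq using t by (auto simp: curve_of_def ev)
    then have "contains_circle (curve_of f)" unfolding contains_circle_def 
      using t real_sqrt_gt_zero by blast
    then show False using no_circle by simp
  next
    case False
    then have f1: "degree f = 1" using degree_pos by simp
    have "lead_coeff f * lead_coeff k = 1" 
      using lead_coeff_mult[of f k] unfolding k[symmetric] lg by (simp add: pCons_one)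
    then have "evx (lead_coeff f) x * evx (lead_coeff k) x = 1" for x :: real
      using evx_simps(4)[of "lead_coeff f" "lead_coeff k" x] by (simp del: evx_real evx_simps(4))
    then have nz: "evx (lead_coeff f) x \<noteq> 0" for x :: real by (metis mult_zero_left zero_neq_one)
    \<comment> \<open>Since (1 + |t|)^2 > t, the circle polynomial is positive on the whole vertical
      line over this x.\<close>
    define x where "x = a + (1 + \<bar>t\<bar>)"
    define y where "y = - evx (coeff f 0) x / evx (coeff f 1) x"
    have "ev f x y = evx (coeff f 0) x + evx (coeff f 1) x * y"
      by (simp add: ev_altdef f1)
    also have "\<dots> = 0" using nz[of x] f1 by (simp add: y_def)
    finally have "ev g x y = 0" using k by simp
    then have "(x - a)\<^sup>2 + (y - b)\<^sup>2 - t = 0" using ev[of x y] by simp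
    moreover have "x - a = 1 + \<bar>t\<bar>" by (simp add: x_def)
    ultimately have "(1 + \<bar>t\<bar>)\<^sup>2 \<le> t" using zero_le_power2[of "y - b"] by (simp only:)
    moreover have "(1 + \<bar>t\<bar>)\<^sup>2 = 1 + 2 * \<bar>t\<bar> + \<bar>t\<bar>\<^sup>2" by (simp add: power2_sum)
    ultimately show False using zero_le_power2[of "\<bar>t\<bar>"] abs_ge_self[of t] abs_ge_zero[of t] by linarith
  qed
qed

text \<open>Complex points have to be counted because partners of real points may be complex. Centre
  and \<open>t\<close> stay real, so non-divisibility over the reals suffices. Over a complex x the
  fibre is bounded through the circle, which is monic of degree 2 in y.\<close>

lemma circle_zeros:
  fixes q :: "real \<times> real" and t :: real
  shows "finite {p \<in> zeros_of f. sqd p (cpl q) = of_real t}"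
    "card {p \<in> zeros_of f. sqd p (cpl q) = of_real t} \<le> meet_bound"
proof -
  obtain a b where q: "q = (a, b)" by force
  define g where "g = [:[:a\<^sup>2 + b\<^sup>2 - t, -2*a, 1:], [:-2*b:], 1:]"
  have evr: "ev g x y = (x - a)\<^sup>2 + (y - b)\<^sup>2 - t" for x y :: real 
    by (simp add: g_def power2_eq_square algebra_simps)
  have evc: "ev g x y = (x - of_real a)\<^sup>2 + (y - of_real b)\<^sup>2 - of_real t" for x y :: complex 
    by (simp add: g_def power2_eq_square algebra_simps)
  have bd: "bideg_le g 2" unfolding g_def 
    by (intro bideg_le_pCons) auto
  have ndvd: "\<not> f dvd g" by (rule circle_not_dvd[OF evr g_def])
  define h where "h = resultant f g"
  have h0: "h \<noteq> 0" unfolding h_def by (rule resultant_irreducible_nonzero[OF irreducible ndvd])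
  define X where "X = {x::complex. evx h x = 0}"
  have X: "finite X" "card X \<le> (d + 2)\<^sup>2"
    using evx_roots[OF h0, where 'a=complex] degree_resultant_le[OF bideg bd]
    by (auto simp: X_def h_def power2_eq_square)
  define Y where "Y = (\<lambda>x. {y::complex. poly [:(x - of_real a)\<^sup>2 + of_real b ^ 2 - of_real t, - 2 * of_real b, 1:] y = 0})"
  have Y: "finite (Y x)" "card (Y x) \<le> 2" for x
    unfolding Y_def by (rule poly_roots_finite, simp)
      (rule order_trans[OF card_poly_roots_bound], auto)
  have sub: "{p \<in> zeros_of f. sqd p (cpl q) = of_real t} \<subseteq> Sigma X Y"
  proof
    fix p assume "p \<in> {p \<in> zeros_of f. sqd p (cpl q) = of_real t}"
    then have p: "ev f (fst p) (snd p) = 0" "ev g (fst p) (snd p) = 0"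
      by (auto simp: zeros_of_def sqd_def evc cpl_def q)
    have "fst p \<in> X" using resultant_common_zero[OF p degree_pos] by (simp add: X_def h_def)
    moreover have "snd p \<in> Y (fst p)" using p(2) unfolding evc Y_def 
      by (simp add: power2_eq_square algebra_simps)
    ultimately show "p \<in> Sigma X Y" by (cases p) simp
  qed
  have fin: "finite (Sigma X Y)" using X Y by blast
  show "finite {p \<in> zeros_of f. sqd p (cpl q) = of_real t}" using sub fin by (rule finite_subset)
  have "card {p \<in> zeros_of f. sqd p (cpl q) = of_real t} \<le> card (Sigma X Y)"
    using sub fin by (intro card_mono)
  also have "\<dots> = (\<Sum>x\<in>X. card (Y x))" using X Y by (intro card_SigmaI) auto
  also have "\<dots> \<le> (\<Sum>x\<in>X. 2)" by (intro sum_mono Y)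
  also have "\<dots> = card X * 2" by simp
  also have "\<dots> \<le> 2 * (d + 2)\<^sup>2" using X by simp
  also have "\<dots> \<le> meet_bound" by (simp add: meet_bound_def power2_eq_square power3_eq_cube)
  finally show "card {p \<in> zeros_of f. sqd p (cpl q) = of_real t} \<le> meet_bound" .
qed

lemma circle_points:
  fixes t :: real
  shows "finite {p \<in> curve_of f. sqd p q = t}" "card {p \<in> curve_of f. sqd p q = t} \<le> meet_bound"
proof -
  have sub: "cpl ` {p \<in> curve_of f. sqd p q = t} \<subseteq> {p \<in> zeros_of f. sqd p (cpl q) = of_real t}"
    by (auto simp: sqd_cpl)
  have inj: "inj_on cpl A" for A using inj_cpl by (rule inj_on_subset) simp
  show "finite {p \<in> curve_of f. sqd p q = t}"
    by (rule finite_imageD[OF finite_subset[OF sub circle_zeros(1)] inj])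
  show "card {p \<in> curve_of f. sqd p q = t} \<le> meet_bound"
    using card_mono[OF circle_zeros(1) sub] circle_zeros(2)[of q t] inj by (simp add: card_image)
qed

end

section \<open>Branches of the curve\<close>

lemma continuous_on_ev [continuous_intros]:
  fixes g h :: "'a::topological_space \<Rightarrow> real"
  assumes "continuous_on S g" "continuous_on S h"
  shows "continuous_on S (\<lambda>z. ev f (g z) (h z))"
  unfolding ev_altdef evx_altdef by (intro continuous_intros assms)

lemma has_derivative_ev:
  "((\<lambda>y::real. ev f x y) has_real_derivative ev (pderiv f) x y) (at y)"
proof (induction f)
  case (pCons c f)
  have "((\<lambda>y. evx c x + y * ev f x y) has_real_derivative
     0 + (1 * ev f x y + ev (pderiv f) x y * y)) (at y)"
    by (intro derivative_intros pCons)
  then show ?case by (simp add: pderiv_pCons mult.commute)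
qed simp

lemma eventually_no_zero_on_compact:
  fixes K :: "real set"
  assumes "compact K" "\<And>y. y \<in> K \<Longrightarrow> ev f x0 y \<noteq> 0"
  shows "\<forall>\<^sub>F x in nhds x0. \<forall>y\<in>K. ev f x y \<noteq> 0"
proof -
  define W where "W = {p::real\<times>real. ev f (fst p) (snd p) \<noteq> 0}"
  have "open W" unfolding W_def
    by (intro open_Collect_neq continuous_intros)
  moreover have "{x0} \<times> K \<subseteq> W" using assms(2) by (auto simp: W_def)
  ultimately obtain X0 where X0: "x0 \<in> X0" "open X0" "X0 \<times> K \<subseteq> W"
    using Elementary_Topology.tube_lemma[OF assms(1), of W x0] by blast
  show ?thesis unfolding eventually_nhds
    by (rule exI[of _ X0]) (use X0 in \<open>auto simp: W_def\<close>)
qed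

lemma eventually_ev_pos:
  fixes x0 y0 :: real
  assumes "s * ev f x0 y0 > 0"
  shows "\<forall>\<^sub>F x in nhds x0. s * ev f x y0 > 0"
proof -
  have "open {x. s * ev f x y0 > 0}"
    by (intro open_Collect_less continuous_intros)
  then show ?thesis unfolding eventually_nhds using assms by blast
qed

text \<open>On a box around the root the y-derivative keeps its sign \<open>s\<close>, so
  \<open>s * ev f x y\<close> increases strictly in y. Its signs at both ends persist for nearby x,
  which gives existence; monotonicity gives uniqueness.\<close>

lemma simple_root_persists:
  fixes x0 y0 e :: real
  assumes "ev f x0 y0 = 0" "ev (pderiv f) x0 y0 \<noteq> 0" "e > 0"
  shows "\<exists>\<epsilon>. 0 < \<epsilon> \<and> \<epsilon> < e \<and> (\<forall>\<^sub>F x in nhds x0. \<exists>!y. \<bar>y - y0\<bar> < \<epsilon> \<and> ev f x y = 0)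
     \<and> (\<forall>y. \<bar>y - y0\<bar> \<le> \<epsilon> \<longrightarrow> ev f x0 y = 0 \<longrightarrow> y = y0)"
proof -
  define s where "s = sgn (ev (pderiv f) x0 y0)"
  define W where "W = {p::real\<times>real. s * ev (pderiv f) (fst p) (snd p) > 0}"
  have "open W" unfolding W_def by (intro open_Collect_less continuous_intros)
  moreover have "(x0, y0) \<in> W" using assms by (auto simp: W_def s_def sgn_if)
  ultimately obtain A B where AB: "open A" "open B" "x0 \<in> A" "y0 \<in> B" "A \<times> B \<subseteq> W"
    by (rule open_prod_elim) auto
  then obtain r where r: "r > 0" "ball y0 r \<subseteq> B" by (meson openE)
  define \<epsilon> where "\<epsilon> = min r e / 2"
  have \<epsilon>: "0 < \<epsilon>" "\<epsilon> < e" "\<epsilon> < r" using r assms(3) by (auto simp: \<epsilon>_def)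
  have pos: "s * ev (pderiv f) x y > 0" if "x \<in> A" "\<bar>y - y0\<bar> \<le> \<epsilon>" for x y
  proof -
    have "y \<in> ball y0 r" using that \<epsilon> by (auto simp: dist_real_def)
    then have "(x, y) \<in> W" using that(1) r(2) AB(5) by blast
    then show ?thesis by (simp add: W_def)
  qed
  have mono: "s * ev f x y < s * ev f x y'" 
    if "x \<in> A" "\<bar>y - y0\<bar> \<le> \<epsilon>" "\<bar>y' - y0\<bar> \<le> \<epsilon>" "y < y'" for x y y'
  proof (rule DERIV_pos_imp_increasing[OF that(4)])
    fix u assume u: "y \<le> u" "u \<le> y'"
    have "((\<lambda>y. s * ev f x y) has_real_derivative s * ev (pderiv f) x u) (at u)"
      by (intro DERIV_cmult has_derivative_ev)
    moreover have "s * ev (pderiv f) x u > 0" using u that by (intro pos) auto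
    ultimately show "\<exists>z. ((\<lambda>y. s * ev f x y) has_real_derivative z) (at u) \<and> 0 < z" by blast
  qed
  have "s * ev f x0 (y0 - \<epsilon>) < s * ev f x0 y0" "s * ev f x0 y0 < s * ev f x0 (y0 + \<epsilon>)"
    using \<epsilon> AB by (auto intro!: mono)
  then have "(-s) * ev f x0 (y0 - \<epsilon>) > 0" "s * ev f x0 (y0 + \<epsilon>) > 0" using assms by auto
  note eventually_ev_pos[OF this(1)] eventually_ev_pos[OF this(2)]
  moreover have "\<forall>\<^sub>F x in nhds x0. x \<in> A" using AB by (auto intro: eventually_nhds_in_open)
  ultimately have "\<forall>\<^sub>F x in nhds x0. \<exists>!y. \<bar>y - y0\<bar> < \<epsilon> \<and> ev f x y = 0"
  proof eventually_elim
    case (elim x)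
    have "\<exists>y\<ge>y0 - \<epsilon>. y \<le> y0 + \<epsilon> \<and> s * ev f x y = 0"
      by (rule IVT') (use elim \<epsilon> in \<open>auto intro!: continuous_intros\<close>)
    then obtain y where y: "y0 - \<epsilon> \<le> y" "y \<le> y0 + \<epsilon>" "s * ev f x y = 0" by blast
    have s0: "s \<noteq> 0" using assms by (simp add: s_def sgn_if)
    have "y \<noteq> y0 - \<epsilon>" "y \<noteq> y0 + \<epsilon>" using elim y by auto
    then have y2: "\<bar>y - y0\<bar> < \<epsilon>" "ev f x y = 0" using y s0 by auto
    show ?case
    proof (rule ex1I[of _ y])
      show "\<bar>y - y0\<bar> < \<epsilon> \<and> ev f x y = 0" using y2 by simp
      fix y' assume y': "\<bar>y' - y0\<bar> < \<epsilon> \<and> ev f x y' = 0"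
      show "y' = y"
        using mono[OF elim(3), of y y'] mono[OF elim(3), of y' y] y' y2
        by (cases y y' rule: linorder_cases) auto
    qed
  qed
  moreover have "y = y0" if "\<bar>y - y0\<bar> \<le> \<epsilon>" "ev f x0 y = 0" for y
    using mono[OF AB(3), of y y0] mono[OF AB(3), of y0 y] that \<epsilon> assms(1)
    by (cases y y0 rule: linorder_cases) auto
  ultimately show ?thesis using \<epsilon> by blast
qed

text \<open>Cauchy's bound for the roots in terms of the coefficients. It keeps roots from escaping
  to infinity as long as the leading coefficient stays away from 0.\<close>

lemma root_bound:
  fixes x y :: real
  assumes "ev f x y = 0" "evx (lead_coeff f) x \<noteq> 0" 
  shows "\<bar>y\<bar> \<le> 1 + (\<Sum>i<degree f. \<bar>evx (coeff f i) x\<bar>) / \<bar>evx (lead_coeff f) x\<bar>"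
proof (cases "\<bar>y\<bar> \<le> 1")
  case True
  have "0 \<le> (\<Sum>i<degree f. \<bar>evx (coeff f i) x\<bar>) / \<bar>evx (lead_coeff f) x\<bar>"
    by (intro divide_nonneg_nonneg sum_nonneg) auto
  then show ?thesis using True by linarith
next
  case False
  define m where "m = degree f"
  define l where "l = evx (lead_coeff f) x"
  have split: "ev f x y = (\<Sum>i<m. evx (coeff f i) x * y ^ i) + l * y ^ m"
    unfolding ev_altdef m_def l_def by (simp only: lessThan_Suc_atMost[symmetric] sum.lessThan_Suc)
  show ?thesis
  proof (cases "m = 0")
    case True
    then show ?thesis using split assms by (simp add: l_def)
  next
    case m: False
    have "\<bar>l\<bar> * \<bar>y\<bar> ^ m = \<bar>\<Sum>i<m. evx (coeff f i) x * y ^ i\<bar>"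
      using split assms(1) by (simp add: abs_mult power_abs[symmetric]) (metis abs_minus_cancel abs_mult add_eq_0_iff2)
    also have "\<dots> \<le> (\<Sum>i<m. \<bar>evx (coeff f i) x * y ^ i\<bar>)" by (rule sum_abs)
    also have "\<dots> \<le> (\<Sum>i<m. \<bar>evx (coeff f i) x\<bar> * \<bar>y\<bar> ^ (m - 1))"
    proof (rule sum_mono)
      fix i assume "i \<in> {..<m}"
      then have "\<bar>y\<bar> ^ i \<le> \<bar>y\<bar> ^ (m - 1)" using False by (intro power_increasing) auto
      then show "\<bar>evx (coeff f i) x * y ^ i\<bar> \<le> \<bar>evx (coeff f i) x\<bar> * \<bar>y\<bar> ^ (m - 1)"
        by (simp only: abs_mult power_abs) (rule mult_left_mono, auto)
    qed
    also have "\<dots> = (\<Sum>i<m. \<bar>evx (coeff f i) x\<bar>) * \<bar>y\<bar> ^ (m - 1)" by (simp add: sum_distrib_right)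
    finally have "(\<bar>l\<bar> * \<bar>y\<bar>) * \<bar>y\<bar> ^ (m - 1) \<le> (\<Sum>i<m. \<bar>evx (coeff f i) x\<bar>) * \<bar>y\<bar> ^ (m - 1)"
      using m by (cases m) (auto simp: mult_ac)
    moreover have "\<bar>y\<bar> ^ (m - 1) > 0" using False by (intro zero_less_power) auto
    ultimately have "\<bar>l\<bar> * \<bar>y\<bar> \<le> (\<Sum>i<m. \<bar>evx (coeff f i) x\<bar>)" by (simp only: mult_le_cancel_right_pos)
    then have "\<bar>y\<bar> \<le> (\<Sum>i<m. \<bar>evx (coeff f i) x\<bar>) / \<bar>l\<bar>"
      using assms(2) by (simp add: l_def field_simps)
    then show ?thesis unfolding m_def l_def by linarith
  qed
qed

lemma eventually_roots_bounded:
  fixes x0 :: real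
  assumes "evx (lead_coeff f) x0 \<noteq> 0"
  shows "\<exists>B. \<forall>\<^sub>F x in nhds x0. \<forall>y. ev f x y = 0 \<longrightarrow> \<bar>y\<bar> < B"
proof -
  define M :: "real \<Rightarrow> real" where "M = (\<lambda>x. 1 + (\<Sum>i<degree f. \<bar>evx (coeff f i) x\<bar>) / \<bar>evx (lead_coeff f) x\<bar>)"
  have "isCont M x0" unfolding M_def using assms
    by (intro continuous_intros) auto
  then have "\<forall>\<^sub>F x in nhds x0. M x < M x0 + 1"
    by (intro order_tendstoD) (auto simp: continuous_within tendsto_nhds_iff)
  moreover have "\<forall>\<^sub>F x in nhds x0. evx (lead_coeff f) x \<noteq> 0"
  proof -
    have "open {x::real. poly (lead_coeff f) x \<noteq> 0}" by (intro open_Collect_neq continuous_intros)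
    then show ?thesis unfolding eventually_nhds using assms by (auto intro!: exI[of _ "{x. poly (lead_coeff f) x \<noteq> 0}"])
  qed
  ultimately have "\<forall>\<^sub>F x in nhds x0. \<forall>y. ev f x y = 0 \<longrightarrow> \<bar>y\<bar> < M x0 + 1"
  proof eventually_elim
    case (elim x)
    show ?case
    proof (intro allI impI)
      fix y assume "ev f x y = 0"
      then have "\<bar>y\<bar> \<le> M x" unfolding M_def using elim by (intro root_bound)
      then show "\<bar>y\<bar> < M x0 + 1" using elim by simp
    qed
  qed
  then show ?thesis by blast
qed

definition rootrank :: "real poly poly \<Rightarrow> real \<Rightarrow> real \<Rightarrow> nat" where
  "rootrank f x c = card {y. y < c \<and> ev f x y = 0}"

text \<open>No root can appear, vanish or cross the level c. Each simple root below c continues as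
  exactly one nearby root, the compact remainder \<open>K\<close> of the range stays free of roots,
  and below -B there are none.\<close>

lemma rank_locally_constant:
  fixes x0 c :: real
  assumes fin: "finite {y. ev f x0 y = 0}"
    and simple: "\<And>y. ev f x0 y = 0 \<Longrightarrow> ev (pderiv f) x0 y \<noteq> 0"
    and lc: "evx (lead_coeff f) x0 \<noteq> 0" and c: "ev f x0 c \<noteq> 0"
  shows "\<forall>\<^sub>F x in nhds x0. rootrank f x c = rootrank f x0 c"
proof -
  define Y where "Y = {y. y < c \<and> ev f x0 y = 0}"
  have finY: "finite Y" using fin by (rule finite_subset[rotated]) (auto simp: Y_def)
  obtain e where e: "e > 0" "\<And>y. y \<in> Y \<Longrightarrow> y + e < c" "\<And>y z. y \<in> Y \<Longrightarrow> z \<in> Y \<Longrightarrow> y \<noteq> z \<Longrightarrow> \<bar>y - z\<bar> > 2 * e"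
  proof -
    \<comment> \<open>The 1 keeps \<open>D\<close> nonempty when there is no root below c. A third
      of the minimum makes the intervals around the roots disjoint and keeps them below c.\<close>
    define D where "D = insert 1 ((\<lambda>y. c - y) ` Y \<union> (\<lambda>(y, z). \<bar>y - z\<bar>) ` ({(y, z). y \<in> Y \<and> z \<in> Y \<and> y \<noteq> z}))"
    have "finite {(y, z). y \<in> Y \<and> z \<in> Y \<and> y \<noteq> z}"
      by (rule finite_subset[of _ "Y \<times> Y"]) (use finY in auto)
    then have "finite D" unfolding D_def using finY by auto
    moreover have "\<forall>u\<in>D. u > 0" by (auto simp: D_def Y_def)
    ultimately have m: "Min D > 0" by (subst Min_gr_iff) (auto simp: D_def)
    have le: "Min D \<le> u" if "u \<in> D" for u using \<open>finite D\<close> that by simp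
    show ?thesis
    proof (rule that[of "Min D / 3"])
      show "y + Min D / 3 < c" if "y \<in> Y" for y
        using le[of "c - y"] that m by (auto simp: D_def)
      show "\<bar>y - z\<bar> > 2 * (Min D / 3)" if "y \<in> Y" "z \<in> Y" "y \<noteq> z" for y z
      proof -
        have "\<bar>y - z\<bar> \<in> D" unfolding D_def using that by (intro insertI2 UnI2 image_eqI[of _ _ "(y, z)"]) auto
        then show ?thesis using le[of "\<bar>y - z\<bar>"] m by linarith
      qed
    qed (use m in simp)
  qed
  have "\<forall>y\<in>Y. \<exists>\<epsilon>. 0 < \<epsilon> \<and> \<epsilon> < e \<and> (\<forall>\<^sub>F x in nhds x0. \<exists>!y'. \<bar>y' - y\<bar> < \<epsilon> \<and> ev f x y' = 0)
     \<and> (\<forall>y'. \<bar>y' - y\<bar> \<le> \<epsilon> \<longrightarrow> ev f x0 y' = 0 \<longrightarrow> y' = y)"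
    using simple e(1) by (intro ballI simple_root_persists) (auto simp: Y_def)
  from bchoice[OF this]
  obtain \<epsilon> where \<epsilon>: "\<And>y. y \<in> Y \<Longrightarrow> 0 < \<epsilon> y" "\<And>y. y \<in> Y \<Longrightarrow> \<epsilon> y < e"
    "\<And>y. y \<in> Y \<Longrightarrow> \<forall>\<^sub>F x in nhds x0. \<exists>!y'. \<bar>y' - y\<bar> < \<epsilon> y \<and> ev f x y' = 0"
    by blast
  obtain B where B: "\<forall>\<^sub>F x in nhds x0. \<forall>y. ev f x y = 0 \<longrightarrow> \<bar>y\<bar> < B"
    using eventually_roots_bounded[OF lc] by blast
  define K where "K = {-B..c} - (\<Union>y\<in>Y. {y - \<epsilon> y<..<y + \<epsilon> y})"
  have "compact K" unfolding K_def by (intro compact_diff) auto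
  moreover have "ev f x0 y \<noteq> 0" if "y \<in> K" for y
  proof
    assume z: "ev f x0 y = 0"
    then have "y \<noteq> c" using c by auto
    then have "y \<in> Y" using that z by (auto simp: K_def Y_def)
    then show False using that \<epsilon>(1)[of y] by (auto simp: K_def)
  qed
  ultimately have nz: "\<forall>\<^sub>F x in nhds x0. \<forall>y\<in>K. ev f x y \<noteq> 0" by (rule eventually_no_zero_on_compact)
  have "\<forall>\<^sub>F x in nhds x0. \<forall>y\<in>Y. \<exists>!y'. \<bar>y' - y\<bar> < \<epsilon> y \<and> ev f x y' = 0"
    using finY \<epsilon>(3) by (simp add: eventually_ball_finite)
  with nz B show ?thesis
  proof eventually_elim
    case (elim x)
    define Z where "Z = (\<lambda>y. {y'. \<bar>y' - y\<bar> < \<epsilon> y \<and> ev f x y' = 0})"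
    have card1: "card (Z y) = 1" if "y \<in> Y" for y
    proof -
      have "\<exists>!y'. \<bar>y' - y\<bar> < \<epsilon> y \<and> ev f x y' = 0" using elim(3) that by blast
      then obtain y' where y': "\<bar>y' - y\<bar> < \<epsilon> y \<and> ev f x y' = 0"
        and u: "\<forall>u. \<bar>u - y\<bar> < \<epsilon> y \<and> ev f x u = 0 \<longrightarrow> u = y'"
        unfolding Ex1_def by blast
      have "Z y = {y'}" unfolding Z_def using y' u by blast
      then show ?thesis by simp
    qed
    have "{y. y < c \<and> ev f x y = 0} = (\<Union>y\<in>Y. Z y)"
    proof (intro equalityI subsetI)
      fix y assume y: "y \<in> {y. y < c \<and> ev f x y = 0}"
      then have "\<bar>y\<bar> < B" "y \<notin> K" using elim by blast+
      moreover have "y \<in> {-B..c}" using y \<open>\<bar>y\<bar> < B\<close> by simp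
      ultimately obtain u where u: "u \<in> Y" "y \<in> {u - \<epsilon> u<..<u + \<epsilon> u}" unfolding K_def by blast
      then have "y \<in> Z u" using y by (simp add: Z_def abs_less_iff)
      then show "y \<in> (\<Union>y\<in>Y. Z y)" using u(1) by blast
    next
      fix y assume "y \<in> (\<Union>y\<in>Y. Z y)"
      then obtain u where u: "u \<in> Y" "\<bar>y - u\<bar> < \<epsilon> u" "ev f x y = 0" by (auto simp: Z_def)
      then show "y \<in> {y. y < c \<and> ev f x y = 0}" using e(2)[OF u(1)] \<epsilon>(2)[OF u(1)] by auto
    qed
    then have "rootrank f x c = card (\<Union>y\<in>Y. Z y)" by (simp add: rootrank_def)
    also have "\<dots> = (\<Sum>y\<in>Y. card (Z y))"
    proof (rule card_UN_disjoint[OF finY])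
      show "\<forall>i\<in>Y. finite (Z i)" using card1 by (metis card.infinite zero_neq_one)
      show "\<forall>i\<in>Y. \<forall>j\<in>Y. i \<noteq> j \<longrightarrow> Z i \<inter> Z j = {}"
      proof (intro ballI impI)
        fix i j assume ij: "i \<in> Y" "j \<in> Y" "i \<noteq> j"
        show "Z i \<inter> Z j = {}" using e(3)[OF ij] \<epsilon>(2)[OF ij(1)] \<epsilon>(2)[OF ij(2)] by (auto simp: Z_def)
      qed
    qed
    also have "\<dots> = card Y" using card1 by simp
    finally show ?case by (simp add: rootrank_def Y_def)
  qed
qed

text \<open>Ranks increase strictly along \<open>A\<close>, so they map \<open>A\<close> injectively
  into \<open>{..<card A}\<close>, hence onto it.\<close>

lemma exists_element_of_rank:
  fixes A :: "real set"
  assumes "finite A" "k < card A"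
  shows "\<exists>y\<in>A. card {z \<in> A. z < y} = k"
proof -
  define r where "r = (\<lambda>y. card {z \<in> A. z < y})"
  have lt: "r y < r y'" if "y \<in> A" "y < y'" for y y'
    unfolding r_def using assms(1) that by (intro psubset_card_mono) auto
  have inj: "inj_on r A"
    using lt by (intro linorder_inj_onI') (metis less_irrefl)
  have "r ` A \<subseteq> {..<card A}"
    unfolding r_def using assms(1) by (auto intro!: psubset_card_mono)
  then have "r ` A = {..<card A}"
    using inj by (intro card_subset_eq) (auto simp: card_image)
  then show ?thesis using assms(2) unfolding r_def by (metis (no_types, lifting) imageE lessThan_iff)
qed

section \<open>Branches over intervals free of bad abscissae\<close>

context curve
begin

text \<open>The resultant vanishes wherever a multiple root occurs in the fibre; the factor
  \<open>lead_coeff f\<close> adds the abscissae at which a root may run off to infinity.\<close>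

definition bad_poly :: "real poly" where
  "bad_poly = resultant f (pderiv f) * lead_coeff f"

definition bad_x :: "real set" where
  "bad_x = {x. evx bad_poly x = 0}"

lemma bad_poly_nonzero: "bad_poly \<noteq> 0"
proof -
  have p0: "pderiv f \<noteq> 0" using degree_pos by (simp add: pderiv_eq_0_iff)
  have "\<not> f dvd pderiv f"
  proof
    assume "f dvd pderiv f"
    then have "degree f \<le> degree (pderiv f)" using p0 by (rule dvd_imp_degree_le)
    then show False using degree_pos by (simp add: degree_pderiv)
  qed
  then have "resultant f (pderiv f) \<noteq> 0" by (rule resultant_irreducible_nonzero[OF irreducible])
  moreover have "lead_coeff f \<noteq> 0" using degree_pos by auto
  ultimately show ?thesis by (simp add: bad_poly_def)
qed

lemma finite_bad_x: "finite bad_x"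
  unfolding bad_x_def by (rule evx_roots[OF bad_poly_nonzero])

lemma card_bad_x: "card bad_x \<le> (2 * d)\<^sup>2 + d"
proof -
  have "bideg_le (pderiv f) d"
    using bideg unfolding bideg_le_def
  proof (intro conjI allI)
    assume *: "degree f \<le> d \<and> (\<forall>i. degree (coeff f i) \<le> d)"
    show "degree (pderiv f) \<le> d" using * by (simp add: degree_pderiv le_diff_conv)
    fix i
    have "degree (coeff (pderiv f) i) \<le> degree (of_nat (Suc i) :: real poly) + degree (coeff f (Suc i))"
      unfolding coeff_pderiv by (rule degree_mult_le)
    then show "degree (coeff (pderiv f) i) \<le> d" using * 
      by (metis add_0 degree_of_nat le_trans)
  qed
  then have "degree (resultant f (pderiv f)) \<le> (2 * d)\<^sup>2"
    using degree_resultant_le[OF bideg] by (simp add: power2_eq_square mult_2)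
  moreover have "degree (lead_coeff f) \<le> d" using bideg by (simp add: bideg_le_def)
  ultimately have "degree bad_poly \<le> (2 * d)\<^sup>2 + d"
    unfolding bad_poly_def by (intro order_trans[OF degree_mult_le] add_mono)
  then show ?thesis unfolding bad_x_def using evx_roots(2)[OF bad_poly_nonzero, where 'a=real] by linarith
qed

lemma good_x:
  assumes "x \<notin> bad_x"
  shows "evx (lead_coeff f) x \<noteq> 0" "ev f x y = 0 \<Longrightarrow> ev (pderiv f) x y \<noteq> 0"
proof -
  show "evx (lead_coeff f) x \<noteq> 0" using assms by (auto simp: bad_x_def bad_poly_def)
  assume "ev f x y = 0"
  then show "ev (pderiv f) x y \<noteq> 0" 
    using assms resultant_common_zero[OF _ _ degree_pos, of x y "pderiv f"] 
    by (auto simp: bad_x_def bad_poly_def)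
qed

lemma rank_eventually:
  assumes "x0 \<notin> bad_x" "ev f x0 c \<noteq> 0"
  shows "\<forall>\<^sub>F x in nhds x0. rootrank f x c = rootrank f x0 c"
  using assms good_x[OF assms(1)] by (intro rank_locally_constant fibre) auto

text \<open>The number of all roots is the rank of a level \<open>B\<close> that lies above every
  root for all x nearby.\<close>

lemma root_count_eventually:
  assumes "x0 \<notin> bad_x"
  shows "\<forall>\<^sub>F x in nhds x0. card {y. ev f x y = 0} = card {y. ev f x0 y = 0}"
proof -
  obtain B where B: "\<forall>\<^sub>F x in nhds x0. \<forall>y. ev f x y = 0 \<longrightarrow> \<bar>y\<bar> < B"
    using eventually_roots_bounded[OF good_x(1)[OF assms]] by blast
  then have B0: "\<bar>y\<bar> < B" if "ev f x0 y = 0" for y using that eventually_nhds_x_imp_x by fast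
  have "ev f x0 B \<noteq> 0" using B0[of B] by auto
  from B rank_eventually[OF assms this] show ?thesis
  proof eventually_elim
    case (elim x)
    have "{y. y < B \<and> ev f x y = 0} = {y. ev f x y = 0}" using elim(1) by auto
    moreover have "{y. y < B \<and> ev f x0 y = 0} = {y. ev f x0 y = 0}" using B0 by (auto dest: abs_less_iff[THEN iffD1])
    ultimately show ?case using elim(2) by (simp add: rootrank_def)
  qed
qed

lemma root_count_constant:
  assumes "{a..b} \<inter> bad_x = {}" "x \<in> {a..b}" "x' \<in> {a..b}"
  shows "card {y. ev f x y = 0} = card {y. ev f x' y = 0}"
proof -
  define n :: "real \<Rightarrow> nat" where "n = (\<lambda>x. card {y. ev f x y = 0})"
  have "n x' = n x"
  proof (rule connected_induction_simple[where S = "{a..b}" and a = x and b = x' and P = "\<lambda>u. n u = n x"])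
    fix u assume u: "u \<in> {a..b}"
    then have "\<forall>\<^sub>F v in nhds u. n v = n u" unfolding n_def using assms(1)
      by (intro root_count_eventually) auto
    then obtain T where T: "open T" "u \<in> T" "\<And>v. v \<in> T \<Longrightarrow> n v = n u" unfolding eventually_nhds by blast
    have "openin (top_of_set {a..b}) ({a..b} \<inter> T)" using T(1) by (rule openin_open_Int)
    moreover have "n w = n x" if "v \<in> {a..b} \<inter> T" "w \<in> {a..b} \<inter> T" "n v = n x" for v w
      using that T(3)[of v] T(3)[of w] by simp
    ultimately
    show "\<exists>T. openin (top_of_set {a..b}) T \<and> u \<in> T \<and> (\<forall>x'\<in>T. \<forall>y\<in>T. n x' = n x \<longrightarrow> n y = n x)"
      using T(2) u by blast
  qed (use assms in auto)
  then show ?thesis by (simp add: n_def)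
qed

definition branch :: "nat \<Rightarrow> real \<Rightarrow> real" where
  "branch k x = (SOME y. ev f x y = 0 \<and> rootrank f x y = k)"

lemma branch:
  assumes "k < card {y. ev f x y = 0}"
  shows "ev f x (branch k x) = 0" "rootrank f x (branch k x) = k"
proof -
  obtain y where "ev f x y = 0" "card {z \<in> {y. ev f x y = 0}. z < y} = k"
    using exists_element_of_rank[OF fibre(1) assms] by auto
  then have "ev f x y = 0 \<and> rootrank f x y = k" by (simp add: rootrank_def conj_commute)
  then have "ev f x (branch k x) = 0 \<and> rootrank f x (branch k x) = k"
    unfolding branch_def by (rule someI)
  then show "ev f x (branch k x) = 0" "rootrank f x (branch k x) = k" by auto
qed

lemma rootrank_less:
  assumes "ev f x y = 0" "y < y'"
  shows "rootrank f x y < rootrank f x y'"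
proof -
  have "finite {z. z < y' \<and> ev f x z = 0}" using fibre(1)[of x] by (rule finite_subset[rotated]) auto
  then show ?thesis unfolding rootrank_def using assms by (intro psubset_card_mono) auto
qed

lemma rootrank_mono: "y \<le> y' \<Longrightarrow> rootrank f x y \<le> rootrank f x y'"
proof -
  assume *: "y \<le> y'"
  have "finite {z. z < y' \<and> ev f x z = 0}" using fibre(1)[of x] by (rule finite_subset[rotated]) auto
  then show ?thesis unfolding rootrank_def using * by (intro card_mono) auto
qed

lemma branch_unique:
  assumes "ev f x y = 0" "rootrank f x y = k"
  shows "branch k x = y" "k < card {y. ev f x y = 0}"
proof -
  show k: "k < card {y. ev f x y = 0}"
    unfolding assms(2)[symmetric] rootrank_def using fibre(1)[of x] assms(1)
    by (intro psubset_card_mono) auto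
  show "branch k x = y"
    using branch[OF k] assms rootrank_less[of x y "branch k x"] rootrank_less[of x "branch k x" y]
    by (cases y "branch k x" rule: linorder_cases) auto
qed

text \<open>The rank of the level y0 - \<epsilon> is k and that of y0 + \<epsilon> exceeds k. Both
  are locally constant, so the root of rank k stays trapped between the two levels.\<close>

lemma continuous_on_branch:
  assumes "{a..b} \<inter> bad_x = {}" "x1 \<in> {a..b}" "k < card {y. ev f x1 y = 0}"
  shows "continuous_on {a..b} (branch k)"
  unfolding continuous_on_iff
proof (intro ballI allI impI)
  fix x0 e :: real assume x0: "x0 \<in> {a..b}" and e: "e > 0"
  have k: "k < card {y. ev f x y = 0}" if "x \<in> {a..b}" for x
    using root_count_constant[OF assms(1) that assms(2)] assms(3) by simp
  define y0 where "y0 = branch k x0"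
  have y0: "ev f x0 y0 = 0" "rootrank f x0 y0 = k" using branch[OF k[OF x0]] by (auto simp: y0_def)
  have bad: "x0 \<notin> bad_x" using assms(1) x0 by auto
  obtain \<epsilon> where \<epsilon>: "0 < \<epsilon>" "\<epsilon> < e" "\<And>y. \<bar>y - y0\<bar> \<le> \<epsilon> \<Longrightarrow> ev f x0 y = 0 \<Longrightarrow> y = y0"
    using simple_root_persists[OF y0(1) good_x(2)[OF bad y0(1)] e] by blast
  have nz: "ev f x0 (y0 - \<epsilon>) \<noteq> 0" "ev f x0 (y0 + \<epsilon>) \<noteq> 0"
    using \<epsilon>(3)[of "y0 - \<epsilon>"] \<epsilon>(3)[of "y0 + \<epsilon>"] \<epsilon>(1) by auto
  have "{y. y < y0 - \<epsilon> \<and> ev f x0 y = 0} = {y. y < y0 \<and> ev f x0 y = 0}"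
  proof (intro equalityI subsetI)
    fix y assume y: "y \<in> {y. y < y0 \<and> ev f x0 y = 0}"
    have "y < y0 - \<epsilon>"
    proof (rule ccontr)
      assume "\<not> y < y0 - \<epsilon>"
      then have "\<bar>y - y0\<bar> \<le> \<epsilon>" using y by auto
      then show False using \<epsilon>(3)[of y] y by auto
    qed
    then show "y \<in> {y. y < y0 - \<epsilon> \<and> ev f x0 y = 0}" using y by simp
  qed (use \<epsilon> in auto)
  then have r1: "rootrank f x0 (y0 - \<epsilon>) = k" using y0 by (simp add: rootrank_def)
  have r2: "rootrank f x0 (y0 + \<epsilon>) > k" using rootrank_less[of x0 y0 "y0 + \<epsilon>"] y0 \<epsilon> by simp
  from rank_eventually[OF bad nz(1)] rank_eventually[OF bad nz(2)]
  have "\<forall>\<^sub>F x in nhds x0. rootrank f x (y0 - \<epsilon>) = k \<and> rootrank f x (y0 + \<epsilon>) > k"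
  proof eventually_elim
    case (elim x)
    then show ?case using r1 r2 by simp
  qed
  then obtain \<delta> where \<delta>: "\<delta> > 0" "\<And>x. dist x x0 < \<delta> \<Longrightarrow> rootrank f x (y0 - \<epsilon>) = k \<and> rootrank f x (y0 + \<epsilon>) > k"
    unfolding eventually_nhds_metric by blast
  show "\<exists>\<delta>>0. \<forall>x'\<in>{a..b}. dist x' x0 < \<delta> \<longrightarrow> dist (branch k x') (branch k x0) < e"
  proof (intro exI[of _ \<delta>] conjI ballI impI)
    fix x assume x: "x \<in> {a..b}" "dist x x0 < \<delta>"
    note b = branch[OF k[OF x(1)]]
    have "\<not> branch k x < y0 - \<epsilon>" using rootrank_less[OF b(1), of "y0 - \<epsilon>"] b(2) \<delta>(2)[OF x(2)] by auto
    moreover have "\<not> y0 + \<epsilon> \<le> branch k x" using rootrank_mono[of "y0 + \<epsilon>" "branch k x" x] b(2) \<delta>(2)[OF x(2)] by auto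
    ultimately show "dist (branch k x) (branch k x0) < e" using \<epsilon>(2) by (auto simp: dist_real_def y0_def)
  qed (rule \<delta>(1))
qed

text \<open>Points of equal rank over an interval without bad abscissae lie on the graph of one
  continuous branch, which connects them.\<close>

lemma IVT_on_branch:
  fixes \<phi> :: "real \<times> real \<Rightarrow> real"
  assumes good: "{a..b} \<inter> bad_x = {}"
    and q: "fst q1 \<in> {a..b}" "fst q2 \<in> {a..b}" "q1 \<in> curve_of f" "q2 \<in> curve_of f"
    and rank: "rootrank f (fst q1) (snd q1) = k" "rootrank f (fst q2) (snd q2) = k"
    and \<phi>: "continuous_on UNIV \<phi>" "\<phi> q1 \<le> t" "t \<le> \<phi> q2"
  shows "\<exists>z\<in>curve_of f. fst z \<in> {a..b} \<and> rootrank f (fst z) (snd z) = k \<and> \<phi> z = t"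
proof -
  have qz: "ev f (fst q1) (snd q1) = 0" "ev f (fst q2) (snd q2) = 0" using q by (auto simp: curve_of_def)
  note b1 = branch_unique[OF qz(1) rank(1)] and b2 = branch_unique[OF qz(2) rank(2)]
  have cont: "continuous_on {a..b} (branch k)" by (rule continuous_on_branch[OF good q(1) b1(2)])
  define h where "h = (\<lambda>x. \<phi> (x, branch k x))"
  have hc: "continuous_on {a..b} h" unfolding h_def
    by (rule continuous_on_compose2[OF \<phi>(1)]) (auto intro!: continuous_intros cont)
  have h: "h (fst q1) \<le> t" "t \<le> h (fst q2)" using b1 b2 \<phi> by (auto simp: h_def)
  have "\<exists>x\<in>{a..b}. h x = t"
  proof (cases "fst q1 \<le> fst q2")
    case True
    have "\<exists>x\<ge>fst q1. x \<le> fst q2 \<and> h x = t"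
      by (rule IVT'[OF h True]) (rule continuous_on_subset[OF hc], use q in auto)
    then show ?thesis using q by force
  next
    case False
    then have "\<exists>x\<ge>fst q2. x \<le> fst q1 \<and> h x = t"
      by (intro IVT2') (use h q in \<open>auto intro: continuous_on_subset[OF hc]\<close>)
    then show ?thesis using q by force
  qed
  then obtain x where x: "x \<in> {a..b}" "h x = t" by blast
  have "k < card {y. ev f x y = 0}" using root_count_constant[OF good x(1) q(1)] b1(2) by simp
  note b = branch[OF this]
  show ?thesis by (rule bexI[of _ "(x, branch k x)"]) (use x b in \<open>auto simp: h_def curve_of_def\<close>)
qed

lemma curve_infinite:
  assumes "q \<in> curve_of f" "fst q \<notin> bad_x"
  shows "infinite (curve_of f)"
proof -
  have "open (- bad_x)" using finite_bad_x by (intro open_Compl finite_imp_closed)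
  then obtain e where e: "e > 0" "cball (fst q) e \<subseteq> - bad_x" 
    using assms(2) by (meson ComplI open_contains_cball)
  define a where "a = fst q - e"
  define b where "b = fst q + e"
  have good: "{a..b} \<inter> bad_x = {}" using e by (auto simp: a_def b_def cball_def dist_real_def subset_iff)
  have mem: "fst q \<in> {a..b}" using e by (simp add: a_def b_def)
  have qz: "ev f (fst q) (snd q) = 0" using assms by (auto simp: curve_of_def)
  define k where "k = rootrank f (fst q) (snd q)"
  have k: "k < card {y. ev f x y = 0}" if "x \<in> {a..b}" for x
    using root_count_constant[OF good that mem] branch_unique(2)[OF qz] k_def by simp
  have "(\<lambda>x. (x, branch k x)) ` {a..b} \<subseteq> curve_of f" using branch(1)[OF k] by (auto simp: curve_of_def)
  moreover have "infinite ((\<lambda>x. (x, branch k x)) ` {a..b})"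
  proof
    assume "finite ((\<lambda>x. (x, branch k x)) ` {a..b})"
    then have "finite {a..b}" by (rule finite_imageD) (auto simp: inj_on_def)
    then show False using e infinite_Icc[of a b] by (simp add: a_def b_def)
  qed
  ultimately show ?thesis by (meson finite_subset)
qed

end

section \<open>Polynomial functions on the plane and on double covers\<close>

text \<open>A real polynomial as a function on complex points. The bidegree is recorded because the
  Bezout counts need explicit degrees.\<close>

definition polyfun :: "nat \<Rightarrow> (complex \<times> complex \<Rightarrow> complex) \<Rightarrow> bool" where
  "polyfun e \<phi> \<longleftrightarrow> (\<exists>g. bideg_le g e \<and> (\<forall>p. \<phi> p = ev g (fst p) (snd p)))"

lemma polyfun_mono: "polyfun M \<phi> \<Longrightarrow> M \<le> N \<Longrightarrow> polyfun N \<phi>"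
  unfolding polyfun_def using bideg_le_mono by blast

lemma polyfun_add:
  assumes "polyfun M \<phi>" "polyfun M \<psi>"
  shows "polyfun M (\<lambda>p. \<phi> p + \<psi> p)"
proof -
  obtain g h where "bideg_le g M" "\<And>p. \<phi> p = ev g (fst p) (snd p)" "bideg_le h M" "\<And>p. \<psi> p = ev h (fst p) (snd p)"
    using assms unfolding polyfun_def by blast
  then show ?thesis unfolding polyfun_def by (intro exI[of _ "g + h"]) (simp add: bideg_le_add)
qed

lemma polyfun_mult:
  assumes "polyfun M \<phi>" "polyfun N \<psi>"
  shows "polyfun (M + N) (\<lambda>p. \<phi> p * \<psi> p)"
proof -
  obtain g h where "bideg_le g M" "\<And>p. \<phi> p = ev g (fst p) (snd p)" "bideg_le h N" "\<And>p. \<psi> p = ev h (fst p) (snd p)"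
    using assms unfolding polyfun_def by blast
  then show ?thesis unfolding polyfun_def by (intro exI[of _ "g * h"]) (simp add: bideg_le_mult)
qed

lemma polyfun_affine: "polyfun 1 (\<lambda>p. of_real a * fst p + of_real b * snd p + of_real c)"
  unfolding polyfun_def
proof (intro exI conjI allI)
  show "bideg_le [:[:c, a:], [:b:]:] 1" by (intro bideg_le_pCons) auto
qed (simp add: algebra_simps)

lemma polyfun_const: "polyfun N (\<lambda>p. of_real c)"
  unfolding polyfun_def
proof (intro exI conjI allI)
  show "bideg_le [:[:c:]:] N" by (intro bideg_le_pCons) auto
qed simp

lemma polyfun_uminus: "polyfun N \<phi> \<Longrightarrow> polyfun N (\<lambda>p. - \<phi> p)"
  using polyfun_mult[OF polyfun_const[of 0 "-1"], of N \<phi>] by simp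

lemma polyfun_diff: "polyfun N \<phi> \<Longrightarrow> polyfun N \<psi> \<Longrightarrow> polyfun N (\<lambda>p. \<phi> p - \<psi> p)"
  using polyfun_add[OF _ polyfun_uminus, of N \<phi> \<psi>] by simp

lemma polyfun_power2: "polyfun N \<phi> \<Longrightarrow> polyfun (N + N) (\<lambda>p. (\<phi> p)\<^sup>2)"
  unfolding power2_eq_square by (rule polyfun_mult)

lemma polyfun_sqd: "polyfun 2 (\<lambda>p. sqd p (cpl q))"
proof -
  have "polyfun (1 + 1) (\<lambda>p. (of_real 1 * fst p + of_real 0 * snd p + of_real (- fst q))\<^sup>2
     + (of_real 0 * fst p + of_real 1 * snd p + of_real (- snd q))\<^sup>2)"
    by (intro polyfun_add polyfun_power2 polyfun_affine)
  then show ?thesis unfolding one_add_one by (simp add: sqd_def cpl_def)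
qed

text \<open>Functions on the double cover \<open>\<eta>\<^sup>2 = E p\<close> that are polynomial in \<open>p\<close> and \<open>\<eta>\<close>.\<close>

definition qfun :: "(complex \<times> complex \<Rightarrow> complex) \<Rightarrow> nat \<Rightarrow> (complex \<times> complex \<Rightarrow> complex \<Rightarrow> complex) \<Rightarrow> bool" where
  "qfun E k \<Phi> \<longleftrightarrow> (\<exists>A B. polyfun k A \<and> polyfun k B \<and> (\<forall>p \<eta>. \<eta>\<^sup>2 = E p \<longrightarrow> \<Phi> p \<eta> = A p + \<eta> * B p))"

lemma qfun_mono: "qfun E M \<Phi> \<Longrightarrow> M \<le> N \<Longrightarrow> qfun E N \<Phi>"
  unfolding qfun_def using polyfun_mono by blast

lemma qfun_add:
  assumes "qfun E M \<Phi>" "qfun E M \<Psi>"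
  shows "qfun E M (\<lambda>p \<eta>. \<Phi> p \<eta> + \<Psi> p \<eta>)"
proof -
  obtain A B A' B' where "polyfun M A" "polyfun M B" "\<And>p \<eta>. \<eta>\<^sup>2 = E p \<Longrightarrow> \<Phi> p \<eta> = A p + \<eta> * B p"
    "polyfun M A'" "polyfun M B'" "\<And>p \<eta>. \<eta>\<^sup>2 = E p \<Longrightarrow> \<Psi> p \<eta> = A' p + \<eta> * B' p"
    using assms unfolding qfun_def by blast
  then show ?thesis unfolding qfun_def 
    by (intro exI[of _ "\<lambda>p. A p + A' p"] exI[of _ "\<lambda>p. B p + B' p"]) (auto intro: polyfun_add simp: algebra_simps)
qed

text \<open>The extra 2 pays for replacing \<eta>^2 by \<open>E p\<close>.\<close>

lemma qfun_mult:
  assumes "polyfun 2 E" "qfun E M \<Phi>" "qfun E N \<Psi>"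
  shows "qfun E (M + N + 2) (\<lambda>p \<eta>. \<Phi> p \<eta> * \<Psi> p \<eta>)"
proof -
  obtain A B A' B' where *: "polyfun M A" "polyfun M B" "\<And>p \<eta>. \<eta>\<^sup>2 = E p \<Longrightarrow> \<Phi> p \<eta> = A p + \<eta> * B p"
    "polyfun N A'" "polyfun N B'" "\<And>p \<eta>. \<eta>\<^sup>2 = E p \<Longrightarrow> \<Psi> p \<eta> = A' p + \<eta> * B' p"
    using assms(2,3) unfolding qfun_def by blast
  have 1: "polyfun (M + N + 2) (\<lambda>p. A p * A' p + B p * B' p * E p)"
    by (intro polyfun_add polyfun_mult * assms(1) polyfun_mono[OF polyfun_mult[OF *(1,4)]]) simp
  have 2: "polyfun (M + N + 2) (\<lambda>p. A p * B' p + B p * A' p)"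
    by (intro polyfun_add polyfun_mono[OF polyfun_mult[OF *(1,5)]] polyfun_mono[OF polyfun_mult[OF *(2,4)]]) simp_all
  have "\<Phi> p \<eta> * \<Psi> p \<eta> = (A p * A' p + B p * B' p * E p) + \<eta> * (A p * B' p + B p * A' p)" if "\<eta>\<^sup>2 = E p" for p \<eta>
    using *(3)[OF that] *(6)[OF that] unfolding that[symmetric] by (simp add: power2_eq_square algebra_simps)
  with 1 2 show ?thesis unfolding qfun_def by blast
qed

lemma qfun_const: "qfun E N (\<lambda>p \<eta>. of_real c)"
  unfolding qfun_def by (intro exI[of _ "\<lambda>p. of_real c"] exI[of _ "\<lambda>p. of_real 0"]) (simp add: polyfun_const del: of_real_0)

lemma qfun_sum:
  "(\<And>i. i \<in> I \<Longrightarrow> qfun E N (\<Phi> i)) \<Longrightarrow> qfun E N (\<lambda>p \<eta>. \<Sum>i\<in>I. \<Phi> i p \<eta>)"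
proof (induction I rule: infinite_finite_induct)
  case (insert i I)
  then show ?case by (simp add: qfun_add)
qed (use qfun_const[of E N 0] in auto)

lemma qfun_power:
  assumes "polyfun 2 E" "qfun E N \<Phi>"
  shows "qfun E (k * (N + 2)) (\<lambda>p \<eta>. \<Phi> p \<eta> ^ k)"
proof (induction k)
  case 0
  show ?case using qfun_const[of E 0 1] by simp
next
  case (Suc k)
  then show ?case using qfun_mult[OF assms Suc] by (simp add: algebra_simps)
qed

text \<open>Powers up to the d-th of either argument have degree at most \<open>d * (N + 2)\<close>.
  The 4 stems from two further uses of \<open>qfun_mult\<close>, for the constant coefficients and
  for the product of the two powers.\<close>

lemma qfun_ev:
  assumes "polyfun 2 E" "qfun E N \<Phi>" "qfun E N \<Psi>" "bideg_le f d"
  shows "qfun E (2 * (d * (N + 2)) + 4) (\<lambda>p \<eta>. ev f (\<Phi> p \<eta>) (\<Psi> p \<eta>))"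
proof -
  have "qfun E (d * (N + 2) + 2) (\<lambda>p \<eta>. evx (coeff f i) (\<Phi> p \<eta>))" for i
    unfolding evx_altdef
  proof (rule qfun_sum)
    fix j assume "j \<in> {..degree (coeff f i)}"
    then have "j \<le> d" using assms(4) by (auto simp: bideg_le_def intro: order_trans)
    then have "qfun E (d * (N + 2)) (\<lambda>p \<eta>. \<Phi> p \<eta> ^ j)"
      by (intro qfun_mono[OF qfun_power[OF assms(1,2)]] mult_right_mono) auto
    from qfun_mult[OF assms(1) qfun_const[of E 0] this]
    show "qfun E (d * (N + 2) + 2) (\<lambda>p \<eta>. of_real (coeff (coeff f i) j) * \<Phi> p \<eta> ^ j)" by simp
  qed
  note 1 = this
  show ?thesis unfolding ev_altdef
  proof (rule qfun_sum)
    fix i assume "i \<in> {..degree f}"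
    then have "i \<le> d" using assms(4) by (auto simp: bideg_le_def intro: order_trans)
    then have "qfun E (d * (N + 2)) (\<lambda>p \<eta>. \<Psi> p \<eta> ^ i)"
      by (intro qfun_mono[OF qfun_power[OF assms(1,3)]] mult_right_mono) auto
    from qfun_mult[OF assms(1) 1[of i] this]
    show "qfun E (2 * (d * (N + 2)) + 4) (\<lambda>p \<eta>. evx (coeff f i) (\<Phi> p \<eta>) * \<Psi> p \<eta> ^ i)" 
      by (rule qfun_mono) simp
  qed
qed

lemma qfun_affine:
  "qfun E 1 (\<lambda>p \<eta>. of_real a * fst p + of_real b * snd p + of_real c + of_real e * \<eta>)"
  unfolding qfun_def
proof (intro exI conjI allI impI)
  show "polyfun 1 (\<lambda>p. of_real a * fst p + of_real b * snd p + of_real c)" by (rule polyfun_affine)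
  show "polyfun 1 (\<lambda>p. of_real e)" by (rule polyfun_const)
qed (simp add: mult.commute)

text \<open>The trivial cover E = 0 with \<eta> = 0 in \<open>qfun_ev\<close>, whose degree 2 * (d *
  3) + 4 becomes 6 * d + 4.\<close>

lemma polyfun_ev_affine:
  assumes "bideg_le f d"
  shows "polyfun (6 * d + 4) (\<lambda>p. ev f (of_real a * fst p + of_real b * snd p + of_real c) 
    (of_real a' * fst p + of_real b' * snd p + of_real c'))"
proof -
  have E: "polyfun 2 (\<lambda>p. 0)" using polyfun_const[of 2 0] by simp
  define \<Phi> :: "complex \<times> complex \<Rightarrow> complex \<Rightarrow> complex" where "\<Phi> = (\<lambda>p \<eta>. ev f (of_real a * fst p + of_real b * snd p + of_real c + of_real 0 * \<eta>) 
    (of_real a' * fst p + of_real b' * snd p + of_real c' + of_real 0 * \<eta>))"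
  have "qfun (\<lambda>p. 0) (2 * (d * (1 + 2)) + 4) \<Phi>"
    unfolding \<Phi>_def by (rule qfun_ev[OF E qfun_affine qfun_affine assms])
  then obtain A B where A: "polyfun (2 * (d * (1 + 2)) + 4) A" 
    and *: "\<And>p \<eta>. \<eta>\<^sup>2 = 0 \<Longrightarrow> \<Phi> p \<eta> = A p + \<eta> * B p"
    unfolding qfun_def by blast
  have "A p = ev f (of_real a * fst p + of_real b * snd p + of_real c) 
    (of_real a' * fst p + of_real b' * snd p + of_real c')" for p using *[of 0 p] by (simp add: \<Phi>_def)
  then have "A = (\<lambda>p. ev f (of_real a * fst p + of_real b * snd p + of_real c) 
    (of_real a' * fst p + of_real b' * snd p + of_real c'))" by (simp add: fun_eq_iff)
  then show ?thesis using A by (simp add: mult.commute)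
qed

lemma card_le_fibres:
  assumes "finite W" "\<And>w. w \<in> W \<Longrightarrow> card {v \<in> W. g v = g w} \<le> m"
  shows "card W \<le> card (g ` W) * m"
proof -
  have "card W = (\<Sum>y\<in>g ` W. card {x \<in> W. g x = y})"
    using sum.image_gen[OF assms(1), of "\<lambda>_. 1::nat" g] by simp
  also have "\<dots> \<le> (\<Sum>y\<in>g ` W. m)" using assms(2) by (intro sum_mono) auto
  finally show ?thesis by simp
qed

section \<open>Affine maps determined by distances to three points\<close>

definition aff :: "(real \<times> real \<Rightarrow> real \<times> real) \<Rightarrow> bool" where
  "aff U \<longleftrightarrow> (\<exists>a b c a' b' c'. U = (\<lambda>p. (a * fst p + b * snd p + c, a' * fst p + b' * snd p + c')))"

definition det3 :: "real \<times> real \<Rightarrow> real \<times> real \<Rightarrow> real \<times> real \<Rightarrow> real" where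
  "det3 u v w = (fst v - fst u) * (snd w - snd u) - (snd v - snd u) * (fst w - fst u)"

text \<open>Subtracting two distance equations cancels the quadratic terms.\<close>

lemma distance_difference:
  fixes X Y x y :: complex
  assumes "(X - X0)\<^sup>2 + (Y - Y0)\<^sup>2 = (x - x0)\<^sup>2 + (y - y0)\<^sup>2"
    "(X - X1)\<^sup>2 + (Y - Y1)\<^sup>2 = (x - x1)\<^sup>2 + (y - y1)\<^sup>2"
    "k * 2 = (x0\<^sup>2 + y0\<^sup>2 - x1\<^sup>2 - y1\<^sup>2) - (X0\<^sup>2 + Y0\<^sup>2 - X1\<^sup>2 - Y1\<^sup>2)"
  shows "X * (X1 - X0) + Y * (Y1 - Y0) = x * (x1 - x0) + y * (y1 - y0) + k"
proof -
  have "(X * (X1 - X0) + Y * (Y1 - Y0)) * 2 - (x * (x1 - x0) + y * (y1 - y0) + k) * 2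
     = (((X - X0)\<^sup>2 + (Y - Y0)\<^sup>2) - ((x - x0)\<^sup>2 + (y - y0)\<^sup>2))
     - (((X - X1)\<^sup>2 + (Y - Y1)\<^sup>2) - ((x - x1)\<^sup>2 + (y - y1)\<^sup>2))
     + (((x0\<^sup>2 + y0\<^sup>2 - x1\<^sup>2 - y1\<^sup>2) - (X0\<^sup>2 + Y0\<^sup>2 - X1\<^sup>2 - Y1\<^sup>2)) - k * 2)"
    by (simp add: power2_eq_square algebra_simps)
  also have "\<dots> = 0" unfolding assms by simp
  finally have "(X * (X1 - X0) + Y * (Y1 - Y0)) * 2 = (x * (x1 - x0) + y * (y1 - y0) + k) * 2" by (simp only: right_minus_eq)
  then show ?thesis by (rule iffD1[OF mult_right_cancel, rotated]) simp
qed

text \<open>Two differences of distance equations form a linear system for p' with determinant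
  \<open>det3 q0' q1' q2'\<close>, solved by Cramer's rule. The coefficients are real although p and
  p' may be complex. The determinant identity makes the map invertible when \<open>q0\<close>,
  \<open>q1\<close>, \<open>q2\<close> are not collinear either.\<close>

lemma affine_of_distances:
  assumes "det3 q0' q1' q2' \<noteq> 0"
  shows "\<exists>a b c a' b' c'. (a * b' - b * a') * det3 q0' q1' q2' = det3 q0 q1 q2 \<and>
    (\<forall>p p'. sqd p' (cpl q0') = sqd p (cpl q0) \<longrightarrow> sqd p' (cpl q1') = sqd p (cpl q1) \<longrightarrow>
      sqd p' (cpl q2') = sqd p (cpl q2) \<longrightarrow>
      p' = (of_real a * fst p + of_real b * snd p + of_real c, of_real a' * fst p + of_real b' * snd p + of_real c'))"
proof -
  obtain x0 y0 x1 y1 x2 y2 where q: "q0 = (x0, y0)" "q1 = (x1, y1)" "q2 = (x2, y2)" by (metis surj_pair)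
  obtain X0 Y0 X1 Y1 X2 Y2 where Q: "q0' = (X0, Y0)" "q1' = (X1, Y1)" "q2' = (X2, Y2)" by (metis surj_pair)
  define D where "D = det3 q0' q1' q2'"
  have D0: "D \<noteq> 0" using assms by (simp add: D_def)
  have D: "D = (X1 - X0) * (Y2 - Y0) - (Y1 - Y0) * (X2 - X0)" by (simp add: D_def det3_def Q)
  define k1 where "k1 = ((x0\<^sup>2 + y0\<^sup>2 - x1\<^sup>2 - y1\<^sup>2) - (X0\<^sup>2 + Y0\<^sup>2 - X1\<^sup>2 - Y1\<^sup>2)) / 2"
  define k2 where "k2 = ((x0\<^sup>2 + y0\<^sup>2 - x2\<^sup>2 - y2\<^sup>2) - (X0\<^sup>2 + Y0\<^sup>2 - X2\<^sup>2 - Y2\<^sup>2)) / 2"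
  define a where "a = ((x1 - x0) * (Y2 - Y0) - (x2 - x0) * (Y1 - Y0)) / D"
  define b where "b = ((y1 - y0) * (Y2 - Y0) - (y2 - y0) * (Y1 - Y0)) / D"
  define c where "c = (k1 * (Y2 - Y0) - k2 * (Y1 - Y0)) / D"
  define a' where "a' = ((X1 - X0) * (x2 - x0) - (X2 - X0) * (x1 - x0)) / D"
  define b' where "b' = ((X1 - X0) * (y2 - y0) - (X2 - X0) * (y1 - y0)) / D"
  define c' where "c' = ((X1 - X0) * k2 - (X2 - X0) * k1) / D"
  have "(a * b' - b * a') * (D * D) = (a * D) * (b' * D) - (b * D) * (a' * D)" by (simp add: algebra_simps)
  also have "\<dots> = D * ((x1 - x0) * (y2 - y0) - (y1 - y0) * (x2 - x0))"
    using D0 unfolding a_def b_def a'_def b'_def by (simp add: D) (simp add: algebra_simps)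
  finally have det: "(a * b' - b * a') * D = det3 q0 q1 q2" using D0 by (simp add: det3_def q)
  have "p' = (of_real a * fst p + of_real b * snd p + of_real c, of_real a' * fst p + of_real b' * snd p + of_real c')"
    if h: "sqd p' (cpl q0') = sqd p (cpl q0)" "sqd p' (cpl q1') = sqd p (cpl q1)" "sqd p' (cpl q2') = sqd p (cpl q2)" for p p'
  proof -
    obtain x y where p: "p = (x, y)" by force
    obtain X Y where p': "p' = (X, Y)" by force
    let ?r = "complex_of_real"
    have k: "?r k1 * 2 = (?r x0^2 + ?r y0^2 - ?r x1^2 - ?r y1^2) - (?r X0^2 + ?r Y0^2 - ?r X1^2 - ?r Y1^2)"
      "?r k2 * 2 = (?r x0^2 + ?r y0^2 - ?r x2^2 - ?r y2^2) - (?r X0^2 + ?r Y0^2 - ?r X2^2 - ?r Y2^2)"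
      by (simp_all add: k1_def k2_def)
    have e1: "X * (?r X1 - ?r X0) + Y * (?r Y1 - ?r Y0) = x * (?r x1 - ?r x0) + y * (?r y1 - ?r y0) + ?r k1"
      by (rule distance_difference[OF _ _ k(1)]) (use h(1,2) in \<open>simp_all add: p p' sqd_def cpl_def q Q\<close>)
    have e2: "X * (?r X2 - ?r X0) + Y * (?r Y2 - ?r Y0) = x * (?r x2 - ?r x0) + y * (?r y2 - ?r y0) + ?r k2"
      by (rule distance_difference[OF _ _ k(2)]) (use h(1,3) in \<open>simp_all add: p p' sqd_def cpl_def q Q\<close>)
    have rD: "?r D = (?r X1 - ?r X0) * (?r Y2 - ?r Y0) - (?r Y1 - ?r Y0) * (?r X2 - ?r X0)"
      by (simp add: D)
    have rD0: "?r D \<noteq> 0" using D0 by simp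
    have X: "X * ?r D = (x * (?r x1 - ?r x0) + y * (?r y1 - ?r y0) + ?r k1) * (?r Y2 - ?r Y0)
       - (x * (?r x2 - ?r x0) + y * (?r y2 - ?r y0) + ?r k2) * (?r Y1 - ?r Y0)"
      unfolding e1[symmetric] e2[symmetric] rD by (simp add: algebra_simps)
    have Y: "Y * ?r D = (?r X1 - ?r X0) * (x * (?r x2 - ?r x0) + y * (?r y2 - ?r y0) + ?r k2)
       - (?r X2 - ?r X0) * (x * (?r x1 - ?r x0) + y * (?r y1 - ?r y0) + ?r k1)"
      unfolding e1[symmetric] e2[symmetric] rD by (simp add: algebra_simps)
    have ra: "?r a * ?r D = (?r x1 - ?r x0) * (?r Y2 - ?r Y0) - (?r x2 - ?r x0) * (?r Y1 - ?r Y0)"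
      "?r b * ?r D = (?r y1 - ?r y0) * (?r Y2 - ?r Y0) - (?r y2 - ?r y0) * (?r Y1 - ?r Y0)"
      "?r c * ?r D = ?r k1 * (?r Y2 - ?r Y0) - ?r k2 * (?r Y1 - ?r Y0)"
      "?r a' * ?r D = (?r X1 - ?r X0) * (?r x2 - ?r x0) - (?r X2 - ?r X0) * (?r x1 - ?r x0)"
      "?r b' * ?r D = (?r X1 - ?r X0) * (?r y2 - ?r y0) - (?r X2 - ?r X0) * (?r y1 - ?r y0)"
      "?r c' * ?r D = (?r X1 - ?r X0) * ?r k2 - (?r X2 - ?r X0) * ?r k1"
      using rD0 by (simp_all add: a_def b_def c_def a'_def b'_def c'_def)
    have "(?r a * x + ?r b * y + ?r c) * ?r D = (?r a * ?r D) * x + (?r b * ?r D) * y + ?r c * ?r D"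
      by (simp add: algebra_simps)
    also have "\<dots> = X * ?r D" unfolding ra X by (simp add: algebra_simps)
    finally have 1: "X = ?r a * x + ?r b * y + ?r c" using rD0 by simp
    have "(?r a' * x + ?r b' * y + ?r c') * ?r D = (?r a' * ?r D) * x + (?r b' * ?r D) * y + ?r c' * ?r D"
      by (simp add: algebra_simps)
    also have "\<dots> = Y * ?r D" unfolding ra Y by (simp add: algebra_simps)
    finally have 2: "Y = ?r a' * x + ?r b' * y + ?r c'" using rD0 by simp
    show ?thesis using 1 2 by (simp add: p p')
  qed
  with det show ?thesis unfolding D_def by blast
qed

section \<open>Related pairs of points\<close>

text \<open>\<open>N\<close> is the norm from the double cover, the product of the values on its two
  sheets. Square roots always exist over the complex numbers, so \<open>N\<close> vanishes exactly
  where one of the sheets does.\<close>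

lemma qfun_norm:
  assumes E: "polyfun 2 E" and q: "qfun E k \<Phi>"
  shows "\<exists>N. polyfun (2 * k + 2) N \<and> (\<forall>p. N p = 0 \<longleftrightarrow> (\<exists>\<eta>. \<eta>\<^sup>2 = E p \<and> \<Phi> p \<eta> = 0))"
proof -
  obtain A B where AB: "polyfun k A" "polyfun k B" "\<And>p \<eta>. \<eta>\<^sup>2 = E p \<Longrightarrow> \<Phi> p \<eta> = A p + \<eta> * B p"
    using q unfolding qfun_def by blast
  define N where "N = (\<lambda>p. (A p)\<^sup>2 - E p * (B p)\<^sup>2)"
  have "polyfun (2 * k + 2) N" unfolding N_def
    using polyfun_power2[OF AB(1)] polyfun_mult[OF E polyfun_power2[OF AB(2)]]
    by (intro polyfun_diff) (auto elim: polyfun_mono)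
  moreover have "N p = 0 \<longleftrightarrow> (\<exists>\<eta>. \<eta>\<^sup>2 = E p \<and> \<Phi> p \<eta> = 0)" for p
  proof
    assume N0: "N p = 0"
    define h where "h = csqrt (E p)"
    have h: "h\<^sup>2 = E p" "(- h)\<^sup>2 = E p" by (simp_all add: h_def)
    have "(A p + h * B p) * (A p + (- h) * B p) = (A p)\<^sup>2 - h\<^sup>2 * (B p)\<^sup>2"
      by (simp add: power2_eq_square algebra_simps)
    also have "\<dots> = 0" using N0 h by (simp add: N_def)
    finally have "\<Phi> p h = 0 \<or> \<Phi> p (- h) = 0" using AB(3)[OF h(1)] AB(3)[OF h(2)] by simp
    then show "\<exists>\<eta>. \<eta>\<^sup>2 = E p \<and> \<Phi> p \<eta> = 0" using h by blast
  next
    assume "\<exists>\<eta>. \<eta>\<^sup>2 = E p \<and> \<Phi> p \<eta> = 0"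
    then obtain \<eta> where e: "\<eta>\<^sup>2 = E p" "A p + \<eta> * B p = 0" using AB(3) by fastforce
    then have "A p = - \<eta> * B p" by (simp add: eq_neg_iff_add_eq_0)
    then have "(A p)\<^sup>2 = E p * (B p)\<^sup>2" by (simp add: power_mult_distrib e(1))
    then show "N p = 0" by (simp add: N_def)
  qed
  ultimately show ?thesis by blast
qed

context curve
begin

definition bezout_bound :: "nat \<Rightarrow> nat" where "bezout_bound e = (d + e)\<^sup>2 * d"

text \<open>Too many real zeros on the curve force \<open>f\<close> to divide the polynomial, which
  then vanishes at the complex zeros of \<open>f\<close> as well.\<close>

lemma polyfun_vanishes:
  assumes "polyfun e \<phi>" "finite S" "S \<subseteq> curve_of f" "card S > bezout_bound e" "\<And>p. p \<in> S \<Longrightarrow> \<phi> (cpl p) = 0"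
    and p: "p \<in> zeros_of f"
  shows "\<phi> p = 0"
proof -
  obtain g where g: "bideg_le g e" "\<And>p. \<phi> p = ev g (fst p) (snd p)" using assms(1) unfolding polyfun_def by blast
  have "S \<subseteq> curve_of f \<inter> curve_of g"
  proof
    fix s assume s: "s \<in> S"
    then have "ev g (complex_of_real (fst s)) (complex_of_real (snd s)) = 0" using assms(5) g(2) by (simp add: cpl_def)
    then show "s \<in> curve_of f \<inter> curve_of g" using s assms(3) by (auto simp: ev_of_real curve_of_def)
  qed
  have "f dvd g"
  proof (rule ccontr)
    assume "\<not> f dvd g"
    note b = common_zeros_bound[OF this g(1)]
    have "card S \<le> bezout_bound e" unfolding bezout_bound_def using card_mono[OF b(1) \<open>S \<subseteq> curve_of f \<inter> curve_of g\<close>] b(2) by linarith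
    then show False using assms(4) by simp
  qed
  then obtain k where "g = f * k" by (auto elim: dvdE)
  then show ?thesis using p g(2) by (simp add: zeros_of_def)
qed

text \<open>The indices (p, p') of the curves that pass through both grid points (q0, q0') and (q,
  q').\<close>

definition common_pairs :: "(real \<times> real) \<Rightarrow> (real \<times> real) \<Rightarrow> (real \<times> real) \<Rightarrow> (real \<times> real) \<Rightarrow> ((real \<times> real) \<times> (real \<times> real)) set" where
  "common_pairs q0 q0' q q' = {(p, p'). p \<in> curve_of f \<and> p' \<in> curve_of f \<and> sqd p q0 = sqd p' q0' \<and> sqd p q = sqd p' q'}"

text \<open>\<open>p'\<close> is written in the orthogonal frame spanned by \<open>q1' - q0'\<close>; its coordinate along the frame
  axis is affine in \<open>p\<close> and the square of the other coordinate is the quadratic polynomial \<open>E\<close>.\<close>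

lemma partner_exists:
  assumes ne': "q1' \<noteq> q0'"
    and S: "finite S" "S \<subseteq> curve_of f" "card S > bezout_bound (12 * d + 10)"
    and partner: "\<And>p. p \<in> S \<Longrightarrow> \<exists>p'. (p, p') \<in> common_pairs q0 q0' q1 q1'"
    and p: "p \<in> curve_of f"
  shows "\<exists>p'\<in>zeros_of f. sqd p' (cpl q0') = of_real (sqd p q0) \<and> sqd p' (cpl q1') = of_real (sqd p q1)"
proof -
  obtain x0 y0 x1 y1 where q: "q0 = (x0, y0)" "q1 = (x1, y1)" by (metis surj_pair)
  obtain X0 Y0 X1 Y1 where Q: "q0' = (X0, Y0)" "q1' = (X1, Y1)" by (metis surj_pair)
  define u where "u = X1 - X0"
  define v where "v = Y1 - Y0"
  define l where "l = u\<^sup>2 + v\<^sup>2"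
  have l: "l \<noteq> 0" using ne' by (auto simp: l_def u_def v_def Q sum_power2_eq_zero_iff)
  have uv: "X1 = X0 + u" "Y1 = Y0 + v" by (simp_all add: u_def v_def)
  let ?r = "complex_of_real"
  have rl: "?r l \<noteq> 0" "?r l = (?r u)\<^sup>2 + (?r v)\<^sup>2" using l by (simp, simp add: l_def)
  define a where "a = (x1 - x0) / l"
  define b where "b = (y1 - y0) / l"
  define c where "c = (x0\<^sup>2 + y0\<^sup>2 - x1\<^sup>2 - y1\<^sup>2 + l) / (2 * l)"
  \<comment> \<open>The prescribed distances give 2 l s = |p q0|^2 - |p q1|^2 + l, where the
    quadratic terms in p cancel.\<close>
  define s where "s = (\<lambda>p. ?r a * fst p + ?r b * snd p + ?r c)"
  define E where "E = (\<lambda>p. ?r (1 / l) * sqd p (cpl q0) - (s p)\<^sup>2)"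
  have s_eq: "s p * (2 * ?r l) = sqd p (cpl q0) - sqd p (cpl q1) + ?r l" for p
  proof -
    have al: "?r a * ?r l = ?r x1 - ?r x0" "?r b * ?r l = ?r y1 - ?r y0"
      "?r c * (2 * ?r l) = (?r x0)\<^sup>2 + (?r y0)\<^sup>2 - (?r x1)\<^sup>2 - (?r y1)\<^sup>2 + ?r l"
      using rl(1) by (simp_all add: a_def b_def c_def)
    have "s p * (2 * ?r l) = 2 * (?r a * ?r l) * fst p + 2 * (?r b * ?r l) * snd p + ?r c * (2 * ?r l)"
      by (simp add: s_def algebra_simps)
    also have "\<dots> = sqd p (cpl q0) - sqd p (cpl q1) + ?r l"
      unfolding al by (simp add: sqd_def cpl_def q power2_eq_square algebra_simps)
    finally show ?thesis .
  qed
  have E_eq: "?r l * (E p + (s p)\<^sup>2) = sqd p (cpl q0)" for p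
    using l by (simp add: E_def)
  have sE: "polyfun 1 s" unfolding s_def by (rule polyfun_affine)
  have "polyfun 2 (\<lambda>p. ?r (1 / l) * sqd p (cpl q0))"
    using polyfun_mult[OF polyfun_const[of 0 "1/l"] polyfun_sqd[of q0]] unfolding add_0 .
  moreover have "polyfun 2 (\<lambda>p. (s p)\<^sup>2)" using polyfun_power2[OF sE] unfolding one_add_one .
  ultimately have PE: "polyfun 2 E" unfolding E_def by (rule polyfun_diff)
  define X where "X = (\<lambda>p \<eta>. ?r X0 + s p * ?r u - \<eta> * ?r v)"
  define Y where "Y = (\<lambda>p \<eta>. ?r Y0 + s p * ?r v + \<eta> * ?r u)"
  have qX: "qfun E 1 X" 
    using qfun_affine[of E "a * u" "b * u" "X0 + c * u" "- v"] unfolding X_def s_def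
    by (simp add: algebra_simps)
  have qY: "qfun E 1 Y" 
    using qfun_affine[of E "a * v" "b * v" "Y0 + c * v" "u"] unfolding Y_def s_def
    by (simp add: algebra_simps)
  have XY: "sqd (X p \<eta>, Y p \<eta>) (cpl q0') = ?r l * ((s p)\<^sup>2 + \<eta>\<^sup>2)" 
    "sqd (X p \<eta>, Y p \<eta>) (cpl q1') = ?r l * ((s p)\<^sup>2 + \<eta>\<^sup>2) - s p * (2 * ?r l) + ?r l" for p \<eta>
    unfolding sqd_def cpl_def Q uv X_def Y_def rl(2) by (simp_all add: power2_eq_square algebra_simps)
  define \<Phi> where "\<Phi> = (\<lambda>p \<eta>. ev f (X p \<eta>) (Y p \<eta>))"
  have "qfun E (2 * (d * (1 + 2)) + 4) \<Phi>" unfolding \<Phi>_def by (rule qfun_ev[OF PE qX qY bideg])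
  \<comment> \<open>\<open>N p = 0\<close> says that one of the two candidates for the partner of p
    lies on the curve. Its degree is 2 * (6 * d + 4) + 2 = 12 * d + 10.\<close>
  from qfun_norm[OF PE this] obtain N where N: "polyfun (2 * (2 * (d * (1 + 2)) + 4) + 2) N"
    "\<And>p. N p = 0 \<longleftrightarrow> (\<exists>\<eta>. \<eta>\<^sup>2 = E p \<and> \<Phi> p \<eta> = 0)" by blast
  have N1: "polyfun (12 * d + 10) N" using N(1) by (rule polyfun_mono) simp
  have zero: "N (cpl p) = 0" if pS: "p \<in> S" for p
  proof -
    obtain p' where p': "p' \<in> curve_of f" "sqd p q0 = sqd p' q0'" "sqd p q1 = sqd p' q1'"
      using partner[OF pS] by (auto simp: common_pairs_def)
    define P where "P = cpl p'"
    have P: "sqd (cpl p) (cpl q0) = sqd P (cpl q0')" "sqd (cpl p) (cpl q1) = sqd P (cpl q1')"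
      using p' by (simp_all add: P_def sqd_cpl)
    define \<eta> where "\<eta> = ((snd P - ?r Y0) * ?r u - (fst P - ?r X0) * ?r v) / ?r l"
    define \<sigma> where "\<sigma> = ((fst P - ?r X0) * ?r u + (snd P - ?r Y0) * ?r v) / ?r l"
    have el: "\<eta> * ?r l = (snd P - ?r Y0) * ?r u - (fst P - ?r X0) * ?r v" 
      "\<sigma> * ?r l = (fst P - ?r X0) * ?r u + (snd P - ?r Y0) * ?r v"
      using rl(1) by (simp_all add: \<eta>_def \<sigma>_def)
    have "s (cpl p) * (2 * ?r l) = ((fst P - ?r X0) * ?r u + (snd P - ?r Y0) * ?r v) * 2"
      unfolding s_eq P unfolding sqd_def cpl_def Q uv rl(2) by (simp add: power2_eq_square algebra_simps)
    then have "s (cpl p) * (2 * ?r l) = \<sigma> * ?r l * 2" unfolding el .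
    then have ss: "s (cpl p) = \<sigma>" using rl(1) by simp
    have "X (cpl p) \<eta> * ?r l = ?r X0 * ?r l + (\<sigma> * ?r l) * ?r u - (\<eta> * ?r l) * ?r v"
      by (simp add: X_def ss algebra_simps)
    also have "\<dots> = fst P * ?r l" unfolding el unfolding rl(2) by (simp add: power2_eq_square algebra_simps)
    finally have X1: "X (cpl p) \<eta> = fst P" using rl(1) by simp
    have "Y (cpl p) \<eta> * ?r l = ?r Y0 * ?r l + (\<sigma> * ?r l) * ?r v + (\<eta> * ?r l) * ?r u"
      by (simp add: Y_def ss algebra_simps)
    also have "\<dots> = snd P * ?r l" unfolding el unfolding rl(2) by (simp add: power2_eq_square algebra_simps)
    finally have Y1: "Y (cpl p) \<eta> = snd P" using rl(1) by simp
    have "?r l * (E (cpl p) + (s (cpl p))\<^sup>2) = ?r l * ((s (cpl p))\<^sup>2 + \<eta>\<^sup>2)"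
      unfolding E_eq P using XY(1)[of "cpl p" \<eta>] by (simp add: X1 Y1)
    then have "\<eta>\<^sup>2 = E (cpl p)" using rl(1) by simp
    moreover have "\<Phi> (cpl p) \<eta> = 0" using p'(1) unfolding \<Phi>_def X1 Y1 P_def
      by (simp add: cpl_def ev_of_real curve_of_def)
    ultimately show ?thesis using N(2) by blast
  qed
  have "N (cpl p) = 0" by (rule polyfun_vanishes[OF N1 S zero]) (use p in auto)
  then obtain \<eta> where \<eta>: "\<eta>\<^sup>2 = E (cpl p)" "\<Phi> (cpl p) \<eta> = 0" using N(2) by blast
  define P where "P = (X (cpl p) \<eta>, Y (cpl p) \<eta>)"
  have "P \<in> zeros_of f" using \<eta> by (simp add: P_def \<Phi>_def zeros_of_def)
  moreover have 1: "sqd P (cpl q0') = of_real (sqd p q0)"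
    using XY(1)[of "cpl p" \<eta>] E_eq[of "cpl p"] by (simp add: P_def \<eta>(1) sqd_cpl add.commute)
  moreover have "sqd P (cpl q1') = of_real (sqd p q1)"
    using XY[of "cpl p" \<eta>] 1 s_eq[of "cpl p"] by (simp add: P_def sqd_cpl)
  ultimately show ?thesis by blast
qed

text \<open>The first summand guarantees enough distinct p for the Bezout count after fibres of size
  \<open>meet_bound\<close> are collapsed; the second excludes distinct related pairs that share a
  coordinate.\<close>

definition pair_bound :: nat where "pair_bound = meet_bound * bezout_bound (12 * d + 10) + meet_bound * meet_bound"

text \<open>The finite witness \<open>W\<close> lets an infinite set of common pairs count as large,
  although its \<open>card\<close> is 0.\<close>

definition related :: "(real \<times> real) \<Rightarrow> (real \<times> real) \<Rightarrow> (real \<times> real) \<Rightarrow> (real \<times> real) \<Rightarrow> bool" where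
  "related q0 q0' q q' \<longleftrightarrow> (\<exists>W. finite W \<and> W \<subseteq> common_pairs q0 q0' q q' \<and> card W > pair_bound)"

lemma common_pairs_fibre:
  assumes W: "W \<subseteq> common_pairs q0 q0' q q'"
  shows "card {w \<in> W. fst w = p} \<le> meet_bound" "card {w \<in> W. snd w = p'} \<le> meet_bound"
proof -
  have "{w \<in> W. fst w = p} \<subseteq> Pair p ` {v \<in> curve_of f. sqd v q0' = sqd p q0}"
    using W by (force simp: common_pairs_def)
  then have "card {w \<in> W. fst w = p} \<le> card (Pair p ` {v \<in> curve_of f. sqd v q0' = sqd p q0})"
    by (intro card_mono finite_imageI circle_points)
  also have "\<dots> \<le> meet_bound" by (rule order_trans[OF card_image_le[OF circle_points(1)] circle_points(2)])
  finally show "card {w \<in> W. fst w = p} \<le> meet_bound" .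
  have "{w \<in> W. snd w = p'} \<subseteq> (\<lambda>v. (v, p')) ` {v \<in> curve_of f. sqd v q0 = sqd p' q0'}"
    using W by (force simp: common_pairs_def)
  then have "card {w \<in> W. snd w = p'} \<le> card ((\<lambda>v. (v, p')) ` {v \<in> curve_of f. sqd v q0 = sqd p' q0'})"
    by (intro card_mono finite_imageI circle_points)
  also have "\<dots> \<le> meet_bound" by (rule order_trans[OF card_image_le[OF circle_points(1)] circle_points(2)])
  finally show "card {w \<in> W. snd w = p'} \<le> meet_bound" .
qed

lemma bisector_points:
  assumes "q \<noteq> q'"
  shows "finite {p \<in> curve_of f. sqd p q = sqd p q'}" "card {p \<in> curve_of f. sqd p q = sqd p q'} \<le> meet_bound"
proof -
  have eq: "{p \<in> curve_of f. sqd p q = sqd p q'} = {p \<in> curve_of f. 2 * (fst q' - fst q) * fst p + 2 * (snd q' - snd q) * snd p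
     = (fst q')\<^sup>2 + (snd q')\<^sup>2 - (fst q)\<^sup>2 - (snd q)\<^sup>2}"
    by (auto simp: sqd_def power2_eq_square algebra_simps)
  have "2 * (fst q' - fst q) \<noteq> 0 \<or> 2 * (snd q' - snd q) \<noteq> 0" using assms by (auto simp: prod_eq_iff)
  note * = line_points[OF this]
  show "finite {p \<in> curve_of f. sqd p q = sqd p q'}" "card {p \<in> curve_of f. sqd p q = sqd p q'} \<le> meet_bound"
    unfolding eq by (rule *)+
qed

text \<open>If q = q0 but q' differs from q0', then p' lies on the bisector of q0' and q'. This
  leaves at most \<open>meet_bound\<close> choices of p', each with at most
  \<open>meet_bound\<close> choices of p. The other case is symmetric.\<close>

lemma related_distinct:
  assumes "related q0 q0' q q'" "(q, q') \<noteq> (q0, q0')"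
  shows "q \<noteq> q0" "q' \<noteq> q0'"
proof -
  obtain W where W: "finite W" "W \<subseteq> common_pairs q0 q0' q q'" "card W > pair_bound" using assms(1) by (auto simp: related_def)
  note fib = common_pairs_fibre[OF W(2)]
  show "q \<noteq> q0"
  proof
    assume eq: "q = q0"
    then have "q0' \<noteq> q'" using assms(2) by auto
    note b = bisector_points[OF this]
    have "snd ` W \<subseteq> {p \<in> curve_of f. sqd p q0' = sqd p q'}"
      using W(2) eq by (auto simp: common_pairs_def)
    then have "card (snd ` W) \<le> meet_bound" using card_mono[OF b(1)] b(2) by (meson le_trans)
    moreover have "card W \<le> card (snd ` W) * meet_bound" by (rule card_le_fibres[OF W(1)]) (rule fib)
    ultimately have "card W \<le> meet_bound * meet_bound" by (meson le_trans mult_le_mono1)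
    then show False using W(3) by (simp add: pair_bound_def)
  qed
  show "q' \<noteq> q0'"
  proof
    assume eq: "q' = q0'"
    then have "q0 \<noteq> q" using assms(2) by auto
    note b = bisector_points[OF this]
    have "fst ` W \<subseteq> {p \<in> curve_of f. sqd p q0 = sqd p q}"
      using W(2) eq by (auto simp: common_pairs_def)
    then have "card (fst ` W) \<le> meet_bound" using card_mono[OF b(1)] b(2) by (meson le_trans)
    moreover have "card W \<le> card (fst ` W) * meet_bound" by (rule card_le_fibres[OF W(1)]) (rule fib)
    ultimately have "card W \<le> meet_bound * meet_bound" by (meson le_trans mult_le_mono1)
    then show False using W(3) by (simp add: pair_bound_def)
  qed
qed

lemma related_partner:
  assumes "related q0 q0' q q'" "(q, q') \<noteq> (q0, q0')" "p \<in> curve_of f"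
  shows "\<exists>p'\<in>zeros_of f. sqd p' (cpl q0') = of_real (sqd p q0) \<and> sqd p' (cpl q') = of_real (sqd p q)"
proof -
  obtain W where W: "finite W" "W \<subseteq> common_pairs q0 q0' q q'" "card W > pair_bound" using assms(1) by (auto simp: related_def)
  have "card W \<le> card (fst ` W) * meet_bound" 
    by (rule card_le_fibres[OF W(1)]) (rule common_pairs_fibre[OF W(2)])
  then have "meet_bound * bezout_bound (12 * d + 10) < card (fst ` W) * meet_bound" using W(3) unfolding pair_bound_def by linarith
  then have c: "card (fst ` W) > bezout_bound (12 * d + 10)" by (simp add: mult.commute)
  have ex: "\<exists>p'. (p, p') \<in> common_pairs q0 q0' q q'" if "p \<in> fst ` W" for p using that W(2) by force
  show ?thesis
    by (rule partner_exists[OF related_distinct(2)[OF assms(1,2)] _ _ c ex assms(3)])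
      (use W in \<open>auto simp: common_pairs_def\<close>)
qed

text \<open>For fixed p, the partners obtained from the different r all lie on one circle about
  \<open>q0'\<close>, so there are at most \<open>meet_bound\<close> of them and one serves a fixed
  share of \<open>R\<close>. As \<open>R\<close> has finitely many subsets, the same share occurs
  for infinitely many p.\<close>

lemma pigeonhole_partner:
  assumes inf: "infinite (curve_of f)" and "R \<noteq> {}"
    and R: "finite R" "\<And>r. r \<in> R \<Longrightarrow> related q0 q0' (fst r) (snd r) \<and> r \<noteq> (q0, q0')"
  shows "\<exists>I X. I \<subseteq> R \<and> card R \<le> meet_bound * card I \<and> X \<subseteq> curve_of f \<and> infinite X \<and>
     (\<forall>p\<in>X. \<exists>p'\<in>zeros_of f. \<forall>r\<in>insert (q0, q0') I. sqd p' (cpl (snd r)) = of_real (sqd p (fst r)))"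
proof -
  have "\<exists>I. \<exists>p'\<in>zeros_of f. I \<subseteq> R \<and> card R \<le> meet_bound * card I \<and>
      (\<forall>r\<in>insert (q0, q0') I. sqd p' (cpl (snd r)) = of_real (sqd p (fst r)))" if p: "p \<in> curve_of f" for p
  proof -
    have "\<forall>r\<in>R. \<exists>p'\<in>zeros_of f. sqd p' (cpl q0') = of_real (sqd p q0) \<and> sqd p' (cpl (snd r)) = of_real (sqd p (fst r))"
      using R(2) by (intro ballI related_partner[OF _ _ p]) auto
    from bchoice[OF this[unfolded Bex_def]] obtain h where h: "\<And>r. r \<in> R \<Longrightarrow> h r \<in> zeros_of f"
      "\<And>r. r \<in> R \<Longrightarrow> sqd (h r) (cpl q0') = of_real (sqd p q0)"
      "\<And>r. r \<in> R \<Longrightarrow> sqd (h r) (cpl (snd r)) = of_real (sqd p (fst r))" by blast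
    have "h ` R \<subseteq> {p' \<in> zeros_of f. sqd p' (cpl q0') = of_real (sqd p q0)}" using h by auto
    then have cK: "card (h ` R) \<le> meet_bound" using card_mono[OF circle_zeros(1)] circle_zeros(2) by (meson le_trans)
    define m where "m = Max ((\<lambda>r. card {v \<in> R. h v = h r}) ` R)"
    have "m \<in> (\<lambda>r. card {v \<in> R. h v = h r}) ` R" unfolding m_def using R(1) assms(2) by (intro Max_in) auto
    then obtain r0 where r0: "r0 \<in> R" "m = card {v \<in> R. h v = h r0}" by auto
    have "card R \<le> card (h ` R) * m"
      by (rule card_le_fibres[OF R(1)]) (use R(1) in \<open>auto simp: m_def\<close>)
    then have "card R \<le> meet_bound * m" using cK by (meson le_trans mult_le_mono1)
    moreover have "sqd (h r0) (cpl (snd r)) = of_real (sqd p (fst r))" 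
      if "r \<in> insert (q0, q0') {v \<in> R. h v = h r0}" for r
      using that h(2)[OF r0(1)] h(3)[of r] by auto
    ultimately show ?thesis unfolding r0(2)
      by (intro exI[of _ "{v \<in> R. h v = h r0}"] bexI[of _ "h r0"] conjI ballI h(1) r0(1)) auto
  qed
  then obtain I where I: "\<And>p. p \<in> curve_of f \<Longrightarrow> I p \<subseteq> R" "\<And>p. p \<in> curve_of f \<Longrightarrow> card R \<le> meet_bound * card (I p)"
    "\<And>p. p \<in> curve_of f \<Longrightarrow> \<exists>p'\<in>zeros_of f. \<forall>r\<in>insert (q0, q0') (I p). sqd p' (cpl (snd r)) = of_real (sqd p (fst r))"
    by metis
  have "finite (I ` curve_of f)" by (rule finite_subset[of _ "Pow R"]) (use R(1) I(1) in auto)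
  from pigeonhole_infinite[OF inf this] obtain a where a: "a \<in> curve_of f" "infinite {p \<in> curve_of f. I p = I a}"
    by blast
  have "\<exists>p'\<in>zeros_of f. \<forall>r\<in>insert (q0, q0') (I a). sqd p' (cpl (snd r)) = of_real (sqd p (fst r))"
    if "p \<in> {p \<in> curve_of f. I p = I a}" for p
    using I(3)[of p] that by simp
  then show ?thesis
    by (intro exI[of _ "I a"] exI[of _ "{p \<in> curve_of f. I p = I a}"] conjI ballI I a) auto
qed

end

lemma det3_aff:
  "det3 (a * fst u + b * snd u + c, a' * fst u + b' * snd u + c')
    (a * fst v + b * snd v + c, a' * fst v + b' * snd v + c')
    (a * fst w + b * snd w + c, a' * fst w + b' * snd w + c') = (a * b' - b * a') * det3 u v w"
  by (simp add: det3_def algebra_simps)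

lemma aff_inverse:
  assumes U: "U = (\<lambda>p. (a * fst p + b * snd p + c, a' * fst p + b' * snd p + c'))"
    and D: "a * b' - b * a' \<noteq> 0"
  shows "\<exists>T. aff T \<and> (\<forall>p. T (U p) = p) \<and> (\<forall>p. U (T p) = p)"
proof -
  define D where "D = a * b' - b * a'"
  have D0: "D \<noteq> 0" using D by (simp add: D_def)
  define T where "T = (\<lambda>p. ((b' / D) * fst p + (- b / D) * snd p + (b * c' - b' * c) / D,
     (- a' / D) * fst p + (a / D) * snd p + (a' * c - a * c') / D))"
  have "aff T" unfolding aff_def T_def by blast
  moreover have "T (U p) = p" for p
  proof -
    have "fst (T (U p)) = fst p * D / D"
      unfolding T_def U fst_conv snd_conv using D0 by (simp add: field_simps) (simp add: D_def algebra_simps)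
    moreover have "snd (T (U p)) = snd p * D / D"
      unfolding T_def U fst_conv snd_conv using D0 by (simp add: field_simps) (simp add: D_def algebra_simps)
    ultimately show ?thesis using D0 by (simp add: prod_eq_iff)
  qed
  moreover have "U (T p) = p" for p
  proof -
    have "fst (U (T p)) = fst p * D / D"
      unfolding T_def U fst_conv snd_conv using D0 by (simp add: field_simps) (simp add: D_def algebra_simps)
    moreover have "snd (U (T p)) = snd p * D / D"
      unfolding T_def U fst_conv snd_conv using D0 by (simp add: field_simps) (simp add: D_def algebra_simps)
    ultimately show ?thesis using D0 by (simp add: prod_eq_iff)
  qed
  ultimately show ?thesis by blast
qed

section \<open>From many related pairs to an isometry\<close>

context curve
begin

text \<open>Distances are required to be preserved only between points of the curve. On three
  noncollinear points this already makes an affine map an isometry of the plane, see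
  \<open>orthogonal_of_three_points\<close>.\<close>

definition symm :: "(real \<times> real \<Rightarrow> real \<times> real) \<Rightarrow> bool" where
  "symm U \<longleftrightarrow> aff U \<and> U ` curve_of f = curve_of f \<and>
     (\<forall>p\<in>curve_of f. \<forall>q\<in>curve_of f. sqd (U p) (U q) = sqd p q)"

lemma collinear_points:
  assumes "u \<noteq> v"
  shows "finite {w \<in> curve_of f. det3 u v w = 0}" "card {w \<in> curve_of f. det3 u v w = 0} \<le> meet_bound"
proof -
  have eq: "{w \<in> curve_of f. det3 u v w = 0} = {w \<in> curve_of f. - (snd v - snd u) * fst w + (fst v - fst u) * snd w
     = - (snd v - snd u) * fst u + (fst v - fst u) * snd u}"
    by (auto simp: det3_def algebra_simps)
  have "- (snd v - snd u) \<noteq> 0 \<or> (fst v - fst u) \<noteq> 0" using assms by (auto simp: prod_eq_iff)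
  note * = line_points[OF this]
  show "finite {w \<in> curve_of f. det3 u v w = 0}" "card {w \<in> curve_of f. det3 u v w = 0} \<le> meet_bound"
    unfolding eq by (rule *)+
qed

lemma exists_noncollinear:
  assumes "infinite (curve_of f)"
  shows "\<exists>u\<in>curve_of f. \<exists>v\<in>curve_of f. \<exists>w\<in>curve_of f. det3 u v w \<noteq> 0"
proof -
  obtain u v where uv: "u \<in> curve_of f" "v \<in> curve_of f" "u \<noteq> v" using two_points by blast
  have "infinite (curve_of f - {w \<in> curve_of f. det3 u v w = 0})"
    using assms collinear_points(1)[OF uv(3)] by (rule Diff_infinite_finite[rotated])
  then obtain w where "w \<in> curve_of f - {w \<in> curve_of f. det3 u v w = 0}"
    using infinite_imp_nonempty by blast
  then show ?thesis using uv by blast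
qed

lemma aff_preserves_curve:
  assumes U: "aff U" and X: "infinite X" "X \<subseteq> curve_of f" "\<And>p. p \<in> X \<Longrightarrow> U p \<in> curve_of f"
    and p: "p \<in> curve_of f"
  shows "U p \<in> curve_of f"
proof -
  obtain a b c a' b' c' where Udef: "U = (\<lambda>p. (a * fst p + b * snd p + c, a' * fst p + b' * snd p + c'))"
    using U unfolding aff_def by blast
  define \<phi> where "\<phi> = (\<lambda>p::complex\<times>complex. ev f (of_real a * fst p + of_real b * snd p + of_real c) 
    (of_real a' * fst p + of_real b' * snd p + of_real c'))"
  have pf: "polyfun (6 * d + 4) \<phi>" unfolding \<phi>_def by (rule polyfun_ev_affine[OF bideg])
  have \<phi>: "\<phi> (cpl q) = of_real (ev f (fst (U q)) (snd (U q)))" for q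
    unfolding ev_of_real[symmetric] by (simp add: \<phi>_def cpl_def Udef)
  obtain S where S: "finite S" "card S = Suc (bezout_bound (6 * d + 4))" "S \<subseteq> X"
    using infinite_arbitrarily_large[OF X(1)] by blast
  have "\<phi> (cpl p) = 0"
    by (rule polyfun_vanishes[OF pf S(1)]) (use S X p \<phi> in \<open>auto simp: curve_of_def\<close>)
  then show ?thesis unfolding \<phi> by (simp add: curve_of_def)
qed

text \<open>The difference of the two sides has bidegree at most 2 in p, so agreement at more than
  \<open>bezout_bound 2\<close> points spreads to the whole curve.\<close>

lemma sqd_identity:
  assumes U: "aff U" and S: "finite S" "S \<subseteq> curve_of f" "card S > bezout_bound 2"
    "\<And>p. p \<in> S \<Longrightarrow> sqd (U p) w = sqd p z"
    and p: "p \<in> curve_of f"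
  shows "sqd (U p) w = sqd p z"
proof -
  obtain a b c a' b' c' where Udef: "U = (\<lambda>p. (a * fst p + b * snd p + c, a' * fst p + b' * snd p + c'))"
    using U unfolding aff_def by blast
  define \<phi> where "\<phi> = (\<lambda>p::complex\<times>complex. ((of_real a * fst p + of_real b * snd p + of_real (c - fst w))\<^sup>2 + 
    (of_real a' * fst p + of_real b' * snd p + of_real (c' - snd w))\<^sup>2) - sqd p (cpl z))"
  have pf: "polyfun 2 \<phi>" unfolding \<phi>_def
    using polyfun_power2[OF polyfun_affine] unfolding one_add_one
    by (intro polyfun_diff polyfun_sqd polyfun_add)
  have \<phi>: "\<phi> (cpl q) = of_real (sqd (U q) w - sqd q z)" for q
    unfolding of_real_diff sqd_cpl[symmetric] \<phi>_def by (simp add: cpl_def Udef sqd_def algebra_simps)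
  have "\<phi> (cpl p) = 0"
    by (rule polyfun_vanishes[OF pf S(1-3)]) (use S(4) p \<phi> in auto)
  then show ?thesis unfolding \<phi> by simp
qed

text \<open>The first summand pays for pairs that complete a degenerate triangle on either side; the
  second leaves enough first components for \<open>sqd_identity\<close>.\<close>

definition related_bound :: nat where "related_bound = 2 * (meet_bound * meet_bound) + bezout_bound 2"

text \<open>Points p and pairs (q, q') play dual roles. Three pairs determine p' = U p from p; three
  points of the curve and their images then determine q' = S q from q, and the two affine maps agree
  on the curve. The 1 in the bound on \<open>card R\<close> allows for (q0, q0') itself, which is
  removed.\<close>

lemma many_related_symm:
  assumes inf: "infinite (curve_of f)"
    and R: "finite R" "R \<subseteq> curve_of f \<times> curve_of f" "\<And>r. r \<in> R \<Longrightarrow> related q0 q0' (fst r) (snd r)"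
      "card R > meet_bound * related_bound + 1"
    and q0: "q0 \<in> curve_of f"
  shows "\<exists>U. symm U \<and> U q0 = q0'"
proof -
  define R' where "R' = R - {(q0, q0')}"
  have cR': "card R' > meet_bound * related_bound" using R(4) R(1) by (auto simp: R'_def card_Diff_singleton_if)
  have R': "finite R'" "R' \<noteq> {}" "\<And>r. r \<in> R' \<Longrightarrow> related q0 q0' (fst r) (snd r) \<and> r \<noteq> (q0, q0')"
  proof -
    show "R' \<noteq> {}" using cR' by auto
  qed (use R in \<open>auto simp: R'_def\<close>)
  obtain I X where I: "I \<subseteq> R'" "card R' \<le> meet_bound * card I" and X: "X \<subseteq> curve_of f" "infinite X"
    "\<And>p. p \<in> X \<Longrightarrow> \<exists>p'\<in>zeros_of f. \<forall>r\<in>insert (q0, q0') I. sqd p' (cpl (snd r)) = of_real (sqd p (fst r))"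
    using pigeonhole_partner[OF inf R'(2,1,3)] by blast
  have "meet_bound * related_bound < meet_bound * card I" using I(2) cR' by linarith
  then have cI: "card I > related_bound" by simp
  have finI: "finite I" using I(1) R'(1) by (rule finite_subset)
  have Icurve: "fst r \<in> curve_of f" "snd r \<in> curve_of f" if "r \<in> I" for r
    using that I(1) R(2) by (auto simp: R'_def)
  obtain x where x: "x \<in> X" using infinite_imp_nonempty[OF X(2)] by blast
  then obtain x' where x': "\<And>r. r \<in> insert (q0, q0') I \<Longrightarrow> sqd x' (cpl (snd r)) = of_real (sqd x (fst r))"
    using X(3) by blast
  have fib1: "card {v \<in> I. fst v = q} \<le> meet_bound" for q
  proof -
    \<comment> \<open>Since \<open>x'\<close> may be complex, the real part of the distance equation
      is taken. It places the second component on a real circle about the real part of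
      \<open>x'\<close>.\<close>
    define m where "m = (Re (fst x'), Re (snd x'))"
    define t where "t = sqd x q - Re ((fst x')\<^sup>2 + (snd x')\<^sup>2) + (fst m)\<^sup>2 + (snd m)\<^sup>2"
    have "{v \<in> I. fst v = q} \<subseteq> Pair q ` {w \<in> curve_of f. sqd w m = t}"
    proof
      fix v assume v: "v \<in> {v \<in> I. fst v = q}"
      then have "Re (sqd x' (cpl (snd v))) = sqd x q" using x'[of v] by auto
      then have "sqd (snd v) m = t" 
        by (simp add: t_def m_def sqd_def cpl_def power2_eq_square algebra_simps)
      then show "v \<in> Pair q ` {w \<in> curve_of f. sqd w m = t}" 
        using v Icurve[of v] by (intro image_eqI[of _ _ "snd v"]) (auto simp: prod_eq_iff)
    qed
    then have "card {v \<in> I. fst v = q} \<le> card (Pair q ` {w \<in> curve_of f. sqd w m = t})"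
      by (intro card_mono finite_imageI circle_points)
    also have "\<dots> \<le> meet_bound" by (rule order_trans[OF card_image_le[OF circle_points(1)] circle_points(2)])
    finally show ?thesis .
  qed
  have fib2: "card {v \<in> I. snd v = q} \<le> meet_bound" for q
  proof -
    define t where "t = Re (sqd x' (cpl q))"
    have "{v \<in> I. snd v = q} \<subseteq> (\<lambda>w. (w, q)) ` {w \<in> curve_of f. sqd w x = t}"
    proof
      fix v assume v: "v \<in> {v \<in> I. snd v = q}"
      then have "t = sqd x (fst v)" using x'[of v] by (auto simp: t_def)
      then show "v \<in> (\<lambda>w. (w, q)) ` {w \<in> curve_of f. sqd w x = t}" 
        using v Icurve by (cases v) (auto simp: sqd_commute)
    qed
    then have "card {v \<in> I. snd v = q} \<le> card ((\<lambda>w. (w, q)) ` {w \<in> curve_of f. sqd w x = t})"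
      by (intro card_mono finite_imageI circle_points)
    also have "\<dots> \<le> meet_bound" by (rule order_trans[OF card_image_le[OF circle_points(1)] circle_points(2)])
    finally show ?thesis .
  qed
  obtain r1 where r1: "r1 \<in> I" using cI by (metis card.empty ex_in_conv not_less_zero)
  obtain q1 q1' where q1: "r1 = (q1, q1')" by (cases r1)
  have "related q0 q0' q1 q1'" "(q1, q1') \<noteq> (q0, q0')" using r1 I(1) R'(3)[of r1] q1 by auto
  from related_distinct[OF this] have ne: "q0 \<noteq> q1" "q0' \<noteq> q1'" by auto
  \<comment> \<open>Pairs that would make one of the two triangles degenerate. There are too few of
    them to exhaust \<open>I\<close>.\<close>
  define B1 where "B1 = {r \<in> I. det3 q0 q1 (fst r) = 0}"
  define B2 where "B2 = {r \<in> I. det3 q0' q1' (snd r) = 0}"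
  have b: "finite B1" "finite B2" using finI by (auto simp: B1_def B2_def)
  have "card B1 \<le> card (fst ` B1) * meet_bound"
  proof (rule card_le_fibres[OF b(1)])
    fix w assume "w \<in> B1"
    have "card {v \<in> B1. fst v = fst w} \<le> card {v \<in> I. fst v = fst w}"
      using finI by (intro card_mono) (auto simp: B1_def)
    then show "card {v \<in> B1. fst v = fst w} \<le> meet_bound" using fib1 by (rule le_trans)
  qed
  moreover have "card (fst ` B1) \<le> meet_bound"
    by (rule order_trans[OF card_mono[OF collinear_points(1)[OF ne(1)]] collinear_points(2)[OF ne(1)]])
      (use Icurve in \<open>auto simp: B1_def\<close>)
  ultimately have c1: "card B1 \<le> meet_bound * meet_bound" by (meson le_trans mult_le_mono1)
  have "card B2 \<le> card (snd ` B2) * meet_bound"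
  proof (rule card_le_fibres[OF b(2)])
    fix w assume "w \<in> B2"
    have "card {v \<in> B2. snd v = snd w} \<le> card {v \<in> I. snd v = snd w}"
      using finI by (intro card_mono) (auto simp: B2_def)
    then show "card {v \<in> B2. snd v = snd w} \<le> meet_bound" using fib2 by (rule le_trans)
  qed
  moreover have "card (snd ` B2) \<le> meet_bound"
    by (rule order_trans[OF card_mono[OF collinear_points(1)[OF ne(2)]] collinear_points(2)[OF ne(2)]])
      (use Icurve in \<open>auto simp: B2_def\<close>)
  ultimately have c2: "card B2 \<le> meet_bound * meet_bound" by (meson le_trans mult_le_mono1)
  have "card (B1 \<union> B2) < card I" using card_Un_le[of B1 B2] c1 c2 cI by (simp add: related_bound_def)
  then obtain r2 where r2: "r2 \<in> I" "r2 \<notin> B1 \<union> B2" 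
    using card_mono[of "B1 \<union> B2" I] b by (metis finite_UnI leD subsetI)
  obtain q2 q2' where q2: "r2 = (q2, q2')" by (cases r2)
  have D: "det3 q0 q1 q2 \<noteq> 0" and D': "det3 q0' q1' q2' \<noteq> 0" using r2 q2 by (auto simp: B1_def B2_def)
  obtain a b c a' b' c' where det: "(a * b' - b * a') * det3 q0' q1' q2' = det3 q0 q1 q2"
    and Uc: "\<And>p p'. sqd p' (cpl q0') = sqd p (cpl q0) \<Longrightarrow> sqd p' (cpl q1') = sqd p (cpl q1) \<Longrightarrow>
      sqd p' (cpl q2') = sqd p (cpl q2) \<Longrightarrow>
      p' = (of_real a * fst p + of_real b * snd p + of_real c, of_real a' * fst p + of_real b' * snd p + of_real c')"
    using affine_of_distances[OF D', of q0 q1 q2] by blast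
  define U where "U = (\<lambda>p. (a * fst p + b * snd p + c, a' * fst p + b' * snd p + c'))"
  have dU: "a * b' - b * a' \<noteq> 0" using det D by auto
  have affU: "aff U" unfolding aff_def U_def by blast
  have UX: "U p \<in> curve_of f \<and> (\<forall>r\<in>insert (q0, q0') I. sqd (U p) (snd r) = sqd p (fst r))" if "p \<in> X" for p
  proof -
    obtain p' where p': "p' \<in> zeros_of f" 
      "\<And>r. r \<in> insert (q0, q0') I \<Longrightarrow> sqd p' (cpl (snd r)) = of_real (sqd p (fst r))"
      using X(3)[OF \<open>p \<in> X\<close>] by blast
    \<comment> \<open>\<open>U\<close> has real coefficients, so the partner of a real point of
      \<open>X\<close> turns out to be real.\<close>
    have "p' = cpl (U p)"
      using Uc[of p' "cpl p"] p'(2)[of "(q0, q0')"] p'(2)[of "(q1, q1')"] p'(2)[of "(q2, q2')"] r1 r2 q1 q2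
      by (simp add: sqd_cpl) (simp add: cpl_def U_def)
    then show ?thesis using p' by (simp add: sqd_cpl)
  qed
  obtain T where T: "aff T" "\<And>p. T (U p) = p" "\<And>p. U (T p) = p"
    using aff_inverse[OF U_def dU] by blast
  have Ucurve: "U p \<in> curve_of f" if "p \<in> curve_of f" for p
    by (rule aff_preserves_curve[OF affU X(2,1) _ that]) (use UX in auto)
  have injU: "inj U" by (metis T(2) injI)
  have "infinite (U ` X)" using X(2) injU by (meson finite_imageD inj_on_subset subset_UNIV)
  \<comment> \<open>The inverse sends the infinite image of \<open>X\<close> back into the curve, so
    the same Bezout argument applies to it and \<open>U\<close> maps onto the curve.\<close>
  then have Tcurve: "T p \<in> curve_of f" if "p \<in> curve_of f" for p
    by (rule aff_preserves_curve[OF T(1) _ _ _ that]) (use UX X(1) T(2) in auto)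
  have img: "U ` curve_of f = curve_of f"
  proof
    show "curve_of f \<subseteq> U ` curve_of f" using Tcurve T(3) by (metis image_iff subsetI)
  qed (use Ucurve in auto)
  obtain SX where SX: "finite SX" "card SX = Suc (bezout_bound 2)" "SX \<subseteq> X"
    using infinite_arbitrarily_large[OF X(2)] by blast
  have all: "sqd (U p) (snd r) = sqd p (fst r)" if "r \<in> insert (q0, q0') I" "p \<in> curve_of f" for r p
    by (rule sqd_identity[OF affU SX(1) _ _ _ that(2)]) (use SX X(1) UX that(1) in auto)
  obtain u v w where uvw: "u \<in> curve_of f" "v \<in> curve_of f" "w \<in> curve_of f" "det3 u v w \<noteq> 0"
    using exists_noncollinear[OF inf] by blast
  \<comment> \<open>Roles are exchanged here: the known distances from q' to \<open>U u\<close>,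
    \<open>U v\<close>, \<open>U w\<close> determine q' affinely from q.\<close>
  have D2: "det3 (U u) (U v) (U w) \<noteq> 0" unfolding U_def det3_aff using uvw(4) dU by simp
  obtain \<alpha> \<beta> \<gamma> \<alpha>' \<beta>' \<gamma>' where Sc: "\<And>p p'. sqd p' (cpl (U u)) = sqd p (cpl u) \<Longrightarrow> sqd p' (cpl (U v)) = sqd p (cpl v) \<Longrightarrow>
      sqd p' (cpl (U w)) = sqd p (cpl w) \<Longrightarrow>
      p' = (of_real \<alpha> * fst p + of_real \<beta> * snd p + of_real \<gamma>, of_real \<alpha>' * fst p + of_real \<beta>' * snd p + of_real \<gamma>')"
    using affine_of_distances[OF D2, of u v w] by blast
  define S where "S = (\<lambda>p. (\<alpha> * fst p + \<beta> * snd p + \<gamma>, \<alpha>' * fst p + \<beta>' * snd p + \<gamma>'))"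
  have affS: "aff S" unfolding aff_def S_def by blast
  have sndS: "snd r = S (fst r)" if r: "r \<in> insert (q0, q0') I" for r
  proof -
    have "cpl (snd r) = cpl (S (fst r))"
      using Sc[of "cpl (snd r)" "cpl (fst r)"] all[OF r uvw(1)] all[OF r uvw(2)] all[OF r uvw(3)]
      by (simp add: sqd_cpl sqd_commute) (simp add: cpl_def S_def)
    then show ?thesis using inj_cpl by (simp add: inj_eq)
  qed
  \<comment> \<open>\<open>I\<close> lies on the graph of \<open>S\<close>, so it has as many first
    components as elements.\<close>
  have "inj_on fst I"
  proof (rule inj_onI)
    fix r s assume "r \<in> I" "s \<in> I" "fst r = fst s"
    moreover from this have "snd r = snd s" using sndS[of r] sndS[of s] by simp
    ultimately show "r = s" by (simp add: prod_eq_iff)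
  qed
  then have cf: "card (fst ` I) > bezout_bound 2" using cI by (simp add: card_image related_bound_def)
  have SU: "sqd (S q) (U p) = sqd q p" if "p \<in> curve_of f" "q \<in> curve_of f" for p q
  proof (rule sqd_identity[OF affS _ _ cf _ that(2)])
    fix z assume "z \<in> fst ` I"
    then obtain r where r: "r \<in> I" "z = fst r" by blast
    then show "sqd (S z) (U p) = sqd z p" using all[OF insertI2[OF r(1)] that(1)] sndS[of r] 
      by (simp add: sqd_commute)
  qed (use finI Icurve in auto)
  have eq: "S p = U p" if "p \<in> curve_of f" for p
  proof -
    have "sqd (S p) (U p) = 0" unfolding SU[OF that that] by (simp add: sqd_def)
    then show ?thesis by (simp only: sqd_eq_0_iff)
  qed
  have "symm U" unfolding symm_def using affU img SU eq by auto
  moreover have "U q0 = q0'" using eq[OF q0] sndS[of "(q0, q0')"] by simp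
  ultimately show ?thesis by blast
qed

end

section \<open>Isometries of the curve\<close>

definition zeta :: "real \<times> real \<Rightarrow> complex" where
  "zeta p = Complex (fst p) (snd p)"

lemma zeta_eq_iff [simp]: "zeta p = zeta q \<longleftrightarrow> p = q"
  by (simp add: zeta_def prod_eq_iff)

lemma sqd_zeta: "sqd p q = (cmod (zeta p - zeta q))\<^sup>2"
  by (simp add: sqd_def zeta_def cmod_power2)

lemma zeta_Re_Im [simp]: "zeta (Re z, Im z) = z"
  by (simp add: zeta_def)

lemma linear_system_trivial:
  fixes P Q :: real
  assumes "P * v1 + Q * v2 = 0" "P * w1 + Q * w2 = 0" "v1 * w2 - v2 * w1 \<noteq> 0"
  shows "P = 0" "Q = 0"
proof -
  have "P * (v1 * w2 - v2 * w1) = (P * v1 + Q * v2) * w2 - (P * w1 + Q * w2) * v2" by (simp add: algebra_simps)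
  then show "P = 0" using assms by simp
  have "Q * (v1 * w2 - v2 * w1) = (P * w1 + Q * w2) * v1 - (P * v1 + Q * v2) * w1" by (simp add: algebra_simps)
  then show "Q = 0" using assms by simp
qed

text \<open>\<open>g\<close>, \<open>h\<close>, \<open>k\<close> are the entries of M^T M - 1 for
  the linear part M. This quadratic form vanishes on two independent vectors and on their
  difference, so by polarization it is zero. The determinant \<open>t\<close> is then 1 or -1, which
  separates rotations from reflections.\<close>

lemma orthogonal_of_three_points:
  assumes U: "U = (\<lambda>p. (a * fst p + b * snd p + c, a' * fst p + b' * snd p + c'))"
    and D: "det3 p0 p1 p2 \<noteq> 0"
    and iso: "sqd (U p1) (U p0) = sqd p1 p0" "sqd (U p2) (U p0) = sqd p2 p0" "sqd (U p1) (U p2) = sqd p1 p2"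
  shows "\<exists>u e. cmod u = 1 \<and> ((\<forall>p. zeta (U p) = u * zeta p + e) \<or> (\<forall>p. zeta (U p) = u * cnj (zeta p) + e))"
proof -
  define v1 where "v1 = fst p1 - fst p0"
  define v2 where "v2 = snd p1 - snd p0"
  define w1 where "w1 = fst p2 - fst p0"
  define w2 where "w2 = snd p2 - snd p0"
  define g where "g = a\<^sup>2 + a'\<^sup>2 - 1"
  define h where "h = a * b + a' * b'"
  define k where "k = b\<^sup>2 + b'\<^sup>2 - 1"
  have D': "v1 * w2 - v2 * w1 \<noteq> 0" using D by (simp add: det3_def v1_def v2_def w1_def w2_def)
  have p1: "fst p1 = fst p0 + v1" "snd p1 = snd p0 + v2" by (simp_all add: v1_def v2_def)
  have p2: "fst p2 = fst p0 + w1" "snd p2 = snd p0 + w2" by (simp_all add: w1_def w2_def)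
  have 1: "g * v1\<^sup>2 + 2 * h * v1 * v2 + k * v2\<^sup>2 = 0"
    using iso(1) by (simp add: sqd_def U p1 g_def h_def k_def power2_eq_square algebra_simps)
  have 2: "g * w1\<^sup>2 + 2 * h * w1 * w2 + k * w2\<^sup>2 = 0"
    using iso(2) by (simp add: sqd_def U p2 g_def h_def k_def power2_eq_square algebra_simps)
  have 3: "g * (v1 - w1)\<^sup>2 + 2 * h * (v1 - w1) * (v2 - w2) + k * (v2 - w2)\<^sup>2 = 0"
    using iso(3) by (simp add: sqd_def U p1 p2 g_def h_def k_def power2_eq_square algebra_simps)
  have "2 * (g * v1 * w1 + h * (v1 * w2 + v2 * w1) + k * v2 * w2)
     = (g * v1\<^sup>2 + 2 * h * v1 * v2 + k * v2\<^sup>2) + (g * w1\<^sup>2 + 2 * h * w1 * w2 + k * w2\<^sup>2)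
      - (g * (v1 - w1)\<^sup>2 + 2 * h * (v1 - w1) * (v2 - w2) + k * (v2 - w2)\<^sup>2)"
    by (simp add: power2_eq_square algebra_simps)
  then have 4: "g * v1 * w1 + h * (v1 * w2 + v2 * w1) + k * v2 * w2 = 0" using 1 2 3 by simp
  have "(g * v1 + h * v2) * v1 + (h * v1 + k * v2) * v2 = 0" using 1 by (simp add: power2_eq_square algebra_simps)
  moreover have "(g * v1 + h * v2) * w1 + (h * v1 + k * v2) * w2 = 0" using 4 by (simp add: algebra_simps)
  ultimately have v: "g * v1 + h * v2 = 0" "h * v1 + k * v2 = 0" using linear_system_trivial[OF _ _ D'] by blast+
  have "(g * w1 + h * w2) * v1 + (h * w1 + k * w2) * v2 = 0" using 4 by (simp add: algebra_simps)
  moreover have "(g * w1 + h * w2) * w1 + (h * w1 + k * w2) * w2 = 0" using 2 by (simp add: power2_eq_square algebra_simps)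
  ultimately have w: "g * w1 + h * w2 = 0" "h * w1 + k * w2 = 0" using linear_system_trivial[OF _ _ D'] by blast+
  have gh: "g = 0" "h = 0" using linear_system_trivial[OF v(1) w(1) D'] .
  have k0: "k = 0" using linear_system_trivial[OF v(2) w(2) D'] by simp
  have o: "a\<^sup>2 + a'\<^sup>2 = 1" "a * b = - (a' * b')" "b\<^sup>2 + b'\<^sup>2 = 1" using gh k0 by (simp_all add: g_def h_def k_def)
  define t where "t = a * b' - a' * b"
  have "b = b * (a\<^sup>2 + a'\<^sup>2)" using o(1) by simp
  also have "\<dots> = (a * b) * a + b * a'\<^sup>2" by (simp add: power2_eq_square algebra_simps)
  also have "\<dots> = - a' * t" unfolding o(2) t_def by (simp add: power2_eq_square algebra_simps)
  finally have bt: "b = - a' * t" .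
  have "b' = b' * (a\<^sup>2 + a'\<^sup>2)" using o(1) by simp
  also have "\<dots> = b' * a\<^sup>2 - (- (a' * b')) * a'" by (simp add: power2_eq_square algebra_simps)
  also have "\<dots> = a * t" unfolding o(2)[symmetric] t_def by (simp add: power2_eq_square algebra_simps)
  finally have b't: "b' = a * t" .
  have "t\<^sup>2 * (a\<^sup>2 + a'\<^sup>2) = b\<^sup>2 + b'\<^sup>2" unfolding bt b't by (simp add: power2_eq_square algebra_simps)
  then have "t\<^sup>2 = 1" using o by simp
  then have t: "t = 1 \<or> t = -1" by (simp add: power2_eq_1_iff)
  have cm: "cmod (Complex a a') = 1" using o(1) by (simp add: cmod_def)
  show ?thesis using t
  proof
    assume "t = 1"
    then have "zeta (U p) = Complex a a' * zeta p + Complex c c'" for p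
      by (simp add: zeta_def U complex_eq_iff bt b't)
    then show ?thesis using cm by blast
  next
    assume "t = -1"
    then have "zeta (U p) = Complex a a' * cnj (zeta p) + Complex c c'" for p
      by (simp add: zeta_def U complex_eq_iff bt b't)
    then show ?thesis using cm by blast
  qed
qed

context curve
begin

text \<open>Iterating a nonzero translation puts infinitely many points of the curve on one
  line.\<close>

lemma no_translation:
  assumes "\<And>z. z \<in> zeta ` curve_of f \<Longrightarrow> z + \<delta> \<in> zeta ` curve_of f"
  shows "\<delta> = 0"
proof (rule ccontr)
  assume \<delta>: "\<delta> \<noteq> 0"
  obtain p where p: "p \<in> curve_of f" using two_points by blast
  have it: "zeta p + of_nat n * \<delta> \<in> zeta ` curve_of f" for n
  proof (induction n)
    case (Suc n)
    have "zeta p + of_nat (Suc n) * \<delta> = (zeta p + of_nat n * \<delta>) + \<delta>" by (simp add: algebra_simps)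
    then show ?case using assms[OF Suc] by (simp only:)
  qed (use p in simp)
  define g where "g = (\<lambda>n. (Re (zeta p + of_nat n * \<delta>), Im (zeta p + of_nat n * \<delta>)))"
  define L where "L = {q \<in> curve_of f. - Im \<delta> * fst q + Re \<delta> * snd q = - Im \<delta> * fst p + Re \<delta> * snd p}"
  have "- Im \<delta> \<noteq> 0 \<or> Re \<delta> \<noteq> 0" using \<delta> by (auto simp: complex_eq_iff)
  then have finL: "finite L" unfolding L_def by (rule line_points)
  have "g n \<in> L" for n
  proof -
    obtain q where q: "q \<in> curve_of f" "zeta p + of_nat n * \<delta> = zeta q" using it[of n] by blast
    have gq: "g n = q" unfolding g_def q(2) by (simp add: zeta_def)
    have "fst q = fst p + of_nat n * Re \<delta>" "snd q = snd p + of_nat n * Im \<delta>"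
      using q(2) by (simp_all add: zeta_def complex_eq_iff)
    then show ?thesis using q(1) unfolding gq L_def by (simp add: algebra_simps)
  qed
  then have "range g \<subseteq> L" by auto
  then have "finite (range g)" using finL by (rule finite_subset)
  moreover have "inj g"
  proof (rule injI)
    fix m n assume "g m = g n"
    then have "of_nat m * \<delta> = of_nat n * \<delta>" unfolding g_def prod.inject by (simp add: complex_eq_iff)
    then show "m = n" using \<delta> by simp
  qed
  ultimately show False using finite_imageD infinite_UNIV_nat by blast
qed

definition rots :: "(complex \<times> complex) set" where
  "rots = {(u, e). cmod u = 1 \<and> (\<lambda>z. u * z + e) ` zeta ` curve_of f = zeta ` curve_of f}"

definition refls :: "(complex \<times> complex) set" where
  "refls = {(u, e). cmod u = 1 \<and> (\<lambda>z. u * cnj z + e) ` zeta ` curve_of f = zeta ` curve_of f}"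

text \<open>Commutators of rotations are translations, so all rotations share their centre and the
  orbit of a point lies on a circle.\<close>

lemma rots_orbit:
  assumes z0: "z0 \<in> zeta ` curve_of f"
  shows "\<exists>S. finite S \<and> card S \<le> meet_bound \<and> (\<forall>(u, e)\<in>rots. u * z0 + e \<in> S)"
proof (cases "\<forall>(u, e)\<in>rots. u = 1")
  case True
  have "u * z0 + e = z0" if "(u, e) \<in> rots" for u e
  proof -
    have u: "u = 1" using True that by auto
    then have "(\<lambda>z. z + e) ` zeta ` curve_of f = zeta ` curve_of f" using that by (auto simp: rots_def)
    then have "e = 0" by (intro no_translation) blast
    then show ?thesis using u by simp
  qed
  moreover have "meet_bound \<ge> 1" by (simp add: meet_bound_def)
  ultimately show ?thesis by (intro exI[of _ "{z0}"]) auto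
next
  case False
  then obtain u0 e0 where r0: "(u0, e0) \<in> rots" "u0 \<noteq> 1" by auto
  \<comment> \<open>The fixed point of the rotation z -> u0 z + e0.\<close>
  define c where "c = e0 / (1 - u0)"
  define S where "S = zeta ` {p \<in> curve_of f. sqd p (Re c, Im c) = (cmod (z0 - c))\<^sup>2}"
  have "card S \<le> meet_bound" unfolding S_def by (rule order_trans[OF card_image_le[OF circle_points(1)] circle_points(2)])
  moreover have "finite S" unfolding S_def by (intro finite_imageI circle_points)
  moreover have "u * z0 + e \<in> S" if r: "(u, e) \<in> rots" for u e
  proof -
    have ri: "(\<lambda>z. u * z + e) ` zeta ` curve_of f = zeta ` curve_of f" "cmod u = 1" using r by (auto simp: rots_def)
    have ri0: "(\<lambda>z. u0 * z + e0) ` zeta ` curve_of f = zeta ` curve_of f" using r0 by (auto simp: rots_def)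
    \<comment> \<open>The two orders of composition have the same linear part, so they differ by
      this translation, which must be trivial.\<close>
    have "(u0 * e + e0) - (u * e0 + e) = 0"
    proof (rule no_translation)
      fix w assume "w \<in> zeta ` curve_of f"
      then obtain z1 where z1: "z1 \<in> zeta ` curve_of f" "w = u * z1 + e" using ri(1) by blast
      then obtain z where z: "z \<in> zeta ` curve_of f" "z1 = u0 * z + e0" using ri0 by blast
      have "u * z + e \<in> zeta ` curve_of f" using ri(1) z(1) by blast
      then have "u0 * (u * z + e) + e0 \<in> zeta ` curve_of f" using ri0 by blast
      also have "u0 * (u * z + e) + e0 = w + ((u0 * e + e0) - (u * e0 + e))"
        unfolding z1 z(2) by (simp add: algebra_simps)
      finally show "w + ((u0 * e + e0) - (u * e0 + e)) \<in> zeta ` curve_of f" .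
    qed
    then have "e * (1 - u0) = e0 * (1 - u)" by (simp add: algebra_simps)
    then have e: "e = c * (1 - u)" using r0(2) by (simp add: c_def field_simps)
    have "u * z0 + e - c = u * (z0 - c)" by (simp add: e algebra_simps)
    then have m: "cmod (u * z0 + e - c) = cmod (z0 - c)" using ri(2) by (simp add: norm_mult)
    obtain p where p: "p \<in> curve_of f" "u * z0 + e = zeta p" using ri(1) z0 by blast
    have "sqd p (Re c, Im c) = (cmod (z0 - c))\<^sup>2" unfolding sqd_zeta using m p(2) by simp
    then show ?thesis unfolding S_def p(2) using p(1) by blast
  qed
  ultimately show ?thesis by (intro exI[of _ S]) auto
qed

text \<open>A reflection composed with a fixed reflection is a rotation. The images of
  \<open>z0\<close> under reflections are thus rotated images of its preimage under the fixed
  one.\<close>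

lemma refls_orbit:
  assumes z0: "z0 \<in> zeta ` curve_of f"
  shows "\<exists>S. finite S \<and> card S \<le> meet_bound \<and> (\<forall>(u, e)\<in>refls. u * cnj z0 + e \<in> S)"
proof (cases "refls = {}")
  case False
  then obtain v c where vc: "(v, c) \<in> refls" by auto
  then have v: "(\<lambda>z. v * cnj z + c) ` zeta ` curve_of f = zeta ` curve_of f" "cmod v = 1" by (auto simp: refls_def)
  obtain x where x: "x \<in> zeta ` curve_of f" "z0 = v * cnj x + c" using v(1) z0 by blast
  obtain S where S: "finite S" "card S \<le> meet_bound" "\<And>u e. (u, e) \<in> rots \<Longrightarrow> u * x + e \<in> S"
    using rots_orbit[OF x(1)] by blast
  have "u * cnj z0 + e \<in> S" if "(u, e) \<in> refls" for u e
  proof -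
    have u: "(\<lambda>z. u * cnj z + e) ` zeta ` curve_of f = zeta ` curve_of f" "cmod u = 1" using that by (auto simp: refls_def)
    have "(\<lambda>z. (u * cnj v) * z + (u * cnj c + e)) = (\<lambda>z. u * cnj z + e) \<circ> (\<lambda>z. v * cnj z + c)"
      by (auto simp: fun_eq_iff algebra_simps)
    then have "(\<lambda>z. (u * cnj v) * z + (u * cnj c + e)) ` zeta ` curve_of f = zeta ` curve_of f"
      by (simp only: image_comp[symmetric] u(1) v(1))
    then have "(u * cnj v, u * cnj c + e) \<in> rots" using u(2) v(2) by (simp add: rots_def norm_mult)
    from S(3)[OF this] show ?thesis unfolding x(2) by (simp add: algebra_simps)
  qed
  then show ?thesis using S by (intro exI[of _ S]) auto
qed auto

text \<open>Bounding the images of one point is what the count needs: an exceptional pair is its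
  first point together with an image of that point.\<close>

lemma symm_images:
  assumes inf: "infinite (curve_of f)" and q: "q \<in> curve_of f"
  shows "finite {U q | U. symm U}" "card {U q | U. symm U} \<le> 2 * meet_bound"
proof -
  obtain S where S: "finite S" "card S \<le> meet_bound" "\<And>u e. (u, e) \<in> rots \<Longrightarrow> u * zeta q + e \<in> S"
    using rots_orbit[of "zeta q"] q by blast
  obtain S' where S': "finite S'" "card S' \<le> meet_bound" "\<And>u e. (u, e) \<in> refls \<Longrightarrow> u * cnj (zeta q) + e \<in> S'"
    using refls_orbit[of "zeta q"] q by blast
  have "zeta (U q) \<in> S \<union> S'" if U: "symm U" for U
  proof -
    have "aff U" using U by (simp add: symm_def)
    then obtain a b c a' b' c' where Udef: "U = (\<lambda>p. (a * fst p + b * snd p + c, a' * fst p + b' * snd p + c'))"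
      unfolding aff_def by blast
    obtain u v w where uvw: "u \<in> curve_of f" "v \<in> curve_of f" "w \<in> curve_of f" "det3 u v w \<noteq> 0"
      using exists_noncollinear[OF inf] by blast
    have img: "U ` curve_of f = curve_of f" using U by (simp add: symm_def)
    then have im: "(\<lambda>p. zeta (U p)) ` curve_of f = zeta ` curve_of f" by (metis image_image)
    obtain s e where s: "cmod s = 1" "(\<forall>p. zeta (U p) = s * zeta p + e) \<or> (\<forall>p. zeta (U p) = s * cnj (zeta p) + e)"
    proof -
      have "sqd (U v) (U u) = sqd v u" "sqd (U w) (U u) = sqd w u" "sqd (U v) (U w) = sqd v w"
        using U uvw by (simp_all add: symm_def)
      from orthogonal_of_three_points[OF Udef uvw(4) this] show thesis by (elim exE conjE) (rule that)
    qed
    from s(2) show ?thesis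
    proof
      assume "\<forall>p. zeta (U p) = s * zeta p + e"
      then have *: "zeta (U p) = s * zeta p + e" for p by (rule spec)
      have "(\<lambda>p. s * zeta p + e) ` curve_of f = zeta ` curve_of f" using im unfolding * .
      then have "(s, e) \<in> rots" using s(1) by (simp add: rots_def image_image)
      then show ?thesis unfolding * using S(3) by blast
    next
      assume "\<forall>p. zeta (U p) = s * cnj (zeta p) + e"
      then have *: "zeta (U p) = s * cnj (zeta p) + e" for p by (rule spec)
      have "(\<lambda>p. s * cnj (zeta p) + e) ` curve_of f = zeta ` curve_of f" using im unfolding * .
      then have "(s, e) \<in> refls" using s(1) by (simp add: refls_def image_image)
      then show ?thesis unfolding * using S'(3) by blast
    qed
  qed
  then have sub: "zeta ` {U q | U. symm U} \<subseteq> S \<union> S'" by (intro subsetI) (elim imageE CollectE exE conjE, simp only:)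
  have inj: "inj_on zeta A" for A by (simp add: inj_on_def)
  have fin: "finite (S \<union> S')" using S S' by simp
  show "finite {U q | U. symm U}" by (rule finite_imageD[OF finite_subset[OF sub fin] inj])
  have "card {U q | U. symm U} = card (zeta ` {U q | U. symm U})" by (simp add: card_image inj)
  also have "\<dots> \<le> card (S \<union> S')" by (rule card_mono[OF fin sub])
  also have "\<dots> \<le> 2 * meet_bound" using card_Un_le[of S S'] S(2) S'(2) by linarith
  finally show "card {U q | U. symm U} \<le> 2 * meet_bound" .
qed

end

section \<open>Cells of the grid\<close>

lemma double_count:
  assumes "finite A" "finite B"
  shows "(\<Sum>a\<in>A. card {b \<in> B. R a b}) = (\<Sum>b\<in>B. card {a \<in> A. R a b})"
  using assms by (intro sum_multicount_gen) auto

lemma card_fibre_sum: "finite A \<Longrightarrow> card A = (\<Sum>y\<in>g ` A. card {x \<in> A. g x = y})"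
  using sum.image_gen[of A "\<lambda>_. 1::nat" g] by simp

text \<open>In a cell with more than \<open>M\<close> points of \<open>N\<close> every point has an
  unrelated companion, so the points there are at most as many as the unrelated pairs. Every other
  cell contributes at most \<open>M\<close>.\<close>

lemma cell_count:
  assumes N: "finite N" and M: "\<And>w. w \<in> N \<Longrightarrow> card {v \<in> N. rel w v} \<le> M"
  shows "card N \<le> card (cell ` N) * M + card {(w, v). w \<in> N \<and> v \<in> N \<and> cell w = cell v \<and> \<not> rel w v}"
proof -
  define G where "G = {(w, v). w \<in> N \<and> v \<in> N \<and> cell w = cell v \<and> \<not> rel w v}"
  have "G \<subseteq> N \<times> N" by (auto simp: G_def)
  then have finG: "finite G" using N by (auto intro: finite_subset)
  have Gh: "card {x \<in> N. cell x = h} \<le> M + card {x \<in> G. cell (fst x) = h}" for h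
  proof -
    define A where "A = {x \<in> N. cell x = h}"
    have finA: "finite A" using N by (simp add: A_def)
    show ?thesis
    proof (cases "card A \<le> M")
      case True
      then show ?thesis by (simp add: A_def)
    next
      case False
      have "{x \<in> G. cell (fst x) = h} = Sigma A (\<lambda>w. {v \<in> A. \<not> rel w v})"
        by (auto simp: G_def A_def)
      then have "card {x \<in> G. cell (fst x) = h} = (\<Sum>w\<in>A. card {v \<in> A. \<not> rel w v})"
        using finA by (simp add: card_SigmaI)
      also have "\<dots> \<ge> (\<Sum>w\<in>A. 1)"
      proof (rule sum_mono)
        fix w assume "w \<in> A"
        then have "card {v \<in> N. rel w v} \<le> M" using M by (simp add: A_def)
        moreover have "card {v \<in> A. rel w v} \<le> card {v \<in> N. rel w v}"
          using N by (intro card_mono) (auto simp: A_def)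
        ultimately have "{v \<in> A. rel w v} \<noteq> A" using False by auto
        then have "{v \<in> A. \<not> rel w v} \<noteq> {}" by blast
        then show "1 \<le> card {v \<in> A. \<not> rel w v}" using finA by (simp add: Suc_leI card_gt_0_iff)
      qed
      finally have "card A \<le> card {x \<in> G. cell (fst x) = h}" by simp
      then show ?thesis by (simp add: A_def)
    qed
  qed
  have "card N = (\<Sum>h\<in>cell ` N. card {x \<in> N. cell x = h})" by (rule card_fibre_sum[OF N])
  also have "\<dots> \<le> (\<Sum>h\<in>cell ` N. M + card {x \<in> G. cell (fst x) = h})" by (intro sum_mono Gh)
  also have "\<dots> = card (cell ` N) * M + (\<Sum>h\<in>cell ` N. card {x \<in> G. cell (fst x) = h})"
    by (simp add: sum.distrib)
  also have "(\<Sum>h\<in>cell ` N. card {x \<in> G. cell (fst x) = h}) = (\<Sum>x\<in>G. card {h \<in> cell ` N. cell (fst x) = h})"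
    using N finG by (intro double_count) auto
  also have "\<dots> \<le> (\<Sum>x\<in>G. 1)"
  proof (rule sum_mono)
    fix x
    have "card {h \<in> cell ` N. cell (fst x) = h} \<le> card {cell (fst x)}" by (intro card_mono) auto
    then show "card {h \<in> cell ` N. cell (fst x) = h} \<le> 1" by simp
  qed
  also have "\<dots> = card G" by simp
  finally show ?thesis by (simp add: G_def)
qed

text \<open>When two intervals meet, the larger of the two left endpoints lies in both. Charging the
  pair to that endpoint and using the depth bound gives a count linear in
  \<open>card G\<close>.\<close>

lemma overlapping_intervals:
  fixes lo hi lo' hi' :: "'i \<Rightarrow> real"
  assumes G: "finite G"
    and depth: "\<And>t. card {i \<in> G. lo i \<le> t \<and> t \<le> hi i} \<le> K" "\<And>t. card {i \<in> G. lo' i \<le> t \<and> t \<le> hi' i} \<le> K"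
    and H: "H \<subseteq> {(i, j). i \<in> G \<and> j \<in> G \<and> lo i \<le> hi' j \<and> lo' j \<le> hi i \<and> lo i \<le> hi i \<and> lo' j \<le> hi' j}"
  shows "card H \<le> 2 * K * card G"
proof -
  define H1 where "H1 = Sigma G (\<lambda>i. {j \<in> G. lo' j \<le> lo i \<and> lo i \<le> hi' j})"
  define H2 where "H2 = Sigma G (\<lambda>j. {i \<in> G. lo i \<le> lo' j \<and> lo' j \<le> hi i})"
  have "card H1 = (\<Sum>i\<in>G. card {j \<in> G. lo' j \<le> lo i \<and> lo i \<le> hi' j})" unfolding H1_def using G by (intro card_SigmaI) auto
  also have "\<dots> \<le> (\<Sum>i\<in>G. K)" by (intro sum_mono depth)
  finally have 1: "card H1 \<le> K * card G" by (simp add: mult.commute)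
  have "card H2 = (\<Sum>j\<in>G. card {i \<in> G. lo i \<le> lo' j \<and> lo' j \<le> hi i})" unfolding H2_def using G by (intro card_SigmaI) auto
  also have "\<dots> \<le> (\<Sum>i\<in>G. K)" by (intro sum_mono depth)
  finally have 2: "card H2 \<le> K * card G" by (simp add: mult.commute)
  have fin: "finite H1" "finite H2" using G by (auto simp: H1_def H2_def)
  have "H \<subseteq> H1 \<union> prod.swap ` H2"
  proof
    fix x assume "x \<in> H"
    then obtain i j where ij: "x = (i, j)" "i \<in> G" "j \<in> G" "lo i \<le> hi' j" "lo' j \<le> hi i" "lo i \<le> hi i" "lo' j \<le> hi' j"
      using H by blast
    show "x \<in> H1 \<union> prod.swap ` H2"
    proof (cases "lo' j \<le> lo i")
      case True
      then show ?thesis using ij by (simp add: H1_def)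
    next
      case False
      then have "(j, i) \<in> H2" using ij by (simp add: H2_def)
      then have "prod.swap (j, i) \<in> prod.swap ` H2" by (rule imageI)
      then show ?thesis using ij by simp
    qed
  qed
  then have "card H \<le> card (H1 \<union> prod.swap ` H2)" using fin by (intro card_mono) auto
  also have "\<dots> \<le> card H1 + card H2" 
    using card_Un_le[of H1 "prod.swap ` H2"] card_image_le[OF fin(2), of prod.swap] by linarith
  finally show ?thesis using 1 2 by linarith
qed

section \<open>Arcs of the curve and blocks of consecutive points on them\<close>

context curve
begin

text \<open>For points over good abscissae this names an arc: the gap between bad abscissae that
  contains the point, and the branch over that gap.\<close>

definition piece :: "real \<times> real \<Rightarrow> nat \<times> nat" where
  "piece q = (card {e \<in> bad_x. e < fst q}, rootrank f (fst q) (snd q))"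

definition idx :: "(real \<times> real) set \<Rightarrow> real \<times> real \<Rightarrow> nat" where
  "idx P q = card {v \<in> P. piece v = piece q \<and> fst v < fst q}"

definition chunk :: "(real \<times> real) set \<Rightarrow> nat \<Rightarrow> real \<times> real \<Rightarrow> (nat \<times> nat) \<times> nat" where
  "chunk P s q = (piece q, idx P q div s)"

lemma idx_less:
  assumes "finite P" "v \<in> P" "piece v = piece q" "fst v < fst q"
  shows "idx P v < idx P q"
  unfolding idx_def by (rule psubset_card_mono) (use assms in auto)

lemma idx_inj:
  assumes "finite P" "P \<subseteq> curve_of f" "v \<in> P" "q \<in> P" "piece v = piece q" "idx P v = idx P q"
  shows "v = q"
proof -
  have x: "fst v = fst q"
    using idx_less[OF assms(1,3,5)] idx_less[OF assms(1,4) assms(5)[symmetric]] assms(6)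
    by (cases "fst v" "fst q" rule: linorder_cases) auto
  have "v \<in> curve_of f" "q \<in> curve_of f" using assms(2-4) by blast+
  then have "ev f (fst v) (snd v) = 0" "ev f (fst q) (snd q) = 0" by (simp_all add: curve_of_def)
  note b = branch_unique(1)[OF this(1) refl] branch_unique(1)[OF this(2) refl]
  have "rootrank f (fst v) (snd v) = rootrank f (fst q) (snd q)" using assms(5) by (simp add: piece_def)
  then have "snd v = snd q" using b x by metis
  then show ?thesis using x by (simp add: prod_eq_iff)
qed

lemma chunk_size:
  assumes P: "finite P" "P \<subseteq> curve_of f" and s: "s > 0"
  shows "card {q \<in> P. chunk P s q = c} \<le> s"
proof -
  define l where "l = snd c"
  have "inj_on (idx P) {q \<in> P. chunk P s q = c}"
    by (rule inj_onI) (use idx_inj[OF P] in \<open>auto simp: chunk_def\<close>)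
  moreover have "idx P ` {q \<in> P. chunk P s q = c} \<subseteq> {l * s..<l * s + s}"
  proof
    fix x assume "x \<in> idx P ` {q \<in> P. chunk P s q = c}"
    then obtain q where "x = idx P q" "chunk P s q = c" by blast
    then have "x div s = l" unfolding l_def by (simp add: chunk_def prod_eq_iff)
    then have "l * s + x mod s = x" using div_mult_mod_eq[of x s] by simp
    moreover have "x mod s < s" using s by simp
    ultimately show "x \<in> {l * s..<l * s + s}" by (simp only: atLeastLessThan_iff) linarith
  qed
  ultimately have "card {q \<in> P. chunk P s q = c} \<le> card {l * s..<l * s + s}"
    by (intro card_inj_on_le) auto
  then show ?thesis by simp
qed

text \<open>The number of possible values of \<open>piece\<close>; each component ranges from 0 up
  to its bound, hence the two added ones.\<close>

definition piece_bound :: nat where "piece_bound = ((2 * d)\<^sup>2 + d + 1) * (d + 1)"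

lemma chunk_count:
  assumes P: "finite P" "P \<subseteq> curve_of f"
  shows "card (chunk P s ` P) \<le> piece_bound * (card P div s + 1)"
proof -
  have "chunk P s ` P \<subseteq> ({..(2 * d)\<^sup>2 + d} \<times> {..d}) \<times> {..card P div s}"
  proof
    fix c assume "c \<in> chunk P s ` P"
    then obtain q where q: "q \<in> P" "c = chunk P s q" by blast
    have "card {e \<in> bad_x. e < fst q} \<le> card bad_x" using finite_bad_x by (intro card_mono) auto
    then have 1: "card {e \<in> bad_x. e < fst q} \<le> (2 * d)\<^sup>2 + d" using card_bad_x by linarith
    have "rootrank f (fst q) (snd q) \<le> card {y. ev f (fst q) y = 0}"
      unfolding rootrank_def using fibre(1) by (intro card_mono) auto
    then have 2: "rootrank f (fst q) (snd q) \<le> d" using fibre(2)[of "fst q"] by linarith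
    have "idx P q \<le> card P" unfolding idx_def using P by (intro card_mono) auto
    then have 3: "idx P q div s \<le> card P div s" by (rule div_le_mono)
    show "c \<in> ({..(2 * d)\<^sup>2 + d} \<times> {..d}) \<times> {..card P div s}" using 1 2 3 by (simp add: q(2) chunk_def piece_def)
  qed
  then have "card (chunk P s ` P) \<le> card (({..(2 * d)\<^sup>2 + d} \<times> {..d}) \<times> {..card P div s})"
    by (intro card_mono) auto
  also have "\<dots> = piece_bound * (card P div s + 1)" by (simp add: card_cartesian_product piece_bound_def)
  finally show ?thesis .
qed

text \<open>Each such chunk yields, by the intermediate value theorem, a point of the curve at
  squared distance t from p whose abscissa lies in the range of the chunk. Chunks of one piece have
  disjoint ranges, so these points are distinct, and all of them lie on one circle.\<close>

lemma chunk_depth: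
  assumes P: "finite P" "P \<subseteq> curve_of f" "fst ` P \<inter> bad_x = {}"
  shows "card {i \<in> chunk P s ` P. \<exists>q1\<in>P. \<exists>q2\<in>P. chunk P s q1 = i \<and> chunk P s q2 = i \<and> sqd p q1 \<le> t \<and> t \<le> sqd p q2} \<le> meet_bound"
    (is "card ?I \<le> meet_bound")
proof -
  define bc where "bc = (\<lambda>x. card {e \<in> bad_x. e < x})"
  have bc_mono: "bc x \<le> bc y" if "x \<le> y" for x y
    unfolding bc_def using finite_bad_x that by (intro card_mono) auto
  define Q where "Q = (\<lambda>i z q1 q2. q1 \<in> P \<and> q2 \<in> P \<and> chunk P s q1 = i \<and> chunk P s q2 = i \<and> z \<in> curve_of f \<and> sqd z p = t
      \<and> min (fst q1) (fst q2) \<le> fst z \<and> fst z \<le> max (fst q1) (fst q2) \<and> piece z = fst i)"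
  define II where "II = ?I"
  have ex: "\<exists>z q1 q2. Q i z q1 q2" if iI: "i \<in> II" for i
  proof -
    obtain q1 q2 where q: "q1 \<in> P" "q2 \<in> P" "chunk P s q1 = i" "chunk P s q2 = i" "sqd p q1 \<le> t" "t \<le> sqd p q2"
      using iI unfolding II_def by blast
    define a where "a = min (fst q1) (fst q2)"
    define b where "b = max (fst q1) (fst q2)"
    have pq: "piece q1 = fst i" "piece q2 = fst i" using q(3,4) by (auto simp: chunk_def)
    have bq: "bc (fst q1) = fst (fst i)" "bc (fst q2) = fst (fst i)"
      and rq: "rootrank f (fst q1) (snd q1) = snd (fst i)" "rootrank f (fst q2) (snd q2) = snd (fst i)"
      using arg_cong[OF pq(1), of fst] arg_cong[OF pq(2), of fst] arg_cong[OF pq(1), of snd] arg_cong[OF pq(2), of snd]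
      by (simp_all add: piece_def bc_def)
    then have bcq: "bc a = fst (fst i)" "bc b = fst (fst i)"
      by (auto simp: a_def b_def min_def max_def)
    have ab: "a \<notin> bad_x" "b \<notin> bad_x" using P(3) q(1,2) by (auto simp: a_def b_def min_def max_def)
    have good: "{a..b} \<inter> bad_x = {}"
    proof (rule ccontr)
      assume "{a..b} \<inter> bad_x \<noteq> {}"
      then obtain e where e: "e \<in> bad_x" "a \<le> e" "e \<le> b" by auto
      then have "a < e" "e < b" using ab by (auto simp: less_le)
      then have "{e' \<in> bad_x. e' < a} \<subseteq> {e' \<in> bad_x. e' < b}" "e \<in> {e' \<in> bad_x. e' < b}" "e \<notin> {e' \<in> bad_x. e' < a}"
        using e(1) by auto
      then have "{e' \<in> bad_x. e' < a} \<subset> {e' \<in> bad_x. e' < b}" by blast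
      then have "bc a < bc b" unfolding bc_def using finite_bad_x by (intro psubset_card_mono) auto
      then show False using bcq by simp
    qed
    have cont: "continuous_on UNIV (\<lambda>z. sqd p z)" unfolding sqd_def by (intro continuous_intros)
    have "\<exists>z\<in>curve_of f. fst z \<in> {a..b} \<and> rootrank f (fst z) (snd z) = snd (fst i) \<and> sqd p z = t"
      by (rule IVT_on_branch[OF good _ _ _ _ rq cont q(5,6)])
        (use q(1,2) P(2) in \<open>auto simp: a_def b_def\<close>)
    then obtain z where z: "z \<in> curve_of f" "fst z \<in> {a..b}" "rootrank f (fst z) (snd z) = snd (fst i)" "sqd p z = t" by blast
    have "bc (fst z) = fst (fst i)" using bc_mono[of a "fst z"] bc_mono[of "fst z" b] bcq z(2) by auto
    then have "piece z = fst i" using z(3) by (simp add: piece_def bc_def prod_eq_iff)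
    then have "Q i z q1 q2" using q(1-4) z by (auto simp: Q_def a_def b_def sqd_commute)
    then show ?thesis by blast
  qed
  then obtain z q1 q2 where "\<And>i. i \<in> II \<Longrightarrow> Q i (z i) (q1 i) (q2 i)"
    by metis
  note z = this[unfolded Q_def]
  have order: "fst u < fst v" if "u \<in> P" "v \<in> P" "chunk P s u = i" "chunk P s v = j" "fst i = fst j" "snd i < snd j" for u v i j
  proof (rule ccontr)
    assume n: "\<not> fst u < fst v"
    have pi: "piece u = piece v" using that by (auto simp: chunk_def)
    have "idx P v \<le> idx P u" unfolding idx_def using n P(1) pi by (intro card_mono) auto
    then have "idx P v div s \<le> idx P u div s" by (rule div_le_mono)
    then show False using that(6) unfolding that(3)[symmetric] that(4)[symmetric] chunk_def by simp
  qed
  have no: "False" if i: "i \<in> II" and j: "j \<in> II" and eq: "z i = z j" and lt: "snd i < snd j" for i j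
  proof -
    have p: "fst i = fst j" using z[OF i] z[OF j] eq by metis
    have "fst u < fst v" if "u \<in> {q1 i, q2 i}" "v \<in> {q1 j, q2 j}" for u v
      by (rule order[of u v i j]) (use that z[OF i] z[OF j] p lt in auto)
    then have "max (fst (q1 i)) (fst (q2 i)) < min (fst (q1 j)) (fst (q2 j))" by auto
    then show False using z[OF i] z[OF j] eq by auto
  qed
  have "inj_on z II"
  proof (rule inj_onI)
    fix i j assume ij: "i \<in> II" "j \<in> II" "z i = z j"
    have "fst i = fst j" using z[OF ij(1)] z[OF ij(2)] ij(3) by metis
    moreover have "snd i = snd j" using no[OF ij] no[OF ij(2,1) ij(3)[symmetric]] by (cases "snd i" "snd j" rule: linorder_cases) auto
    ultimately show "i = j" by (rule prod_eqI)
  qed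
  moreover have "z ` II \<subseteq> {z \<in> curve_of f. sqd z p = t}" using z by blast
  ultimately have "card II \<le> card {z \<in> curve_of f. sqd z p = t}"
    by (intro card_inj_on_le circle_points)
  then show ?thesis unfolding II_def using circle_points(2)[of p t] by linarith
qed

text \<open>A chunk spans the interval between the extreme squared distances of its points, seen
  from p along one axis of the grid and from p' along the other. A cell that is hit is a pair of
  meeting intervals.\<close>

lemma cells_hit:
  assumes P: "finite P" "P \<subseteq> curve_of f" "fst ` P \<inter> bad_x = {}"
  shows "card ((\<lambda>(q, q'). (chunk P s q, chunk P s q')) ` {(q, q'). q \<in> P \<and> q' \<in> P \<and> sqd p q = sqd p' q'})
     \<le> 2 * meet_bound * card (chunk P s ` P)"
proof -
  define A where "A = (\<lambda>i. {q \<in> P. chunk P s q = i})"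
  define lo where "lo = (\<lambda>p i. Min (sqd p ` A i))"
  define hi where "hi = (\<lambda>p i. Max (sqd p ` A i))"
  have fin: "finite (sqd p ` A i)" for p :: "real \<times> real" and i using P(1) by (simp add: A_def)
  have lohi: "lo p (chunk P s q) \<le> sqd p q" "sqd p q \<le> hi p (chunk P s q)" if "q \<in> P" for p q
    unfolding lo_def hi_def using that fin by (auto intro!: Min_le Max_ge simp: A_def)
  have depth: "card {i \<in> chunk P s ` P. lo p i \<le> t \<and> t \<le> hi p i} \<le> meet_bound" for p t
  proof -
    have sub: "{i \<in> chunk P s ` P. lo p i \<le> t \<and> t \<le> hi p i} \<subseteq> {i \<in> chunk P s ` P. \<exists>q1\<in>P. \<exists>q2\<in>P. chunk P s q1 = i \<and> chunk P s q2 = i \<and> sqd p q1 \<le> t \<and> t \<le> sqd p q2}"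
    proof
      fix i assume i: "i \<in> {i \<in> chunk P s ` P. lo p i \<le> t \<and> t \<le> hi p i}"
      then have ne: "sqd p ` A i \<noteq> {}" by (auto simp: A_def)
      have "lo p i \<in> sqd p ` A i" "hi p i \<in> sqd p ` A i" unfolding lo_def hi_def
        using Min_in[OF fin ne] Max_in[OF fin ne] by auto
      then obtain q1 q2 where "q1 \<in> A i" "q2 \<in> A i" "lo p i = sqd p q1" "hi p i = sqd p q2" by blast
      then show "i \<in> {i \<in> chunk P s ` P. \<exists>q1\<in>P. \<exists>q2\<in>P. chunk P s q1 = i \<and> chunk P s q2 = i \<and> sqd p q1 \<le> t \<and> t \<le> sqd p q2}"
        using i unfolding A_def by auto
    qed
    show ?thesis
      by (rule order_trans[OF card_mono[OF _ sub] chunk_depth[OF P]]) (use P in auto)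
  qed
  show ?thesis
  proof (rule overlapping_intervals[where lo = "lo p" and hi = "hi p" and lo' = "lo p'" and hi' = "hi p'"])
    show "(\<lambda>(q, q'). (chunk P s q, chunk P s q')) ` {(q, q'). q \<in> P \<and> q' \<in> P \<and> sqd p q = sqd p' q'}
      \<subseteq> {(i, j). i \<in> chunk P s ` P \<and> j \<in> chunk P s ` P \<and> lo p i \<le> hi p' j \<and> lo p' j \<le> hi p i \<and> lo p i \<le> hi p i \<and> lo p' j \<le> hi p' j}"
    proof
      fix x assume "x \<in> (\<lambda>(q, q'). (chunk P s q, chunk P s q')) ` {(q, q'). q \<in> P \<and> q' \<in> P \<and> sqd p q = sqd p' q'}"
      then obtain w where w: "w \<in> {(q, q'). q \<in> P \<and> q' \<in> P \<and> sqd p q = sqd p' q'}"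
        "x = (\<lambda>(q, q'). (chunk P s q, chunk P s q')) w" by blast
      obtain q q' where "w = (q, q')" by (cases w)
      then have x: "x = (chunk P s q, chunk P s q')" "q \<in> P" "q' \<in> P" "sqd p q = sqd p' q'" using w by auto
      then show "x \<in> {(i, j). i \<in> chunk P s ` P \<and> j \<in> chunk P s ` P \<and> lo p i \<le> hi p' j \<and> lo p' j \<le> hi p i \<and> lo p i \<le> hi p i \<and> lo p' j \<le> hi p' j}"
        using lohi[OF x(2), of p] lohi[OF x(3), of p'] by auto
    qed
  qed (use P depth in auto)
qed

end

section \<open>Counting equal distances\<close>

definition energy :: "(real \<times> real) set \<Rightarrow> nat" where
  "energy P = (\<Sum>c\<in>P \<times> P. card {w \<in> P \<times> P. sqd (fst c) (fst w) = sqd (snd c) (snd w)})"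

context curve
begin

text \<open>The summands belong to grid points matched by an isometry, to the cells that are hit,
  and to unrelated pairs inside a cell.\<close>

definition energy_const :: nat where
  "energy_const = 2 * meet_bound * meet_bound + 4 * meet_bound * piece_bound * (meet_bound * related_bound + 1) + pair_bound"

text \<open>The exceptional grid points \<open>Sy\<close> number O(n) and each lies on O(n) curves,
  a total of O(n^2). For the others, \<open>cell_count\<close> is applied to each curve and summed
  over all (p, p').\<close>

lemma energy_le:
  assumes inf: "infinite (curve_of f)"
    and P: "finite P" "P \<subseteq> curve_of f" "fst ` P \<inter> bad_x = {}"
    and s: "s > 0" "card P \<le> s ^ 3"
  shows "energy P \<le> energy_const * (card P)\<^sup>2 * s\<^sup>2"
proof -
  define n where "n = card P"
  define PP where "PP = P \<times> P"
  define inc where "inc = (\<lambda>(c :: (real\<times>real)\<times>(real\<times>real)) w. sqd (fst c) (fst w) = sqd (snd c) (snd w))"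
  define Sy where "Sy = {w \<in> PP. \<exists>U. symm U \<and> U (fst w) = snd w}"
  define rel where "rel = (\<lambda>w v. related (fst w) (snd w) (fst v) (snd v))"
  define cell where "cell = (\<lambda>w. (chunk P s (fst w), chunk P s (snd w)))"
  define M where "M = meet_bound * related_bound + 1"
  define r where "r = card (chunk P s ` P)"
  have finPP: "finite PP" using P by (simp add: PP_def)
  have cPP: "card PP = n\<^sup>2" by (simp add: PP_def n_def card_cartesian_product power2_eq_square)
  have mem: "fst w \<in> P" "snd w \<in> P" "fst w \<in> curve_of f" "snd w \<in> curve_of f" if "w \<in> PP" for w
    using that P(2) by (auto simp: PP_def)
  have finSy: "finite Sy" using finPP by (simp add: Sy_def)
  have cSy: "card Sy \<le> n * (2 * meet_bound)"
  proof -
    have "card Sy \<le> card (fst ` Sy) * (2 * meet_bound)"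
    proof (rule card_le_fibres[OF finSy])
      fix w assume "w \<in> Sy"
      then have q: "fst w \<in> curve_of f" using mem by (simp add: Sy_def)
      have "{v \<in> Sy. fst v = fst w} \<subseteq> Pair (fst w) ` {U (fst w) | U. symm U}"
      proof
        fix v assume v: "v \<in> {v \<in> Sy. fst v = fst w}"
        then obtain U where "symm U" "U (fst w) = snd v" by (auto simp: Sy_def)
        then have "\<exists>U. snd v = U (fst w) \<and> symm U" by metis
        then have "snd v \<in> {U (fst w) | U. symm U}" by simp
        moreover have "v = (fst w, snd v)" using v by (cases v) simp
        ultimately show "v \<in> Pair (fst w) ` {U (fst w) | U. symm U}" by (rule rev_image_eqI)
      qed
      then have "card {v \<in> Sy. fst v = fst w} \<le> card (Pair (fst w) ` {U (fst w) | U. symm U})"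
        by (intro card_mono finite_imageI symm_images inf q)
      also have "\<dots> \<le> 2 * meet_bound"
        by (rule order_trans[OF card_image_le[OF symm_images(1)[OF inf q]] symm_images(2)[OF inf q]])
      finally show "card {v \<in> Sy. fst v = fst w} \<le> 2 * meet_bound" .
    qed
    also have "card (fst ` Sy) \<le> n" unfolding n_def using P mem by (intro card_mono) (auto simp: Sy_def)
    finally show ?thesis by simp
  qed
  have inc1: "card {c \<in> PP. inc c w} \<le> n * meet_bound" for w
  proof -
    have fin: "finite {c \<in> PP. inc c w}" using finPP by simp
    have "card {c \<in> PP. inc c w} \<le> card (fst ` {c \<in> PP. inc c w}) * meet_bound"
    proof (rule card_le_fibres[OF fin])
      fix c assume "c \<in> {c \<in> PP. inc c w}"
      have "{v \<in> {c \<in> PP. inc c w}. fst v = fst c} \<subseteq> Pair (fst c) ` {p \<in> curve_of f. sqd p (snd w) = sqd (fst c) (fst w)}"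
      proof
        fix v assume v: "v \<in> {v \<in> {c \<in> PP. inc c w}. fst v = fst c}"
        then have v1: "inc v w" and v2: "fst v = fst c" and v3: "v \<in> PP" by simp_all
        have "sqd (snd v) (snd w) = sqd (fst c) (fst w)" using v1 unfolding inc_def v2 by (rule sym)
        then have "snd v \<in> {p \<in> curve_of f. sqd p (snd w) = sqd (fst c) (fst w)}"
          using mem[OF v3] by simp
        moreover have "v = (fst c, snd v)" using v by (cases v) simp
        ultimately show "v \<in> Pair (fst c) ` {p \<in> curve_of f. sqd p (snd w) = sqd (fst c) (fst w)}"
          by (rule rev_image_eqI)
      qed
      then have "card {v \<in> {c \<in> PP. inc c w}. fst v = fst c} \<le> card (Pair (fst c) ` {p \<in> curve_of f. sqd p (snd w) = sqd (fst c) (fst w)})"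
        by (intro card_mono finite_imageI circle_points)
      also have "\<dots> \<le> meet_bound" by (rule order_trans[OF card_image_le[OF circle_points(1)] circle_points(2)])
      finally show "card {v \<in> {c \<in> PP. inc c w}. fst v = fst c} \<le> meet_bound" .
    qed
    also have "card (fst ` {c \<in> PP. inc c w}) \<le> n" unfolding n_def using P mem by (intro card_mono) auto
    finally show ?thesis by simp
  qed
  \<comment> \<open>With more related grid points, w would be matched by an isometry and hence
    belong to \<open>Sy\<close>.\<close>
  have relM: "card {v \<in> PP. rel w v} \<le> M" if w: "w \<in> PP - Sy" for w
  proof (rule ccontr)
    assume "\<not> ?thesis"
    then have c: "card {v \<in> PP. rel w v} > meet_bound * related_bound + 1" by (simp add: M_def)
    have "\<exists>U. symm U \<and> U (fst w) = snd w"
      by (rule many_related_symm[OF inf _ _ _ c]) (use finPP mem w in \<open>auto simp: rel_def mem_Times_iff\<close>)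
    then show False using w by (simp add: Sy_def)
  qed
  define N where "N = (\<lambda>c. {w \<in> PP - Sy. inc c w})"
  have finN: "finite (N c)" for c using finPP by (simp add: N_def)
  define T where "T = {(w, v). w \<in> PP \<and> v \<in> PP \<and> cell w = cell v \<and> \<not> rel w v}"
  have finT: "finite T" by (rule finite_subset[of _ "PP \<times> PP"]) (use finPP in \<open>auto simp: T_def\<close>)
  have Nc: "card (N c) \<le> 2 * meet_bound * r * M + card {x \<in> T. inc c (fst x) \<and> inc c (snd x)}" for c
  proof -
    have "card (N c) \<le> card (cell ` N c) * M + card {(w, v). w \<in> N c \<and> v \<in> N c \<and> cell w = cell v \<and> \<not> rel w v}"
    proof (rule cell_count[OF finN])
      fix w assume "w \<in> N c"
      then have "card {v \<in> PP. rel w v} \<le> M" by (intro relM) (simp add: N_def)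
      moreover have "card {v \<in> N c. rel w v} \<le> card {v \<in> PP. rel w v}"
        using finPP by (intro card_mono) (auto simp: N_def)
      ultimately show "card {v \<in> N c. rel w v} \<le> M" by simp
    qed
    moreover have "card (cell ` N c) \<le> 2 * meet_bound * r"
    proof -
      define H where "H = (\<lambda>(q, q'). (chunk P s q, chunk P s q')) ` {(q, q'). q \<in> P \<and> q' \<in> P \<and> sqd (fst c) q = sqd (snd c) q'}"
      have "cell ` N c \<subseteq> H"
        unfolding H_def N_def cell_def by (rule image_subsetI, rule image_eqI) (auto simp: inc_def PP_def)
      moreover have "finite {(q, q'). q \<in> P \<and> q' \<in> P \<and> sqd (fst c) q = sqd (snd c) q'}"
        by (rule finite_subset[of _ "P \<times> P"]) (use P in auto)
      then have "finite H" unfolding H_def by (rule finite_imageI)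
      moreover have "card H \<le> 2 * meet_bound * r" unfolding H_def r_def by (rule cells_hit[OF P])
      ultimately show ?thesis by (meson card_mono le_trans)
    qed
    moreover have "card {(w, v). w \<in> N c \<and> v \<in> N c \<and> cell w = cell v \<and> \<not> rel w v} \<le> card {x \<in> T. inc c (fst x) \<and> inc c (snd x)}"
      using finT by (intro card_mono) (auto simp: T_def N_def)
    ultimately show ?thesis by (meson add_mono le_trans mult_le_mono1)
  qed
  have cT: "card T \<le> n\<^sup>2 * s\<^sup>2"
  proof -
    have sub: "T \<subseteq> Sigma PP (\<lambda>w. {v \<in> PP. cell v = cell w})" by (auto simp: T_def)
    have "card {v \<in> PP. cell v = cell w} \<le> s\<^sup>2" for w
    proof -
      have "{v \<in> PP. cell v = cell w} \<subseteq> {q \<in> P. chunk P s q = chunk P s (fst w)} \<times> {q \<in> P. chunk P s q = chunk P s (snd w)}"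
        by (auto simp: PP_def cell_def)
      then have "card {v \<in> PP. cell v = cell w} \<le> card ({q \<in> P. chunk P s q = chunk P s (fst w)} \<times> {q \<in> P. chunk P s q = chunk P s (snd w)})"
        using P(1) by (intro card_mono) auto
      also have "\<dots> \<le> s * s" unfolding card_cartesian_product
        by (intro mult_mono chunk_size P s) auto
      finally show ?thesis by (simp add: power2_eq_square)
    qed
    then have "(\<Sum>w\<in>PP. card {v \<in> PP. cell v = cell w}) \<le> (\<Sum>w\<in>PP. s\<^sup>2)" by (intro sum_mono)
    then have "card (Sigma PP (\<lambda>w. {v \<in> PP. cell v = cell w})) \<le> n\<^sup>2 * s\<^sup>2"
      using finPP cPP by (subst card_SigmaI) auto
    then show ?thesis using card_mono[OF _ sub] finPP by fastforce
  qed
  have TK: "card {c \<in> PP. inc c (fst x) \<and> inc c (snd x)} \<le> pair_bound" if x: "x \<in> T" for x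
  proof (rule ccontr)
    assume "\<not> ?thesis"
    moreover have "{c \<in> PP. inc c (fst x) \<and> inc c (snd x)} \<subseteq> common_pairs (fst (fst x)) (snd (fst x)) (fst (snd x)) (snd (snd x))"
      using mem by (auto simp: common_pairs_def inc_def)
    ultimately have "rel (fst x) (snd x)" unfolding rel_def related_def using finPP
      by (intro exI[of _ "{c \<in> PP. inc c (fst x) \<and> inc c (snd x)}"]) auto
    then show False using x by (auto simp: T_def)
  qed
  \<comment> \<open>Here n \<le> s^3 makes the cell term n^2 * (n/s) no larger than the pair term
    n^2 * s^2.\<close>
  have nr: "n div s \<le> s\<^sup>2"
  proof -
    have "n div s \<le> s ^ 3 div s" unfolding n_def using s(2) by (rule div_le_mono)
    also have "\<dots> = s\<^sup>2" using s(1) by (simp add: power3_eq_cube power2_eq_square)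
    finally show ?thesis .
  qed
  have "s\<^sup>2 \<ge> 1" using s(1) by simp
  then have "n div s + 1 \<le> 2 * s\<^sup>2" using nr by linarith
  then have rs: "r \<le> piece_bound * (2 * s\<^sup>2)"
    using chunk_count[OF P(1,2), of s] mult_le_mono2 unfolding r_def n_def by (meson le_trans)
  have "energy P = (\<Sum>c\<in>PP. card {w \<in> PP. inc c w})" by (simp add: energy_def PP_def inc_def)
  also have "\<dots> \<le> (\<Sum>c\<in>PP. card {w \<in> Sy. inc c w} + card (N c))"
  proof (rule sum_mono)
    fix c
    have "{w \<in> PP. inc c w} = {w \<in> Sy. inc c w} \<union> N c" by (auto simp: N_def Sy_def)
    then show "card {w \<in> PP. inc c w} \<le> card {w \<in> Sy. inc c w} + card (N c)" 
      using card_Un_le[of "{w \<in> Sy. inc c w}" "N c"] by simp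
  qed
  also have "\<dots> = (\<Sum>c\<in>PP. card {w \<in> Sy. inc c w}) + (\<Sum>c\<in>PP. card (N c))" by (rule sum.distrib)
  also have "(\<Sum>c\<in>PP. card {w \<in> Sy. inc c w}) = (\<Sum>w\<in>Sy. card {c \<in> PP. inc c w})"
    by (rule double_count[OF finPP finSy])
  also have "\<dots> \<le> (\<Sum>w\<in>Sy. n * meet_bound)" by (intro sum_mono inc1)
  also have "\<dots> \<le> (n * (2 * meet_bound)) * (n * meet_bound)" using cSy by simp
  also have "(\<Sum>c\<in>PP. card (N c)) \<le> (\<Sum>c\<in>PP. 2 * meet_bound * r * M + card {x \<in> T. inc c (fst x) \<and> inc c (snd x)})"
    by (intro sum_mono Nc)
  also have "\<dots> = n\<^sup>2 * (2 * meet_bound * r * M) + (\<Sum>c\<in>PP. card {x \<in> T. inc c (fst x) \<and> inc c (snd x)})"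
    by (simp add: sum.distrib cPP)
  \<comment> \<open>Counted the other way round, an unrelated pair of grid points lies on at most
    \<open>pair_bound\<close> curves.\<close>
  also have "(\<Sum>c\<in>PP. card {x \<in> T. inc c (fst x) \<and> inc c (snd x)}) = (\<Sum>x\<in>T. card {c \<in> PP. inc c (fst x) \<and> inc c (snd x)})"
    by (rule double_count[OF finPP finT])
  also have "\<dots> \<le> (\<Sum>x\<in>T. pair_bound)" by (intro sum_mono TK)
  also have "\<dots> \<le> (n\<^sup>2 * s\<^sup>2) * pair_bound" using cT by simp
  finally have E: "energy P \<le> n * (2 * meet_bound) * (n * meet_bound) + (n\<^sup>2 * (2 * meet_bound * r * M) + (n\<^sup>2 * s\<^sup>2) * pair_bound)" by simp
  have "n * (2 * meet_bound) * (n * meet_bound) = (2 * meet_bound * meet_bound) * n\<^sup>2 * 1" by (simp add: power2_eq_square)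
  also have "\<dots> \<le> (2 * meet_bound * meet_bound) * n\<^sup>2 * s\<^sup>2" using \<open>s\<^sup>2 \<ge> 1\<close> by (intro mult_le_mono2)
  finally have E1: "n * (2 * meet_bound) * (n * meet_bound) \<le> (2 * meet_bound * meet_bound) * n\<^sup>2 * s\<^sup>2" .
  have "n\<^sup>2 * (2 * meet_bound * r * M) \<le> n\<^sup>2 * (2 * meet_bound * (piece_bound * (2 * s\<^sup>2)) * M)"
    using rs by (intro mult_le_mono) auto
  also have "\<dots> = (4 * meet_bound * piece_bound * M) * n\<^sup>2 * s\<^sup>2" by (simp add: mult_ac)
  finally have E2: "n\<^sup>2 * (2 * meet_bound * r * M) \<le> (4 * meet_bound * piece_bound * M) * n\<^sup>2 * s\<^sup>2" .
  have "energy_const * n\<^sup>2 * s\<^sup>2 = (2 * meet_bound * meet_bound) * n\<^sup>2 * s\<^sup>2 + ((4 * meet_bound * piece_bound * M) * n\<^sup>2 * s\<^sup>2 + (n\<^sup>2 * s\<^sup>2) * pair_bound)"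
    by (simp add: energy_const_def M_def algebra_simps)
  then show ?thesis using E E1 E2 unfolding n_def by linarith
qed

end

text \<open>Regrouping ((p, p'), (q, q')) as ((p, q), (p', q')) turns the energy into the sum of
  squared multiplicities of the distances, to which Cauchy-Schwarz applies. The added 1 is the value
  0, attained by pairs (p, p).\<close>

lemma energy_ge:
  assumes P: "finite P"
  shows "(real (card P)) ^ 4 \<le> real (card (distances P) + 1) * real (energy P)"
proof -
  define PP where "PP = P \<times> P"
  define \<sigma> where "\<sigma> = (\<lambda>a. sqd (fst a) (snd a) :: real)"
  define V where "V = \<sigma> ` PP"
  define m where "m = (\<lambda>t. card {a \<in> PP. \<sigma> a = t})"
  have finPP: "finite PP" using P by (simp add: PP_def)
  have finV: "finite V" using finPP by (simp add: V_def)
  have "distances P = (\<lambda>a. eucl_dist2 (fst a) (snd a)) ` {a \<in> PP. fst a \<noteq> snd a}"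
    by (force simp: distances_def PP_def image_iff)
  then have finD: "finite (distances P)" using finPP by simp
  have "V \<subseteq> insert 0 ((\<lambda>x. x\<^sup>2) ` distances P)"
  proof
    fix t assume "t \<in> V"
    then obtain u v where uv: "u \<in> P" "v \<in> P" "t = sqd u v" by (auto simp: V_def \<sigma>_def PP_def)
    show "t \<in> insert 0 ((\<lambda>x. x\<^sup>2) ` distances P)"
    proof (cases "u = v")
      case True
      then show ?thesis using uv by (simp add: sqd_eq_0_iff)
    next
      case False
      then have "eucl_dist2 u v \<in> distances P" using uv unfolding distances_def by blast
      moreover have "t = (eucl_dist2 u v)\<^sup>2" by (simp add: uv(3) eucl_dist2_def sqd_def)
      ultimately show ?thesis by blast
    qed
  qed
  then have "card V \<le> card (insert 0 ((\<lambda>x. x\<^sup>2) ` distances P))" using finD by (intro card_mono) auto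
  also have "\<dots> \<le> card (distances P) + 1"
    using card_insert_le_m1 card_image_le[OF finD, of "\<lambda>x. x\<^sup>2"] finD
    by (metis Suc_eq_plus1 Suc_le_mono card_insert_if finite_imageI le_SucI)
  finally have cV: "card V \<le> card (distances P) + 1" .
  define X where "X = Sigma PP (\<lambda>c. {w \<in> PP. sqd (fst c) (fst w) = sqd (snd c) (snd w)})"
  define Y where "Y = Sigma PP (\<lambda>a. {b \<in> PP. \<sigma> b = \<sigma> a})"
  \<comment> \<open>Swaps the two middle entries of a quadruple; it is its own inverse.\<close>
  define sw where "sw = (\<lambda>x::((real\<times>real)\<times>(real\<times>real))\<times>((real\<times>real)\<times>(real\<times>real)).
     ((fst (fst x), fst (snd x)), (snd (fst x), snd (snd x))))"
  have "energy P = card X" unfolding energy_def X_def PP_def[symmetric] using finPP by (subst card_SigmaI) auto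
  also have "\<dots> = card Y"
  proof (rule bij_betw_same_card)
    show "bij_betw sw X Y"
      by (rule bij_betw_byWitness[where f' = sw]) (auto simp: sw_def X_def Y_def PP_def \<sigma>_def)
  qed
  also have "\<dots> = (\<Sum>a\<in>PP. m (\<sigma> a))" unfolding Y_def m_def using finPP by (subst card_SigmaI) auto
  also have "\<dots> = (\<Sum>t\<in>V. \<Sum>a\<in>{a \<in> PP. \<sigma> a = t}. m (\<sigma> a))"
    unfolding V_def by (rule sum.image_gen[OF finPP])
  also have "\<dots> = (\<Sum>t\<in>V. (m t)\<^sup>2)"
  proof (rule sum.cong[OF refl])
    fix t assume "t \<in> V"
    have "(\<Sum>a\<in>{a \<in> PP. \<sigma> a = t}. m (\<sigma> a)) = (\<Sum>a\<in>{a \<in> PP. \<sigma> a = t}. m t)" by (intro sum.cong) auto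
    also have "\<dots> = (m t)\<^sup>2" by (simp add: m_def power2_eq_square)
    finally show "(\<Sum>a\<in>{a \<in> PP. \<sigma> a = t}. m (\<sigma> a)) = (m t)\<^sup>2" .
  qed
  finally have en: "real (energy P) = (\<Sum>t\<in>V. (real (m t))\<^sup>2)" by simp
  have "card PP = (\<Sum>t\<in>V. m t)" unfolding V_def m_def by (rule card_fibre_sum[OF finPP])
  then have "(real (card P))\<^sup>2 = (\<Sum>t\<in>V. real (m t))" 
    by (simp add: PP_def card_cartesian_product power2_eq_square flip: of_nat_mult of_nat_sum)
  then have "(real (card P)) ^ 4 = (\<Sum>t\<in>V. real (m t))\<^sup>2" by (metis power2_eq_square power4_eq_xxxx mult.assoc)
  also have "\<dots> \<le> (\<Sum>t\<in>V. (real (m t))\<^sup>2) * real (card V)" by (rule sum_squared_le_sum_of_squares)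
  also have "\<dots> \<le> real (energy P) * real (card (distances P) + 1)"
    unfolding en using cV by (intro mult_left_mono sum_nonneg) auto
  finally show ?thesis by (simp add: mult.commute)
qed

section \<open>Transfer from coefficient functions to nested polynomials, and assembly of the
  bound\<close>

lemma evx_sum: "evx (\<Sum>i\<in>I. p i) x = (\<Sum>i\<in>I. evx (p i) x)"
  by (induction I rule: infinite_finite_induct) auto

lemma ev_sum: "ev (\<Sum>i\<in>I. p i) x y = (\<Sum>i\<in>I. ev (p i) x y)"
  by (induction I rule: infinite_finite_induct) auto

lemma evx_monom: "evx (monom c i) x = of_real c * x ^ i"
  by (simp add: evx_def map_poly_monom poly_monom)

lemma ev_monom: "ev (monom c j) x y = evx c x * y ^ j"
  by (simp add: ev_def map_poly_monom poly_monom)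

lemma zero_set2_as_curve_of:
  assumes "poly2_deg_le a N" "poly2_nonzero a"
  shows "\<exists>f. f \<noteq> 0 \<and> bideg_le f N \<and> curve_of f = zero_set2 a N"
proof -
  define g where "g = (\<lambda>j. \<Sum>i\<le>N. monom (a i j) i)"
  define f where "f = (\<Sum>j\<le>N. monom (g j) j)"
  have cg: "coeff (g j) i = (if i \<le> N then a i j else 0)" for i j
    by (simp add: g_def coeff_sum)
  have cf: "coeff f j = (if j \<le> N then g j else 0)" for j
    by (simp add: f_def coeff_sum)
  obtain i j where ij: "a i j \<noteq> 0" using assms(2) by (auto simp: poly2_nonzero_def)
  then have "i + j \<le> N" using assms(1) unfolding poly2_deg_le_def by blast
  then have "i \<le> N" "j \<le> N" by linarith+
  then have "coeff (coeff f j) i \<noteq> 0" using ij by (simp add: cf cg)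
  then have "f \<noteq> 0" by auto
  moreover have "bideg_le f N"
    unfolding bideg_le_def
    by (intro conjI allI degree_le) (auto simp: cf cg)
  moreover have "ev f x y = poly2_eval a N x y" for x y :: real
  proof -
    have "ev f x y = (\<Sum>j\<le>N. \<Sum>i\<le>N. a i j * x ^ i * y ^ j)"
      unfolding f_def g_def ev_sum ev_monom evx_sum evx_monom by (simp add: sum_distrib_right)
    also have "\<dots> = (\<Sum>i\<le>N. \<Sum>j\<le>N. a i j * x ^ i * y ^ j)" by (rule sum.swap)
    finally show ?thesis by (simp add: poly2_eval_def)
  qed
  then have "curve_of f = zero_set2 a N" by (auto simp: curve_of_def zero_set2_def)
  ultimately show ?thesis by blast
qed

lemma finite_distances: "finite P \<Longrightarrow> finite (distances P)"
proof -
  assume "finite P"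
  then have "finite ((\<lambda>a. eucl_dist2 (fst a) (snd a)) ` (P \<times> P))" by simp
  moreover have "distances P \<subseteq> (\<lambda>a. eucl_dist2 (fst a) (snd a)) ` (P \<times> P)"
    by (force simp: distances_def)
  ultimately show ?thesis by (rule finite_subset[rotated])
qed

lemma distances_mono: "P \<subseteq> Q \<Longrightarrow> distances P \<subseteq> distances Q"
  unfolding distances_def by blast

lemma distances_nonempty:
  assumes "finite P" "card P \<ge> 2"
  shows "card (distances P) \<ge> 1"
proof -
  have "\<not> card P \<le> Suc 0" using assms(2) by simp
  then obtain u v where "u \<in> P" "v \<in> P" "u \<noteq> v" using card_le_Suc0_iff_eq[OF assms(1)] by blast
  then have "eucl_dist2 u v \<in> distances P" unfolding distances_def by blast
  then show ?thesis using finite_distances[OF assms(1)] by (metis One_nat_def Suc_leI card_gt_0_iff empty_iff)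
qed

context curve
begin

text \<open>With s the rounded-up cube root, the two energy bounds leave n^2 at most a constant
  times (D + 1) * n^(2/3), for D the number of distances. The 4 is the square of the rounding loss s
  \<le> 2 n^(1/3).\<close>

lemma distances_good_points:
  assumes P: "finite P" "P \<noteq> {}" "P \<subseteq> curve_of f" "fst ` P \<inter> bad_x = {}"
  shows "real (card P) powr (4/3) \<le> real (card (distances P) + 1) * (4 * real energy_const)"
proof -
  define n where "n = real (card P)"
  have n: "n \<ge> 1" using P(1,2) by (simp add: n_def Suc_leI card_gt_0_iff)
  define s where "s = nat \<lceil>n powr (1/3)\<rceil>"
  have r1: "n powr (1/3) \<ge> 1" using n by (simp add: ge_one_powr_ge_zero)
  have s1: "n powr (1/3) \<le> real s" unfolding s_def by linarith
  have s2: "real s \<le> 2 * n powr (1/3)" using r1 unfolding s_def by linarith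
  have s0: "s > 0" using s1 r1 by (cases s) auto
  have "n = (n powr (1/3)) ^ 3" using n by (simp add: powr_power)
  also have "\<dots> \<le> real s ^ 3" using s1 by (intro power_mono) auto
  finally have "card P \<le> s ^ 3" unfolding n_def by (metis of_nat_le_iff of_nat_power)
  moreover obtain q where "q \<in> P" using P(2) by blast
  then have "infinite (curve_of f)" using P(3,4) by (intro curve_infinite[of q]) auto
  ultimately have E: "energy P \<le> energy_const * (card P)\<^sup>2 * s\<^sup>2" using P s0 by (intro energy_le) auto
  define D where "D = real (card (distances P) + 1)"
  have "n ^ 4 \<le> D * real (energy P)" unfolding n_def D_def by (rule energy_ge[OF P(1)])
  also have "\<dots> \<le> D * (real energy_const * n\<^sup>2 * (real s)\<^sup>2)"
    using E unfolding n_def D_def 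
    by (intro mult_left_mono) (simp_all flip: of_nat_mult of_nat_power)
  also have "\<dots> \<le> D * (real energy_const * n\<^sup>2 * (2 * n powr (1/3))\<^sup>2)"
    using s2 by (intro mult_left_mono power_mono) (auto simp: D_def)
  also have "\<dots> = (D * (4 * real energy_const) * (n powr (1/3))\<^sup>2) * n\<^sup>2" by (simp add: power_mult_distrib)
  finally have "n\<^sup>2 * n\<^sup>2 \<le> (D * (4 * real energy_const) * (n powr (1/3))\<^sup>2) * n\<^sup>2" by (simp add: power4_eq_xxxx power2_eq_square)
  moreover have "n\<^sup>2 > 0" using n by simp
  ultimately have "n\<^sup>2 \<le> D * (4 * real energy_const) * (n powr (1/3))\<^sup>2" by (simp only: mult_le_cancel_right_pos)
  moreover have "n\<^sup>2 = n powr (4/3) * (n powr (1/3))\<^sup>2"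
  proof -
    have "n powr (4/3) * (n powr (1/3))\<^sup>2 = n powr (4/3) * n powr (2/3)" using n by (simp add: powr_power)
    also have "\<dots> = n powr 2" by (simp flip: powr_add)
    also have "\<dots> = n\<^sup>2" using n by simp
    finally show ?thesis by simp
  qed
  moreover have "(n powr (1/3))\<^sup>2 > 0" using r1 by (intro zero_less_power) linarith
  ultimately have "n powr (4/3) \<le> D * (4 * real energy_const)" by (simp only: mult_le_cancel_right_pos)
  then show ?thesis by (simp add: n_def D_def)
qed

lemma card_bad_points:
  assumes "finite P" "P \<subseteq> curve_of f"
  shows "card {q \<in> P. fst q \<in> bad_x} \<le> ((2 * d)\<^sup>2 + d) * d"
proof -
  have sub: "{q \<in> P. fst q \<in> bad_x} \<subseteq> Sigma bad_x (\<lambda>x. {y. ev f x y = 0})"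
    using assms(2) by (auto simp: curve_of_def)
  have "card {q \<in> P. fst q \<in> bad_x} \<le> card (Sigma bad_x (\<lambda>x. {y. ev f x y = 0}))"
    using sub finite_bad_x fibre(1) by (intro card_mono) auto
  also have "\<dots> = (\<Sum>x\<in>bad_x. card {y. ev f x y = 0})" using finite_bad_x fibre(1) by (intro card_SigmaI) auto
  also have "\<dots> \<le> (\<Sum>x\<in>bad_x. d)" by (intro sum_mono fibre)
  also have "\<dots> \<le> ((2 * d)\<^sup>2 + d) * d" using card_bad_x by simp
  finally show ?thesis .
qed

end

theorem theorem1p1:
  fixes d :: nat
  assumes "d \<ge> 1"
  shows "\<exists>c::real. c > 0 \<and>
    (\<forall>C P. algebraic_curve_of_degree C d \<longrightarrow> \<not> contains_line C \<longrightarrow>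
       \<not> contains_circle C \<longrightarrow> finite P \<longrightarrow> P \<subseteq> C \<longrightarrow> card P \<ge> 2 \<longrightarrow>
       real (card (distances P)) \<ge> c * real (card P) powr (4/3))"
proof -
  define e where "e = ((2 * d)\<^sup>2 + d) * d"
  \<comment> \<open>The largest possible size of P when the chosen component carries at most 2e + 1
    of its points.\<close>
  define n0 where "n0 = 2 ^ (2 * d) * (2 * e + 1)"
  define A :: real where "A = 2 ^ (2 * d) * 2"
  \<comment> \<open>\<open>curve.energy_const\<close> takes only \<open>d\<close>, so
    \<open>B\<close> is fixed before the curve. The 8 is 4 * 2, where the 2 absorbs the 1 added to
    the number of distances; the last summand covers small sets.\<close>
  define B where "B = A powr (4/3) * (8 * real (curve.energy_const d)) + real n0 powr (4/3)"
  have "n0 > 0" by (simp add: n0_def)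
  then have n01: "real n0 \<ge> 1" by simp
  then have B: "B > 0" unfolding B_def by (intro add_nonneg_pos) auto
  have main: "real (card P) powr (4/3) \<le> B * real (card (distances P))"
    if C: "algebraic_curve_of_degree C d" "\<not> contains_line C" "\<not> contains_circle C"
      and P: "finite P" "P \<subseteq> C" "card P \<ge> 2" for C P
  proof -
    obtain a where a: "poly2_deg_le a d" "poly2_nonzero a" "C = zero_set2 a d"
      using C(1) unfolding algebraic_curve_of_degree_def curve_deg_le_def by blast
    obtain f0 where f0: "f0 \<noteq> 0" "bideg_le f0 d" "curve_of f0 = C"
      using zero_set2_as_curve_of[OF a(1,2)] a(3) by blast
    obtain f where f: "irreducible f" "bideg_le f d" "curve_of f \<subseteq> C"
      "card P \<le> 2 ^ (2 * d) * card (P \<inter> curve_of f)"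
      using irreducible_factor_rich[OF f0(1,2) P(1)] P f0(3) by fastforce
    define P1 where "P1 = P \<inter> curve_of f"
    have D1: "real (card (distances P)) \<ge> 1" using distances_nonempty[OF P(1,3)] by simp
    show ?thesis
    proof (cases "card P1 \<le> 2 * e + 1")
      case True
      then have "card P \<le> n0" using f(4) unfolding n0_def P1_def by (meson le_trans mult_le_mono2)
      then have "real (card P) powr (4/3) \<le> real n0 powr (4/3)" by (intro powr_mono2) auto
      also have "\<dots> \<le> real n0 powr (4/3) * real (card (distances P))" using D1 by (simp add: mult_le_cancel_left1)
      also have "\<dots> \<le> B * real (card (distances P))" unfolding B_def by (intro mult_right_mono) auto
      finally show ?thesis .
    next
      case False
      have finP1: "finite P1" using P by (simp add: P1_def)
      have "\<not> card P1 \<le> Suc 0" using False by simp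
      then obtain u v where uv: "u \<in> P1" "v \<in> P1" "u \<noteq> v" using card_le_Suc0_iff_eq[OF finP1] by blast
      interpret curve f d
      proof
        show "\<not> contains_line (curve_of f)" using C(2) f(3) unfolding contains_line_def by blast
        show "\<not> contains_circle (curve_of f)" using C(3) f(3) unfolding contains_circle_def by blast
        show "\<exists>u\<in>curve_of f. \<exists>v\<in>curve_of f. u \<noteq> v" using uv by (auto simp: P1_def)
      qed (use f in auto)
      define P2 where "P2 = {q \<in> P1. fst q \<notin> bad_x}"
      have sub: "P1 \<subseteq> curve_of f" by (simp add: P1_def)
      have "card P1 = card (P2 \<union> {q \<in> P1. fst q \<in> bad_x})" by (rule arg_cong[of _ _ card]) (auto simp: P2_def)
      also have "\<dots> \<le> card P2 + e" 
        using card_Un_le[of P2 "{q \<in> P1. fst q \<in> bad_x}"] card_bad_points[OF finP1 sub] unfolding e_def by linarith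
      \<comment> \<open>More than 2e + 1 points minus at most e over bad abscissae leaves at least
        half.\<close>
      finally have c2: "card P1 \<le> 2 * card P2" and P2ne: "card P2 > 0" using False by linarith+
      have "real (card P) \<le> A * real (card P2)"
      proof -
        have "card P \<le> 2 ^ (2 * d) * (2 * card P2)" using f(4) c2 unfolding P1_def by (meson le_trans mult_le_mono2)
        then have "real (card P) \<le> real (2 ^ (2 * d) * (2 * card P2))" by (simp only: of_nat_le_iff)
        then show ?thesis by (simp add: A_def)
      qed
      then have "real (card P) powr (4/3) \<le> (A * real (card P2)) powr (4/3)" by (intro powr_mono2) auto
      also have "\<dots> = A powr (4/3) * real (card P2) powr (4/3)" by (rule powr_mult)
      also have "real (card P2) powr (4/3) \<le> real (card (distances P2) + 1) * (4 * real energy_const)"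
      proof (rule distances_good_points)
        show "P2 \<noteq> {}" using P2ne by auto
      qed (use finP1 sub in \<open>auto simp: P2_def\<close>)
      also have "\<dots> \<le> (2 * real (card (distances P))) * (4 * real energy_const)"
      proof (intro mult_right_mono)
        have "distances P2 \<subseteq> distances P" by (rule distances_mono) (auto simp: P2_def P1_def)
        then have "card (distances P2) \<le> card (distances P)" by (intro card_mono finite_distances P(1))
        then show "real (card (distances P2) + 1) \<le> 2 * real (card (distances P))" using D1 by simp
      qed simp
      finally have "real (card P) powr (4/3) \<le> A powr (4/3) * ((2 * real (card (distances P))) * (4 * real energy_const))"
        by (simp add: mult_left_mono)
      also have "\<dots> = (A powr (4/3) * (8 * real energy_const)) * real (card (distances P))" by simp
      also have "\<dots> \<le> B * real (card (distances P))" unfolding B_def by (intro mult_right_mono) auto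
      finally show ?thesis .
    qed
  qed
  show ?thesis
  proof (intro exI[of _ "1 / B"] conjI allI impI)
    show "1 / B > 0" using B by simp
    fix C P
    assume "algebraic_curve_of_degree C d" "\<not> contains_line C" "\<not> contains_circle C" "finite P" "P \<subseteq> C" "card P \<ge> 2"
    from main[OF this] show "real (card (distances P)) \<ge> 1 / B * real (card P) powr (4/3)"
      using B by (simp add: field_simps)
  qed
qed

end
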